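(* Let $\Sigma=(\Gamma,\sigma)$ be a signed graph (not necessarily simple). (a) The following are equivalent: (i) $\Sigma$ satisfies Property 2; (ii) $\Sigma$ is obtained by Construction A; (iii) $\Sigma$ is obtained by Construction B; (iv) $\Sigma$ is obtained by Construction C. (b) If moreover $\Sigma$ is a signed simple graph, the following are equivalent: (i) the naturally vertex-signed line graph $\Lambda_\sigma(\Sigma)$ is consistent; (ii) $\Sigma$ is obtained by Construction A (equivalently by Construction B or Construction C) and $\Sigma$ is balanced; (iii) $\Sigma$ is obtained by Construction D.
   Context: Graphs and signs. - Graphs may have loops and multiple edges; a loop contributes $2$ to the degree $d(v)$ of its vertex. - A signed graph $\Sigma=(\Gamma,\sigma)$ is a graph $\Gamma=(V,E)$ with a sign function $\sigma:E\to\{+1,-1\}$. - $d^-(v)$ is the number of negative edges incident with $v$. - The sign of a path or circle is the product of its edge signs. $\Sigma$ is balanced if every circle is positive. - A cut is the set of edges with one endpoint in $X$ and the other in $V\setminus X$ for some $X\subset V$, provided this set is nonempty. - A vertex-signed graph is consistent if the product of vertex signs on every circle is positive. - For a simple signed graph $\Sigma$, $\Lambda_\sigma(\Sigma)$ is the line graph $L(\Gamma)$ (vertices are the edges of $\Gamma$, adjacent when they share an endpoint), with each vertex $e$ signed $\sigma(e)$. Property 2. For every vertex $v$: (a) if $d(v)>3$ then $d^-(v)=0$; (b) if $d(v)=3$ then $d^-(v)\in\{0,2\}$; (c) if $d^-(v)=2$, then both negative edges at $v$ lie on every circle through $v$. Blocks and paths. - A block is a maximal subgraph $B$ such that any two edges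 of $B$ lie together on a circle; isolated vertices, isthmi and loops are blocks. A block is nontrivial if it contains a circle. - A megablock is a maximal connected union of one or more nontrivial blocks. - Paths may be open or closed. A path joins two termini, which are equal for a closed path. An open path may have length $0$ and is nontrivial if it has positive length; a closed path has positive length. - Internal vertices of a path are the non-termini. Terminal edges are the edges incident with a terminus. A circle has no terminus, and all its vertices are internal. - For a subgraph $\Gamma'$, a $\Gamma'$-divalent path or circle is a nontrivial path or circle in $\Gamma'$ whose internal vertices $v$ have $d_{\Gamma'}(v)=2$. Suppression and subdivision. - Suppressing a divalent vertex $v$ with edges $uv,vw$ replaces them by one edge $uw$ with sign $\sigma(uv)\sigma(vw)$. A divalent vertex supporting a loop cannot be suppressed. - "Suppressing all possible divalent vertices" means repeating this until the only divalent vertices left support loops. - Subdividing an edge $e'$ means replacing it by a nontrivial path $P_{e'}$ with the same termini, or by a circle if $e'$ is a loop. Retaining the edge counts as a subdivision. Construction A. Start with a graph $\Gamma$. Choose a set $\mathcal A$ of pairwise disjoint paths and circles in $\Gamma$, each $P\in\mathcal A$ being one of: (i) a $B$-divalent path in a nontrivial block $B$ of $\Gamma$, all of whose vertices have $d_\Gamma(v)\le 3$ and whose termini have $d_\Gamma(v)=2$; (ii) a path consisting of isthmi, all of whose vertices have $d_\Gamma(v)\le3$ and whose termini have $d_\Gamma(v)\le 2$; (iii) a megablock of $\Gamma$ that is a circle, all of whose vertices have $d_\Gamma(v)\le 3$. Make the edges of the chosen paths and circles negative and all other edges positive. Construction B. Start with a graph $\Gamma'$ having no divalent vertices except possibly ones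 supporting a loop. - Step 1: sign $\Gamma'$ arbitrarily, obtaining $\Sigma'=(\Gamma',\sigma')$. - Step 2: choose $F'\subseteq E(\Gamma')$ containing all negative edges of $\Sigma'$. - Step 3: partition $F'$ into a set $\mathcal D'$ of nontrivial paths and circles such that: (a) internal vertices have degree at most $3$ in $\Gamma'$; (b) the third edge at each trivalent internal vertex is an isthmus; (c) each open path lies within a nontrivial block or consists entirely of isthmi; (d) no terminus is divalent in $\Gamma'$. - Step 4: subdivide each edge $e'$ of $\Gamma'$ into $P_{e'}$, giving $\Gamma$. For $P'\in\mathcal D'$, let $P$ be the path or circle obtained by subdividing its edges. - Step 5: make $P_{e'}$ all positive if $e'\notin F'$. - Step 6: for each $P'\in\mathcal D'$, sign the edges of $P$ so that for each edge $f'$ of $P'$: (a) the sign of $P_{f'}$ equals $\sigma'(f')$; (b) $P_{f'}$ is not all positive; (c) a terminal edge of $P$ incident with a non-univalent terminus is positive; (d) every edge of $P$ incident with a trivalent internal vertex is negative. The result is $\Sigma$. Construction C. Same as Construction B, with these changes: - omit Step 1 and Step 6(a); - in Step 2, $F'$ is an arbitrary edge subset; - afterwards, set $\sigma'(e')$ to be the sign of $P_{e'}$. Construction D. Same as Construction B, except that in Step 1 each nontrivial block of $\Gamma'$ is signed so that it is balanced (otherwise arbitrarily).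
   Formalization: Graphs are taken to be finite (an infinite all-negative two-way path refutes the claim), and d^-(v) counts a negative loop twice, as d(v) does (otherwise a negative loop at a trivalent vertex, allowed by Construction A(iii), violates Property 2(b)). *)

theory Defs
  imports Main
begin

section \<open>Graphs with loops and multiple edges\<close>

text \<open>An edge has one end (a loop) or two.  The value of \<open>ends\<close> off the edge set is irrelevant.
  All graphs are finite.\<close>

record ('v, 'e) graph =
  verts :: "'v set"
  edges :: "'e set"
  ends  :: "'e \<Rightarrow> 'v set"

definition is_graph :: "('v, 'e) graph \<Rightarrow> bool" where
  "is_graph G \<longleftrightarrow> finite (verts G) \<and> finite (edges G) \<and>
     (\<forall>e \<in> edges G. ends G e \<subseteq> verts G \<and> card (ends G e) \<in> {1, 2})"

definition simple_graph :: "('v, 'e) graph \<Rightarrow> bool" where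
  "simple_graph G \<longleftrightarrow> is_graph G \<and> (\<forall>e \<in> edges G. card (ends G e) = 2) \<and> inj_on (ends G) (edges G)"

text \<open>The second summand makes a loop count twice.\<close>

definition degree :: "('v, 'e) graph \<Rightarrow> 'v \<Rightarrow> nat" where
  "degree G v = card {e \<in> edges G. v \<in> ends G e} + card {e \<in> edges G. ends G e = {v}}"

definition subgraph :: "('v, 'e) graph \<Rightarrow> ('v, 'e) graph \<Rightarrow> bool" where
  "subgraph H G \<longleftrightarrow> is_graph H \<and> verts H \<subseteq> verts G \<and> edges H \<subseteq> edges G \<and> ends H = ends G"

definition cut :: "('v, 'e) graph \<Rightarrow> 'e set \<Rightarrow> bool" where
  "cut G S \<longleftrightarrow> S \<noteq> {} \<and>
     (\<exists>X \<subseteq> verts G. S = {e \<in> edges G. ends G e \<inter> X \<noteq> {} \<and> ends G e \<inter> (verts G - X) \<noteq> {}})"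

definition isthmus :: "('v, 'e) graph \<Rightarrow> 'e \<Rightarrow> bool" where
  "isthmus G e \<longleftrightarrow> cut G {e}"


section \<open>Paths and circles\<close>

text \<open>A walk visits the vertices \<open>vs\<close>, traversing the edge \<open>es ! i\<close> from \<open>vs ! i\<close> to \<open>vs ! Suc i\<close>.\<close>

definition walk :: "('v, 'e) graph \<Rightarrow> 'v list \<Rightarrow> 'e list \<Rightarrow> bool" where
  "walk G vs es \<longleftrightarrow> length vs = Suc (length es) \<and> set vs \<subseteq> verts G \<and> set es \<subseteq> edges G \<and>
     (\<forall>i < length es. ends G (es ! i) = {vs ! i, vs ! Suc i})"

definition connected_graph :: "('v, 'e) graph \<Rightarrow> bool" where
  "connected_graph G \<longleftrightarrow> verts G \<noteq> {} \<and>
     (\<forall>u \<in> verts G. \<forall>w \<in> verts G. \<exists>vs es. walk G vs es \<and> hd vs = u \<and> last vs = w)"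

text \<open>A track is a path or a circle, regarded as a subgraph together with its set of termini: two
  for a nontrivial open path, one for a closed path or a path of length 0, none for a circle.
  A closed path thus differs from the circle with the same edges only by its distinguished
  terminus.\<close>

record ('v, 'e) track =
  tverts  :: "'v set"
  tedges  :: "'e set"
  termini :: "'v set"

definition open_path :: "('v, 'e) graph \<Rightarrow> ('v, 'e) track \<Rightarrow> bool" where
  "open_path G P \<longleftrightarrow> (\<exists>vs es. walk G vs es \<and> distinct vs \<and>
     P = \<lparr>tverts = set vs, tedges = set es, termini = {hd vs, last vs}\<rparr>)"

text \<open>Distinctness of the edges matters for length 2: going along an edge and back is not a closed
  path.\<close>

definition closed_path :: "('v, 'e) graph \<Rightarrow> ('v, 'e) track \<Rightarrow> bool" where
  "closed_path G P \<longleftrightarrow> (\<exists>vs es. walk G vs es \<and> es \<noteq> [] \<and> hd vs = last vs \<and> distinct (tl vs) \<and>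
     distinct es \<and> P = \<lparr>tverts = set vs, tedges = set es, termini = {hd vs}\<rparr>)"

definition path :: "('v, 'e) graph \<Rightarrow> ('v, 'e) track \<Rightarrow> bool" where
  "path G P \<longleftrightarrow> open_path G P \<or> closed_path G P"

definition circle :: "('v, 'e) graph \<Rightarrow> ('v, 'e) track \<Rightarrow> bool" where
  "circle G C \<longleftrightarrow> (\<exists>P. closed_path G P \<and> C = P\<lparr>termini := {}\<rparr>)"

definition nontrivial :: "('v, 'e) track \<Rightarrow> bool" where
  "nontrivial P \<longleftrightarrow> tedges P \<noteq> {}"

definition internal :: "('v, 'e) track \<Rightarrow> 'v set" where
  "internal P = tverts P - termini P"

definition divalent_path :: "('v, 'e) graph \<Rightarrow> ('v, 'e) track \<Rightarrow> bool" where
  "divalent_path H P \<longleftrightarrow> path H P \<and> nontrivial P \<and> (\<forall>v \<in> internal P. degree H v = 2)"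

definition track_graph :: "('v, 'e) graph \<Rightarrow> ('v, 'e) track \<Rightarrow> ('v, 'e) graph" where
  "track_graph G P = \<lparr>verts = tverts P, edges = tedges P, ends = ends G\<rparr>"


section \<open>Blocks and megablocks\<close>

text \<open>Connectedness only keeps superfluous isolated vertices out of the maximal subgraph.  Since the
  circle condition is on pairs of distinct edges, isolated vertices, isthmi and loops are blocks.\<close>

definition cocircular :: "('v, 'e) graph \<Rightarrow> ('v, 'e) graph \<Rightarrow> bool" where
  "cocircular G B \<longleftrightarrow> subgraph B G \<and> connected_graph B \<and>
     (\<forall>e \<in> edges B. \<forall>f \<in> edges B. e \<noteq> f \<longrightarrow> (\<exists>C. circle G C \<and> e \<in> tedges C \<and> f \<in> tedges C))"

definition block :: "('v, 'e) graph \<Rightarrow> ('v, 'e) graph \<Rightarrow> bool" where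
  "block G B \<longleftrightarrow> cocircular G B \<and> (\<forall>B'. cocircular G B' \<and> subgraph B B' \<longrightarrow> B' = B)"

definition nontrivial_block :: "('v, 'e) graph \<Rightarrow> ('v, 'e) graph \<Rightarrow> bool" where
  "nontrivial_block G B \<longleftrightarrow> block G B \<and> (\<exists>C. circle B C)"

definition connected_block_union :: "('v, 'e) graph \<Rightarrow> ('v, 'e) graph \<Rightarrow> bool" where
  "connected_block_union G M \<longleftrightarrow> (\<exists>\<B>. \<B> \<noteq> {} \<and> (\<forall>B \<in> \<B>. nontrivial_block G B) \<and>
     M = \<lparr>verts = (\<Union>B \<in> \<B>. verts B), edges = (\<Union>B \<in> \<B>. edges B), ends = ends G\<rparr> \<and>
     connected_graph M)"

definition megablock :: "('v, 'e) graph \<Rightarrow> ('v, 'e) graph \<Rightarrow> bool" where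
  "megablock G M \<longleftrightarrow> connected_block_union G M \<and>
     (\<forall>M'. connected_block_union G M' \<and> subgraph M M' \<longrightarrow> M' = M)"


section \<open>Signs\<close>

definition signing :: "('v, 'e) graph \<Rightarrow> ('e \<Rightarrow> int) \<Rightarrow> bool" where
  "signing G \<sigma> \<longleftrightarrow> (\<forall>e \<in> edges G. \<sigma> e \<in> {1, -1})"

definition signed_graph :: "('v, 'e) graph \<Rightarrow> ('e \<Rightarrow> int) \<Rightarrow> bool" where
  "signed_graph G \<sigma> \<longleftrightarrow> is_graph G \<and> signing G \<sigma>"

text \<open>As in the degree, a negative loop counts twice.\<close>

definition neg_degree :: "('v, 'e) graph \<Rightarrow> ('e \<Rightarrow> int) \<Rightarrow> 'v \<Rightarrow> nat" where
  "neg_degree G \<sigma> v = degree (G\<lparr>edges := {e \<in> edges G. \<sigma> e = -1}\<rparr>) v"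

definition track_sign :: "('e \<Rightarrow> int) \<Rightarrow> ('v, 'e) track \<Rightarrow> int" where
  "track_sign \<sigma> P = (\<Prod>e \<in> tedges P. \<sigma> e)"

definition balanced :: "('v, 'e) graph \<Rightarrow> ('e \<Rightarrow> int) \<Rightarrow> bool" where
  "balanced G \<sigma> \<longleftrightarrow> (\<forall>C. circle G C \<longrightarrow> track_sign \<sigma> C = 1)"

definition consistent :: "('v, 'e) graph \<Rightarrow> ('v \<Rightarrow> int) \<Rightarrow> bool" where
  "consistent G \<mu> \<longleftrightarrow> (\<forall>C. circle G C \<longrightarrow> (\<Prod>v \<in> tverts C. \<mu> v) = 1)"

text \<open>An edge of the line graph is the two-element set of its ends.\<close>

definition line_graph :: "('v, 'e) graph \<Rightarrow> ('e, 'e set) graph" where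
  "line_graph G = \<lparr>verts = edges G,
     edges = {{e, f} | e f. e \<in> edges G \<and> f \<in> edges G \<and> e \<noteq> f \<and> ends G e \<inter> ends G f \<noteq> {}},
     ends = (\<lambda>x. x)\<rparr>"

text \<open>In the last clause the two negative edges at \<open>v\<close> may coincide in a single negative loop.\<close>

definition property2 :: "('v, 'e) graph \<Rightarrow> ('e \<Rightarrow> int) \<Rightarrow> bool" where
  "property2 G \<sigma> \<longleftrightarrow> (\<forall>v \<in> verts G.
     (degree G v > 3 \<longrightarrow> neg_degree G \<sigma> v = 0) \<and>
     (degree G v = 3 \<longrightarrow> neg_degree G \<sigma> v \<in> {0, 2}) \<and>
     (neg_degree G \<sigma> v = 2 \<longrightarrow>
        (\<forall>C. circle G C \<and> v \<in> tverts C \<longrightarrow>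
           {e \<in> edges G. v \<in> ends G e \<and> \<sigma> e = -1} \<subseteq> tedges C)))"


section \<open>Construction A\<close>

definition admissibleA :: "('v, 'e) graph \<Rightarrow> ('v, 'e) track \<Rightarrow> bool" where
  "admissibleA G P \<longleftrightarrow>
     ((\<exists>B. nontrivial_block G B \<and> divalent_path B P) \<and>
        (\<forall>v \<in> tverts P. degree G v \<le> 3) \<and> (\<forall>v \<in> termini P. degree G v = 2))
   \<or> (path G P \<and> (\<forall>e \<in> tedges P. isthmus G e) \<and>
        (\<forall>v \<in> tverts P. degree G v \<le> 3) \<and> (\<forall>v \<in> termini P. degree G v \<le> 2))
   \<or> (circle G P \<and> megablock G (track_graph G P) \<and> (\<forall>v \<in> tverts P. degree G v \<le> 3))"

definition constructionA :: "('v, 'e) graph \<Rightarrow> ('e \<Rightarrow> int) \<Rightarrow> bool" where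
  "constructionA G \<sigma> \<longleftrightarrow> is_graph G \<and>
     (\<exists>\<A>. (\<forall>P \<in> \<A>. admissibleA G P) \<and>
          pairwise (\<lambda>P Q. disjnt (tverts P) (tverts Q)) \<A> \<and>
          (\<forall>e \<in> edges G. \<sigma> e = (if e \<in> (\<Union>P \<in> \<A>. tedges P) then -1 else 1)))"


section \<open>Constructions B, C and D\<close>

text \<open>\<open>G\<close> arises from \<open>G'\<close> by replacing every edge \<open>e\<close> by the path \<open>S e\<close>, a closed path if \<open>e\<close> is
  a loop.  The vertices of \<open>G'\<close> are kept; the names of its edges are unrelated to those of \<open>G\<close>, so
  every subdivision occurs in this form up to renaming.\<close>

definition subdivision ::
  "('v, 'e) graph \<Rightarrow> ('e \<Rightarrow> ('v, 'e) track) \<Rightarrow> ('v, 'e) graph \<Rightarrow> bool" where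
  "subdivision G' S G \<longleftrightarrow> is_graph G' \<and> is_graph G \<and>
     (\<forall>e \<in> edges G'. path G (S e) \<and> nontrivial (S e) \<and> termini (S e) = ends G' e \<and>
        internal (S e) \<inter> verts G' = {}) \<and>
     (\<forall>e \<in> edges G'. \<forall>f \<in> edges G'. e \<noteq> f \<longrightarrow>
        tedges (S e) \<inter> tedges (S f) = {} \<and> internal (S e) \<inter> internal (S f) = {}) \<and>
     edges G = (\<Union>e \<in> edges G'. tedges (S e)) \<and>
     verts G = verts G' \<union> (\<Union>e \<in> edges G'. internal (S e))"

definition subdivide_track ::
  "('e \<Rightarrow> ('v, 'e) track) \<Rightarrow> ('v, 'e) track \<Rightarrow> ('v, 'e) track" where
  "subdivide_track S P' = \<lparr>tverts = tverts P' \<union> (\<Union>e \<in> tedges P'. tverts (S e)),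
     tedges = (\<Union>e \<in> tedges P'. tedges (S e)), termini = termini P'\<rparr>"

definition reduced_graph :: "('v, 'e) graph \<Rightarrow> bool" where
  "reduced_graph G \<longleftrightarrow> is_graph G \<and>
     (\<forall>v \<in> verts G. degree G v = 2 \<longrightarrow> (\<exists>e \<in> edges G. ends G e = {v}))"

text \<open>The third edge at a trivalent internal vertex is the one outside the track.\<close>

definition admissible_partition ::
  "('v, 'e) graph \<Rightarrow> 'e set \<Rightarrow> ('v, 'e) track set \<Rightarrow> bool" where
  "admissible_partition G F \<D> \<longleftrightarrow>
     (\<forall>P \<in> \<D>. nontrivial P \<and> (path G P \<or> circle G P)) \<and>
     (\<Union>P \<in> \<D>. tedges P) = F \<and>
     pairwise (\<lambda>P Q. disjnt (tedges P) (tedges Q)) \<D> \<and>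
     (\<forall>P \<in> \<D>.
        (\<forall>v \<in> internal P. degree G v \<le> 3) \<and>
        (\<forall>v \<in> internal P. degree G v = 3 \<longrightarrow>
           (\<forall>e \<in> edges G. v \<in> ends G e \<and> e \<notin> tedges P \<longrightarrow> isthmus G e)) \<and>
        (open_path G P \<longrightarrow>
           (\<exists>B. nontrivial_block G B \<and> subgraph (track_graph G P) B) \<or>
           (\<forall>e \<in> tedges P. isthmus G e)) \<and>
        (\<forall>v \<in> termini P. degree G v \<noteq> 2))"

definition positive_outside ::
  "('v, 'e) graph \<Rightarrow> 'e set \<Rightarrow> ('e \<Rightarrow> ('v, 'e) track) \<Rightarrow> ('e \<Rightarrow> int) \<Rightarrow> bool" where
  "positive_outside G' F S \<sigma> \<longleftrightarrow> (\<forall>e' \<in> edges G' - F. \<forall>e \<in> tedges (S e'). \<sigma> e = 1)"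

definition signs_agree ::
  "('v, 'e) track set \<Rightarrow> ('e \<Rightarrow> ('v, 'e) track) \<Rightarrow> ('e \<Rightarrow> int) \<Rightarrow> ('e \<Rightarrow> int) \<Rightarrow> bool" where
  "signs_agree \<D> S \<sigma>' \<sigma> \<longleftrightarrow> (\<forall>P' \<in> \<D>. \<forall>f' \<in> tedges P'. track_sign \<sigma> (S f') = \<sigma>' f')"

text \<open>Degrees are taken in \<open>G\<close>; on the vertices of \<open>G'\<close> they agree with those in \<open>G'\<close>.\<close>

definition admissible_signs ::
  "('v, 'e) graph \<Rightarrow> ('v, 'e) track set \<Rightarrow> ('e \<Rightarrow> ('v, 'e) track) \<Rightarrow> ('e \<Rightarrow> int) \<Rightarrow> bool" where
  "admissible_signs G \<D> S \<sigma> \<longleftrightarrow> (\<forall>P' \<in> \<D>. let P = subdivide_track S P' in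
     (\<forall>f' \<in> tedges P'. \<not> (\<forall>e \<in> tedges (S f'). \<sigma> e = 1)) \<and>
     (\<forall>v \<in> termini P. degree G v \<noteq> 1 \<longrightarrow> (\<forall>e \<in> tedges P. v \<in> ends G e \<longrightarrow> \<sigma> e = 1)) \<and>
     (\<forall>v \<in> internal P. degree G v = 3 \<longrightarrow> (\<forall>e \<in> tedges P. v \<in> ends G e \<longrightarrow> \<sigma> e = -1)))"

text \<open>Everything but the choice of \<open>(G', \<sigma>')\<close>, on which alone Constructions B and D differ.\<close>

definition stepsB ::
  "('v, 'e) graph \<Rightarrow> ('e \<Rightarrow> int) \<Rightarrow> ('v, 'e) graph \<Rightarrow> ('e \<Rightarrow> int) \<Rightarrow> bool" where
  "stepsB G' \<sigma>' G \<sigma> \<longleftrightarrow> (\<exists>F \<D> S.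
     F \<subseteq> edges G' \<and> {e \<in> edges G'. \<sigma>' e = -1} \<subseteq> F \<and>
     admissible_partition G' F \<D> \<and> subdivision G' S G \<and> signing G \<sigma> \<and>
     positive_outside G' F S \<sigma> \<and> signs_agree \<D> S \<sigma>' \<sigma> \<and> admissible_signs G \<D> S \<sigma>)"

definition constructionB :: "('v, 'e) graph \<Rightarrow> ('e \<Rightarrow> int) \<Rightarrow> bool" where
  "constructionB G \<sigma> \<longleftrightarrow> (\<exists>(G' :: ('v, 'e) graph) \<sigma>'.
     reduced_graph G' \<and> signing G' \<sigma>' \<and> stepsB G' \<sigma>' G \<sigma>)"

definition constructionC :: "('v, 'e) graph \<Rightarrow> ('e \<Rightarrow> int) \<Rightarrow> bool" where
  "constructionC G \<sigma> \<longleftrightarrow> (\<exists>(G' :: ('v, 'e) graph) F \<D> S \<sigma>'.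
     reduced_graph G' \<and> F \<subseteq> edges G' \<and>
     admissible_partition G' F \<D> \<and> subdivision G' S G \<and> signing G \<sigma> \<and>
     positive_outside G' F S \<sigma> \<and> admissible_signs G \<D> S \<sigma> \<and>
     (\<forall>e' \<in> edges G'. \<sigma>' e' = track_sign \<sigma> (S e')))"

definition constructionD :: "('v, 'e) graph \<Rightarrow> ('e \<Rightarrow> int) \<Rightarrow> bool" where
  "constructionD G \<sigma> \<longleftrightarrow> (\<exists>(G' :: ('v, 'e) graph) \<sigma>'.
     reduced_graph G' \<and> signing G' \<sigma>' \<and> (\<forall>B. nontrivial_block G' B \<longrightarrow> balanced B \<sigma>') \<and>
     stepsB G' \<sigma>' G \<sigma>)"

end

theory Submission
  imports Defs
begin

text \<open>Circles are exactly the minimal nonempty edge sets with all degrees even.  This turns the facts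
  about circles that are needed (an edge is an isthmus iff it lies on no circle, lying on a common
  circle is transitive, balance can be tested on even sets, circles correspond under subdivision)
  into computations with degrees and symmetric differences.

  Property 2 says that a vertex with negative edges has degree at most 3, and that a trivalent one
  has exactly two, its third edge being an isthmus.  Hence linking the two negative edges at each
  vertex with \<open>d\<^sup>- = 2\<close> cuts the negative edges into disjoint paths and circles, and no such path
  changes between isthmi and a nontrivial block; these are the tracks of Construction A.  For
  Construction C the same linking is done in the graph \<open>G'\<close> left after suppressing all possible
  divalent vertices, at the trivalent vertices and the divalent loops only.

  A circle of the line graph of a simple graph consists of a closed trail, which is an even set and
  hence positive by balance, and of edges that the circle only touches at one vertex.  By Property 2
  a touched edge is positive unless the whole circle is the triangle of the edges at a trivalent
  vertex.\<close>

section \<open>Degrees in an edge set\<close>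

text \<open>The obstacle is that linking edge by edge might produce a walk that meets itself. It
  cannot, because the edges left out of \<open>N v\<close> at a linked vertex lie on no circle: two
  open paths with a common terminus that touched at an internal vertex of one of them would contain
  an even set through such an edge. So a merge always gives a path, open or closed, and a family of
  least \<open>weight\<close> has every prescribed vertex internal.

  One locale serves both linkings. In G itself \<open>N v\<close> is the set of negative edges at v.
  In G' it is not the set of edges of F at v: an edge of F has a negative edge somewhere along its
  subdivision, so every edge at a trivalent v may lie in F while only two edge ends at v are
  negative. A vertex with a divalent loop has to be linked as well, since no terminus may be
  divalent.

  Between G' and G even sets are easier to carry over than circles: degrees at old vertices are
  unchanged and the vertices inside a subdivided edge have degree 2, whereas walks would have to be
  spliced.\<close>

definition inc :: "('e \<Rightarrow> 'v set) \<Rightarrow> 'e \<Rightarrow> 'v \<Rightarrow> nat" where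
  "inc E e v = (if v \<notin> E e then 0 else if E e = {v} then 2 else 1)"

text \<open>Taken over an arbitrary edge set and end map, so that graphs, circles and sets of
  negative edges share one degree, additive over disjoint edge sets.\<close>

definition deg_in :: "('e \<Rightarrow> 'v set) \<Rightarrow> 'e set \<Rightarrow> 'v \<Rightarrow> nat" where
  "deg_in E A v = (\<Sum>e\<in>A. inc E e v)"

text \<open>The elements of the binary cycle space.\<close>

definition even_set :: "('e \<Rightarrow> 'v set) \<Rightarrow> 'e set \<Rightarrow> bool" where
  "even_set E A \<longleftrightarrow> finite A \<and> (\<forall>v. even (deg_in E A v))"

lemma inc_pair: "E e = {a, b} \<Longrightarrow> inc E e v = of_bool (a = v) + of_bool (b = v)"
  by (auto simp: inc_def)

lemma inc_pos_iff: "0 < inc E e v \<longleftrightarrow> v \<in> E e"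
  by (auto simp: inc_def)

lemma degree_eq_deg_in:
  assumes "finite (edges G)"
  shows "degree G v = deg_in (ends G) (edges G) v"
proof -
  have "inc (ends G) e v = of_bool (v \<in> ends G e) + of_bool (ends G e = {v})" for e
    by (auto simp: inc_def)
  then show ?thesis
    using assms by (simp add: degree_def deg_in_def sum.distrib Int_def)
qed

lemma neg_degree_eq_deg_in:
  assumes "finite (edges G)"
  shows "neg_degree G \<sigma> v = deg_in (ends G) {e \<in> edges G. \<sigma> e = -1} v"
  using degree_eq_deg_in[of "G\<lparr>edges := {e \<in> edges G. \<sigma> e = -1}\<rparr>" v] assms
  by (simp add: neg_degree_def)

lemma deg_in_mono: "finite B \<Longrightarrow> A \<subseteq> B \<Longrightarrow> deg_in E A v \<le> deg_in E B v"
  unfolding deg_in_def by (rule sum_mono2) auto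

lemma deg_in_ge_inc: "finite A \<Longrightarrow> e \<in> A \<Longrightarrow> inc E e v \<le> deg_in E A v"
  unfolding deg_in_def by (rule member_le_sum) auto

lemma deg_in_pos_iff: "finite A \<Longrightarrow> 0 < deg_in E A v \<longleftrightarrow> (\<exists>e\<in>A. v \<in> E e)"
  unfolding deg_in_def using inc_pos_iff[of E _ v] by (auto simp: sum_nonneg_eq_0_iff simp flip: neq0_conv)

lemma deg_in_union: "finite A \<Longrightarrow> finite B \<Longrightarrow> A \<inter> B = {} \<Longrightarrow> deg_in E (A \<union> B) v = deg_in E A v + deg_in E B v"
  unfolding deg_in_def by (rule sum.union_disjoint)

lemma deg_in_insert: "finite A \<Longrightarrow> e \<notin> A \<Longrightarrow> deg_in E (insert e A) v = inc E e v + deg_in E A v"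
  unfolding deg_in_def by simp

lemma deg_in_diff: "finite B \<Longrightarrow> A \<subseteq> B \<Longrightarrow> deg_in E B v = deg_in E A v + deg_in E (B - A) v"
  using deg_in_union[of A "B - A" E v] finite_subset[of A B] by (simp add: Un_absorb1)

lemma deg_in_at: "finite A \<Longrightarrow> deg_in E {e \<in> A. v \<in> E e} v = deg_in E A v"
  unfolding deg_in_def by (rule sum.mono_neutral_left) (auto simp: inc_def)

lemma deg_in_UN:
  assumes "finite I" "\<And>i. i \<in> I \<Longrightarrow> finite (A i)" "\<And>i j. i \<in> I \<Longrightarrow> j \<in> I \<Longrightarrow> i \<noteq> j \<Longrightarrow> A i \<inter> A j = {}"
  shows "deg_in E (\<Union>i\<in>I. A i) v = (\<Sum>i\<in>I. deg_in E (A i) v)"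
  unfolding deg_in_def using assms by (intro sum.UNION_disjoint) auto

text \<open>An edge of \<open>B - A\<close> at \<open>v\<close> would raise the degree. In this way
  bounds on degrees become statements that all edges at a vertex belong to a given track or
  circle.\<close>

lemma deg_in_eq_imp_contains:
  assumes "finite A" "finite B" "A \<subseteq> B" "deg_in E B v \<le> deg_in E A v" "e \<in> B" "v \<in> E e"
  shows "e \<in> A"
proof (rule ccontr)
  assume "e \<notin> A"
  then have "0 < deg_in E (B - A) v"
    using assms by (subst deg_in_pos_iff) auto
  then show False
    using deg_in_diff[OF assms(2,3), of E v] assms(4) by simp
qed

lemma even_set_diff:
  assumes "even_set E B" "even_set E A" "A \<subseteq> B"
  shows "even_set E (B - A)"
proof -
  have "even (deg_in E (B - A) v)" for v
    using deg_in_diff[of B A E v] assms by (metis even_add even_set_def)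
  then show ?thesis
    using assms by (auto simp: even_set_def)
qed

text \<open>The common edges are counted twice and drop out modulo 2.\<close>

lemma even_set_sym_diff:
  assumes "even_set E A" "even_set E B"
  shows "even_set E ((A - B) \<union> (B - A))"
proof -
  have "even (deg_in E ((A - B) \<union> (B - A)) v)" for v
  proof -
    have "deg_in E A v = deg_in E (A \<inter> B) v + deg_in E (A - B) v"
      using deg_in_diff[of A "A \<inter> B" E v] assms by (simp add: even_set_def Diff_Int)
    moreover have "deg_in E B v = deg_in E (A \<inter> B) v + deg_in E (B - A) v"
      using deg_in_diff[of B "A \<inter> B" E v] assms by (simp add: even_set_def Diff_Int)
    moreover have "deg_in E ((A - B) \<union> (B - A)) v = deg_in E (A - B) v + deg_in E (B - A) v"
      using assms by (intro deg_in_union) (auto simp: even_set_def)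
    ultimately show ?thesis
      using assms by (metis even_add even_set_def)
  qed
  then show ?thesis
    using assms by (auto simp: even_set_def)
qed

section \<open>Walks\<close>

lemma walk_single [simp]: "walk G [v] [] \<longleftrightarrow> v \<in> verts G"
  by (simp add: walk_def)

lemma walk_Cons_Cons:
  "walk G (u # vs) (e # es) \<longleftrightarrow>
     u \<in> verts G \<and> e \<in> edges G \<and> ends G e = {u, hd vs} \<and> walk G vs es"
  by (cases vs) (auto simp: walk_def All_less_Suc2)

lemma walk_nonempty: "walk G vs es \<Longrightarrow> vs \<noteq> []"
  by (auto simp: walk_def)

lemma walk_Nil_iff: "walk G vs [] \<longleftrightarrow> (\<exists>v. vs = [v] \<and> v \<in> verts G)"
  by (cases vs) (auto simp: walk_def)

lemma walk_Cons_iff: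
  "walk G vs (e # es) \<longleftrightarrow> (\<exists>u ws. vs = u # ws \<and>
     u \<in> verts G \<and> e \<in> edges G \<and> ends G e = {u, hd ws} \<and> walk G ws es)"
  by (cases vs) (auto simp: walk_Cons_Cons walk_nonempty[of G "[]"] dest: walk_nonempty)

lemma walk_hd_last: "walk G vs es \<Longrightarrow> hd vs \<in> set vs" "walk G vs es \<Longrightarrow> last vs \<in> set vs"
  by (auto dest: walk_nonempty)

lemma walk_edges_subset: "walk G vs es \<Longrightarrow> set es \<subseteq> edges G"
  and walk_verts_subset: "walk G vs es \<Longrightarrow> set vs \<subseteq> verts G"
  and walk_length: "walk G vs es \<Longrightarrow> length vs = Suc (length es)"
  by (simp_all add: walk_def)

lemma walk_ends_nth: "walk G vs es \<Longrightarrow> i < length es \<Longrightarrow> ends G (es ! i) = {vs ! i, vs ! Suc i}"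
  by (simp add: walk_def)

lemma walk_ends_subset: "walk G vs es \<Longrightarrow> e \<in> set es \<Longrightarrow> ends G e \<subseteq> set vs"
  using walk_ends_nth[of G vs es] walk_length[of G vs es] nth_mem[of _ vs] unfolding in_set_conv_nth by fastforce

lemma walk_append:
  "walk G vs es \<Longrightarrow> walk G ws fs \<Longrightarrow> last vs = hd ws \<Longrightarrow> walk G (vs @ tl ws) (es @ fs)"
proof (induction es arbitrary: vs)
  case Nil
  then have "vs = [hd ws]" "ws \<noteq> []"
    using walk_nonempty[of G ws fs] by (auto simp: walk_Nil_iff)
  with Nil show ?case
    by simp
next
  case (Cons e es)
  then obtain u us where vs: "vs = u # us" and "u \<in> verts G" "e \<in> edges G" "ends G e = {u, hd us}"
    "walk G us es"
    by (auto simp: walk_Cons_iff)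
  moreover have "us \<noteq> []"
    using \<open>walk G us es\<close> by (rule walk_nonempty)
  ultimately show ?case
    using Cons by (auto simp: walk_Cons_Cons hd_append)
qed

lemma walk_rev: "walk G vs es \<Longrightarrow> walk G (rev vs) (rev es)"
  unfolding walk_def
proof (intro conjI allI impI; (elim conjE)?)
  fix i
  assume *: "length vs = Suc (length es)" "i < length (rev es)"
    "\<forall>i<length es. ends G (es ! i) = {vs ! i, vs ! Suc i}"
  define j where "j = length es - Suc i"
  have "rev vs ! i = vs ! Suc j" "rev vs ! Suc i = vs ! j" "rev es ! i = es ! j" "j < length es"
    using * by (auto simp: rev_nth j_def Suc_diff_Suc)
  then show "ends G (rev es ! i) = {rev vs ! i, rev vs ! Suc i}"
    using * by auto
qed auto

lemma walk_take: "walk G vs es \<Longrightarrow> i \<le> length es \<Longrightarrow> walk G (take (Suc i) vs) (take i es)"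
  by (auto simp: walk_def dest!: in_set_takeD)

lemma walk_drop: "walk G vs es \<Longrightarrow> i \<le> length es \<Longrightarrow> walk G (drop i vs) (drop i es)"
  by (auto simp: walk_def dest!: in_set_dropD)

lemma walk_mono:
  assumes "walk H vs es" "verts H \<subseteq> verts G" "edges H \<subseteq> edges G" "ends H = ends G"
  shows "walk G vs es"
  using assms by (auto simp: walk_def)

lemma walk_restrict:
  assumes "walk G vs es" "set vs \<subseteq> verts H" "set es \<subseteq> edges H" "ends H = ends G"
  shows "walk H vs es"
  using assms by (auto simp: walk_def)

lemma walk_distinct_edges: "walk G vs es \<Longrightarrow> distinct vs \<Longrightarrow> distinct es"
proof (induction es arbitrary: vs)
  case (Cons e es)
  then obtain u us where vs: "vs = u # us" "ends G e = {u, hd us}" "walk G us es"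
    by (auto simp: walk_Cons_iff)
  then have "e \<notin> set es"
    using Cons.prems walk_ends_subset[of G us es e] by auto
  then show ?case
    using Cons vs by auto
qed simp

text \<open>Whenever the new first vertex recurs in the shortened rest, the detour up to that
  recurrence is cut off.\<close>

lemma walk_shorten:
  "walk G vs es \<Longrightarrow> \<exists>vs' es'. walk G vs' es' \<and> distinct vs' \<and> hd vs' = hd vs \<and> last vs' = last vs \<and>
     set es' \<subseteq> set es"
proof (induction es arbitrary: vs)
  case Nil
  then show ?case
    by (intro exI[of _ vs] exI[of _ "[]"]) (auto simp: walk_Nil_iff)
next
  case (Cons e es)
  then obtain u us where vs: "vs = u # us" "u \<in> verts G" "e \<in> edges G" "ends G e = {u, hd us}" "walk G us es"
    by (auto simp: walk_Cons_iff)
  with Cons.IH obtain ws fs where ws: "walk G ws fs" "distinct ws" "hd ws = hd us" "last ws = last us"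
    "set fs \<subseteq> set es"
    by blast
  have ne: "us \<noteq> []" "ws \<noteq> []"
    using vs(5) ws(1) by (auto dest: walk_nonempty)
  show ?case
  proof (cases "u \<in> set ws")
    case False
    then show ?thesis
      using vs ws ne by (intro exI[of _ "u # ws"] exI[of _ "e # fs"]) (auto simp: walk_Cons_Cons)
  next
    case True
    then obtain i where i: "i < length ws" "ws ! i = u"
      by (auto simp: in_set_conv_nth)
    then have "i \<le> length fs"
      using walk_length[OF ws(1)] by simp
    then have "walk G (drop i ws) (drop i fs)"
      using ws(1) walk_drop by blast
    then show ?thesis
      using vs ws ne i
      by (intro exI[of _ "drop i ws"] exI[of _ "drop i fs"]) (auto simp: hd_drop_conv_nth dest!: in_set_dropD)
  qed
qed

text \<open>Each edge contributes one to the vertex it leaves and one to the vertex it enters;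
  \<open>butlast vs\<close> lists the former, \<open>tl vs\<close> the latter.\<close>

lemma walk_deg_in:
  assumes "walk G vs es" "distinct es"
  shows "deg_in (ends G) (set es) v = count_list (butlast vs) v + count_list (tl vs) v"
  using assms
proof (induction es arbitrary: vs)
  case Nil
  then show ?case
    by (auto simp: walk_Nil_iff deg_in_def)
next
  case (Cons e es)
  then obtain u us where vs: "vs = u # us" "ends G e = {u, hd us}" "walk G us es"
    by (auto simp: walk_Cons_iff)
  then obtain x xs where us: "us = x # xs"
    by (cases us) (auto dest: walk_nonempty)
  have "deg_in (ends G) (set (e # es)) v = inc (ends G) e v + deg_in (ends G) (set es) v"
    using Cons.prems by (simp add: deg_in_insert)
  also have "\<dots> = (of_bool (u = v) + of_bool (x = v)) + (count_list (butlast us) v + count_list (tl us) v)"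
    using Cons vs us by (simp add: inc_pair)
  finally show ?case
    using vs us by auto
qed

lemma count_list_distinct: "distinct xs \<Longrightarrow> count_list xs x = of_bool (x \<in> set xs)"
  by (induction xs) auto

lemma walk_deg_in_distinct:
  assumes "walk G vs es" "distinct vs"
  shows "deg_in (ends G) (set es) v = of_bool (v \<in> set vs \<and> v \<noteq> last vs) + of_bool (v \<in> set vs \<and> v \<noteq> hd vs)"
proof -
  have ne: "vs \<noteq> []"
    using assms walk_nonempty by blast
  then have a: "v \<in> set (butlast vs) \<longleftrightarrow> v \<in> set vs \<and> v \<noteq> last vs"
    using assms(2) by (cases vs rule: rev_cases) auto
  have b: "v \<in> set (tl vs) \<longleftrightarrow> v \<in> set vs \<and> v \<noteq> hd vs"
    using assms(2) ne by (cases vs) auto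
  have "distinct (butlast vs)" "distinct (tl vs)"
    using assms(2) by (auto simp: distinct_butlast distinct_tl)
  then show ?thesis
    using walk_deg_in[OF assms(1) walk_distinct_edges[OF assms]] a b
    by (simp add: count_list_distinct)
qed

lemma closed_walk_deg_in:
  assumes "walk G vs es" "es \<noteq> []" "hd vs = last vs" "distinct (tl vs)" "distinct es"
  shows "deg_in (ends G) (set es) v = (if v \<in> set vs then 2 else 0)"
proof -
  obtain u ws where vs: "vs = u # ws" "ws \<noteq> []"
    using assms(1,2) by (cases es) (auto simp: walk_Cons_iff dest: walk_nonempty)
  obtain ws' where ws: "ws = ws' @ [u]"
    using vs assms(3) by (cases ws rule: rev_cases) auto
  have "count_list (butlast vs) v + count_list (tl vs) v = 2 * count_list ws v"
    using vs ws by (auto simp: butlast_append)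
  also have "\<dots> = (if v \<in> set vs then 2 else 0)"
    using vs ws assms(4) by (subst count_list_distinct) auto
  finally show ?thesis
    using walk_deg_in[OF assms(1,5)] by simp
qed

lemma walk_edges_connected:
  assumes w: "walk G vs es" and e: "e \<in> set es" "e \<in> A"
    and step: "\<And>i. Suc i < length es \<Longrightarrow> es ! i \<in> A \<longleftrightarrow> es ! Suc i \<in> A"
  shows "set es \<subseteq> A"
proof -
  have *: "i < length es \<Longrightarrow> es ! i \<in> A \<longleftrightarrow> es ! 0 \<in> A" for i
    by (induction i) (use step in auto)
  then show ?thesis
    using e by (metis in_set_conv_nth subsetI)
qed

section \<open>Tracks\<close>

definition track :: "('v, 'e) graph \<Rightarrow> ('v, 'e) track \<Rightarrow> bool" where
  "track G P \<longleftrightarrow> path G P \<or> circle G P"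

lemma circle_iff:
  "circle G C \<longleftrightarrow> (\<exists>vs es. walk G vs es \<and> es \<noteq> [] \<and> hd vs = last vs \<and> distinct (tl vs) \<and>
     distinct es \<and> C = \<lparr>tverts = set vs, tedges = set es, termini = {}\<rparr>)"
  unfolding circle_def closed_path_def by fastforce

text \<open>A closed path and a circle come from the same cyclic walk and differ only in
  \<open>T\<close>, so two cases suffice.\<close>

lemma trackE:
  assumes "track G P"
  obtains vs es where "walk G vs es" "distinct vs" "open_path G P"
      "P = \<lparr>tverts = set vs, tedges = set es, termini = {hd vs, last vs}\<rparr>"
  | vs es T where "walk G vs es" "es \<noteq> []" "hd vs = last vs" "distinct (tl vs)" "distinct es"
      "circle G (P\<lparr>termini := {}\<rparr>)" "T = {} \<or> T = {hd vs}" "closed_path G P \<longleftrightarrow> T = {hd vs}"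
      "P = \<lparr>tverts = set vs, tedges = set es, termini = T\<rparr>"
proof -
  consider "open_path G P" | "closed_path G P" | "circle G P"
    using assms by (auto simp: track_def path_def)
  then show thesis
  proof cases
    case 1
    then show thesis
      using that(1) by (auto simp: open_path_def)
  next
    case 2
    then obtain vs es where *: "walk G vs es" "es \<noteq> []" "hd vs = last vs" "distinct (tl vs)" "distinct es"
      "P = \<lparr>tverts = set vs, tedges = set es, termini = {hd vs}\<rparr>"
      unfolding closed_path_def by blast
    moreover have "circle G (P\<lparr>termini := {}\<rparr>)"
      using 2 by (auto simp: circle_def)
    ultimately show thesis
      using that(2)[of vs es "{hd vs}"] 2 by blast
  next
    case 3
    then obtain vs es where *: "walk G vs es" "es \<noteq> []" "hd vs = last vs" "distinct (tl vs)" "distinct es"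
      "P = \<lparr>tverts = set vs, tedges = set es, termini = {}\<rparr>"
      unfolding circle_iff by blast
    moreover have "circle G (P\<lparr>termini := {}\<rparr>)"
      using 3 by (auto simp: circle_def)
    moreover have "\<not> closed_path G P"
      using * by (auto simp: closed_path_def)
    ultimately show thesis
      using that(2)[of vs es "{}"] by blast
  qed
qed

lemma circle_track: "circle G C \<Longrightarrow> track G C"
  by (simp add: track_def)

lemma track_basic:
  assumes "track G P"
  shows track_finite_edges: "finite (tedges P)"
    and track_edges_subset: "tedges P \<subseteq> edges G"
    and track_verts_subset: "tverts P \<subseteq> verts G"
    and track_termini_subset: "termini P \<subseteq> tverts P"
    and track_finite_verts: "finite (tverts P)"
    and track_verts_nonempty: "tverts P \<noteq> {}"
  using assms
  by (auto elim!: trackE simp: walk_edges_subset[THEN subsetD] walk_verts_subset[THEN subsetD]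
      dest: walk_nonempty walk_hd_last)

lemma track_ends_subset: "track G P \<Longrightarrow> e \<in> tedges P \<Longrightarrow> ends G e \<subseteq> tverts P"
  by (erule trackE) (auto dest: walk_ends_subset)

lemma track_deg_in_internal: "track G P \<Longrightarrow> v \<in> internal P \<Longrightarrow> deg_in (ends G) (tedges P) v = 2"
  by (erule trackE) (auto simp: internal_def walk_deg_in_distinct closed_walk_deg_in)

lemma track_deg_in_outside: "track G P \<Longrightarrow> v \<notin> tverts P \<Longrightarrow> deg_in (ends G) (tedges P) v = 0"
  by (erule trackE) (auto simp: walk_deg_in_distinct closed_walk_deg_in)

lemma open_path_termini:
  assumes "open_path G P" "nontrivial P"
  shows "card (termini P) = 2"
proof -
  obtain vs es where "walk G vs es" "distinct vs" "P = \<lparr>tverts = set vs, tedges = set es, termini = {hd vs, last vs}\<rparr>"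
    using assms by (auto simp: open_path_def)
  moreover from this have "hd vs \<noteq> last vs"
    using assms(2) by (cases es; cases vs) (auto simp: nontrivial_def walk_def split: if_splits)
  ultimately show ?thesis
    by simp
qed

lemma open_path_deg_in_terminus:
  assumes "open_path G P" "nontrivial P" "v \<in> termini P"
  shows "deg_in (ends G) (tedges P) v = 1"
proof -
  obtain vs es where *: "walk G vs es" "distinct vs" "P = \<lparr>tverts = set vs, tedges = set es, termini = {hd vs, last vs}\<rparr>"
    using assms by (auto simp: open_path_def)
  moreover have "hd vs \<noteq> last vs"
    using open_path_termini[OF assms(1,2)] * by auto
  ultimately show ?thesis
    using assms(3) walk_nonempty[OF *(1)] by (auto simp: walk_deg_in_distinct)
qed

lemma closed_path_deg_in: "closed_path G P \<Longrightarrow> deg_in (ends G) (tedges P) v = (if v \<in> tverts P then 2 else 0)"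
  by (auto simp: closed_path_def closed_walk_deg_in)

lemma circle_deg_in: "circle G P \<Longrightarrow> deg_in (ends G) (tedges P) v = (if v \<in> tverts P then 2 else 0)"
  by (auto simp: circle_iff closed_walk_deg_in)

lemma closed_path_termini: "closed_path G P \<Longrightarrow> \<exists>v. termini P = {v}"
  by (auto simp: closed_path_def)

lemma circle_nontrivial: "circle G C \<Longrightarrow> tedges C \<noteq> {}"
  by (auto simp: circle_iff)

lemma circle_even_set: "circle G C \<Longrightarrow> even_set (ends G) (tedges C)"
  using circle_deg_in[of G C] track_finite_edges[OF circle_track] by (auto simp: even_set_def)

lemma circle_internal: "circle G C \<Longrightarrow> internal C = tverts C"
  by (auto simp: circle_iff internal_def)

lemma track_edge_at:
  assumes "track G P" "nontrivial P" "v \<in> tverts P"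
  shows "\<exists>e\<in>tedges P. v \<in> ends G e"
proof -
  have "0 < deg_in (ends G) (tedges P) v"
    using assms open_path_deg_in_terminus[of G P v] track_deg_in_internal[OF assms(1), of v]
      closed_path_deg_in[of G P v] circle_deg_in[of G P v]
    by (cases "v \<in> termini P") (auto simp: track_def path_def internal_def)
  then show ?thesis
    by (simp add: deg_in_pos_iff track_finite_edges[OF assms(1)])
qed

text \<open>Induction along the walk: its inner vertices are internal to the track, for paths and
  circles alike. Claims about all edges of a track are thereby reduced to its internal
  vertices.\<close>

lemma track_edges_connected:
  assumes P: "track G P" and e: "e \<in> tedges P" "e \<in> A"
    and step: "\<And>v e f. v \<in> internal P \<Longrightarrow> e \<in> tedges P \<Longrightarrow> f \<in> tedges P \<Longrightarrow> v \<in> ends G e \<Longrightarrow> v \<in> ends G f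
      \<Longrightarrow> e \<in> A \<Longrightarrow> f \<in> A"
  shows "tedges P \<subseteq> A"
proof -
  have main: "tedges P \<subseteq> A" if w: "walk G vs es" and d: "distinct (tl vs)" and oc: "distinct vs \<or> hd vs = last vs"
    and Pe: "tedges P = set es" "tverts P = set vs" "termini P \<subseteq> {hd vs, last vs}" for vs es
    unfolding Pe
  proof (rule walk_edges_connected[OF w _ e(2)])
    fix i assume i: "Suc i < length es"
    have len: "length vs = Suc (length es)"
      using w by (rule walk_length)
    have ne: "vs \<noteq> []"
      using w by (rule walk_nonempty)
    \<comment> \<open>Comparing positions inside \<open>tl vs\<close> covers the closed case, where
      the first vertex recurs as the last.\<close>
    have "vs ! Suc i = tl vs ! i" "last vs = tl vs ! (length es - 1)"
      using len i ne by (cases es; simp add: nth_tl last_conv_nth)+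
    then have l: "vs ! Suc i \<noteq> last vs"
      using d i len by (simp add: nth_eq_iff_index_eq)
    moreover have "vs ! Suc i \<noteq> hd vs"
    proof (cases "hd vs = last vs")
      case False
      then have "distinct vs"
        using oc by simp
      then show ?thesis
        using i len ne by (simp add: hd_conv_nth nth_eq_iff_index_eq)
    qed (use l in simp)
    ultimately have "vs ! Suc i \<in> internal P"
      using Pe i len by (auto simp: internal_def)
    then show "es ! i \<in> A \<longleftrightarrow> es ! Suc i \<in> A"
      using step[of "vs ! Suc i" "es ! i" "es ! Suc i"] step[of "vs ! Suc i" "es ! Suc i" "es ! i"]
        walk_ends_nth[OF w, of i] walk_ends_nth[OF w, of "Suc i"] i Pe by auto
  qed (use e Pe in auto)
  from P show ?thesis
    by (cases rule: trackE) (rule main; auto simp: distinct_tl)+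
qed

section \<open>Circles and isthmi\<close>

lemma circle_mono:
  assumes "circle H C" "verts H \<subseteq> verts G" "edges H \<subseteq> edges G" "ends H = ends G"
  shows "circle G C"
  using assms walk_mono[OF _ assms(2-4)] unfolding circle_iff by blast

lemma circle_restrict:
  assumes "circle G C" "tverts C \<subseteq> verts H" "tedges C \<subseteq> edges H" "ends H = ends G"
  shows "circle H C"
  using assms walk_restrict[of G _ _ H] unfolding circle_iff by fastforce

lemma path_restrict:
  assumes "path G P" "tverts P \<subseteq> verts H" "tedges P \<subseteq> edges H" "ends H = ends G"
  shows "path H P"
proof -
  have w: "walk H vs es" if "walk G vs es" "tverts P = set vs" "tedges P = set es" for vs es
    using walk_restrict[OF that(1)] that(2,3) assms(2-4) by simp
  from assms(1) consider "open_path G P" | "closed_path G P"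
    by (auto simp: path_def)
  then show ?thesis
  proof cases
    case 1
    then show ?thesis
      unfolding path_def open_path_def using w by (metis track.select_convs(1,2))
  next
    case 2
    then show ?thesis
      unfolding path_def closed_path_def using w by (metis track.select_convs(1,2))
  qed
qed

lemma graph_finite: "is_graph G \<Longrightarrow> finite (edges G)" "is_graph G \<Longrightarrow> finite (verts G)"
  by (auto simp: is_graph_def)

lemma graph_endsE:
  assumes "is_graph G" "e \<in> edges G"
  obtains a b where "ends G e = {a, b}" "a \<in> verts G" "b \<in> verts G"
proof -
  from assms have "ends G e \<subseteq> verts G" "card (ends G e) = 1 \<or> card (ends G e) = 2"
    by (auto simp: is_graph_def)
  then have "\<exists>a b. ends G e = {a, b}"
    by (auto simp: card_1_singleton_iff card_2_iff)
  then show thesis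
    using that \<open>ends G e \<subseteq> verts G\<close> by auto
qed

text \<open>Let X be the set of vertices reachable from one end of \<open>e\<close> without using
  \<open>e\<close>. If X contained the other end, a path there would close up with \<open>e\<close>
  to a circle; so \<open>e\<close> is the only edge leaving X. A loop closes up with the path of
  length 0.\<close>

lemma not_in_circle_imp_isthmus:
  assumes G: "is_graph G" and e: "e \<in> edges G" and nc: "\<And>C. circle G C \<Longrightarrow> e \<notin> tedges C"
  shows "isthmus G e"
proof -
  obtain a b where ab: "ends G e = {a, b}" "a \<in> verts G" "b \<in> verts G"
    using graph_endsE[OF G e] .
  define H where "H = G\<lparr>edges := edges G - {e}\<rparr>"
  define X where "X = {x. \<exists>vs es. walk H vs es \<and> hd vs = a \<and> last vs = x}"
  have bX: "b \<notin> X"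
  proof
    assume "b \<in> X"
    then obtain vs es where vs: "walk H vs es" "hd vs = a" "last vs = b" "distinct vs"
      unfolding X_def using walk_shorten by (smt (verit, best) mem_Collect_eq)
    have "walk G vs es"
      using vs(1) by (rule walk_mono) (auto simp: H_def)
    then have "walk G (b # vs) (e # es)"
      using vs ab e by (auto simp: walk_Cons_Cons)
    moreover have "e \<notin> set es"
      using walk_edges_subset[OF vs(1)] by (auto simp: H_def)
    ultimately have "circle G \<lparr>tverts = set (b # vs), tedges = set (e # es), termini = {}\<rparr>"
      using vs walk_distinct_edges[OF vs(1,4)] walk_nonempty[OF vs(1)]
      unfolding circle_iff by (intro exI[of _ "b # vs"] exI[of _ "e # es"]) auto
    then show False
      using nc by force
  qed
  have aX: "a \<in> X"
    unfolding X_def using ab by (intro CollectI exI[of _ "[a]"] exI[of _ "[]"]) (auto simp: H_def)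
  have XG: "X \<subseteq> verts G"
  proof
    fix x assume "x \<in> X"
    then obtain vs es where "walk H vs es" "last vs = x"
      unfolding X_def by blast
    then show "x \<in> verts G"
      using walk_verts_subset[of H vs es] walk_nonempty[of H vs es] last_in_set[of vs] by (auto simp: H_def)
  qed
  have step: "q \<in> X" if "p \<in> X" "f \<in> edges G" "f \<noteq> e" "ends G f = {p, q}" for p q f
  proof -
    obtain vs es where vs: "walk H vs es" "hd vs = a" "last vs = p"
      using \<open>p \<in> X\<close> unfolding X_def by blast
    have "p \<in> verts G" "q \<in> verts G"
      using that G by (auto simp: is_graph_def)
    then have "walk H [p, q] [f]"
      using that by (auto simp: walk_Cons_Cons H_def)
    from walk_append[OF vs(1) this] vs show ?thesis
      unfolding X_def using walk_nonempty[OF vs(1)] by (intro CollectI exI[of _ "vs @ [q]"] exI[of _ "es @ [f]"]) auto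
  qed
  have only: "f = e" if f: "f \<in> edges G" and "ends G f \<inter> X \<noteq> {}" "ends G f \<inter> (verts G - X) \<noteq> {}" for f
  proof (rule ccontr)
    assume "f \<noteq> e"
    obtain c d where cd: "ends G f = {c, d}"
      using graph_endsE[OF G f] .
    with that step[of c f d] step[of d f c] \<open>f \<noteq> e\<close> show False
      by (auto simp: insert_commute)
  qed
  have "ends G e \<inter> X \<noteq> {}" "ends G e \<inter> (verts G - X) \<noteq> {}"
    using ab aX bX by auto
  then have "{e} = {e \<in> edges G. ends G e \<inter> X \<noteq> {} \<and> ends G e \<inter> (verts G - X) \<noteq> {}}"
    using e only by blast
  then show ?thesis
    unfolding isthmus_def cut_def using XG by blast
qed

text \<open>Sum the degrees in \<open>A\<close> over the side X of the cut: the sum is even, every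
  edge that does not cross the cut contributes 0 or 2, and \<open>e\<close> would contribute
  1.\<close>

lemma isthmus_not_in_even_set:
  assumes G: "is_graph G" and i: "isthmus G e" and A: "even_set (ends G) A" "A \<subseteq> edges G"
  shows "e \<notin> A"
proof
  assume "e \<in> A"
  obtain X where X: "X \<subseteq> verts G" "{e} = {e \<in> edges G. ends G e \<inter> X \<noteq> {} \<and> ends G e \<inter> (verts G - X) \<noteq> {}}"
    using i unfolding isthmus_def cut_def by blast
  have fin: "finite X" "finite A"
    using X(1) A G finite_subset by (auto simp: even_set_def is_graph_def)
  define s where "s f = (\<Sum>v\<in>X. inc (ends G) f v)" for f
  have s: "s f = of_bool (a \<in> X) + of_bool (b \<in> X)" if "ends G f = {a, b}" for f a b
  proof -
    have "(\<Sum>v\<in>X. of_bool (c = v)) = (of_bool (c \<in> X) :: nat)" for c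
      using fin by (simp add: of_bool_def)
    then show ?thesis
      unfolding s_def inc_pair[of "ends G", OF that] by (simp add: sum.distrib)
  qed
  have "even (\<Sum>v\<in>X. deg_in (ends G) A v)"
    using A by (intro dvd_sum) (auto simp: even_set_def)
  also have "(\<Sum>v\<in>X. deg_in (ends G) A v) = (\<Sum>f\<in>A. s f)"
    unfolding deg_in_def s_def by (rule sum.swap)
  also have "\<dots> = s e + (\<Sum>f\<in>A - {e}. s f)"
    using fin \<open>e \<in> A\<close> by (simp add: sum.remove)
  finally have "even (s e + (\<Sum>f\<in>A - {e}. s f))" .
  moreover have "even (\<Sum>f\<in>A - {e}. s f)"
  proof (rule dvd_sum)
    fix f assume f: "f \<in> A - {e}"
    then have fe: "f \<in> edges G"
      using A by auto
    obtain a b where ab: "ends G f = {a, b}" "a \<in> verts G" "b \<in> verts G"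
      using graph_endsE[OF G fe] .
    have "f \<notin> {e \<in> edges G. ends G e \<inter> X \<noteq> {} \<and> ends G e \<inter> (verts G - X) \<noteq> {}}"
      using X f by blast
    then show "even (s f)"
      using fe ab by (auto simp: s)
  qed
  moreover have "odd (s e)"
  proof -
    have ee: "e \<in> edges G" "ends G e \<inter> X \<noteq> {}" "ends G e \<inter> (verts G - X) \<noteq> {}"
      using X(2) by auto
    obtain a b where ab: "ends G e = {a, b}" "a \<in> verts G" "b \<in> verts G"
      using graph_endsE[OF G ee(1)] .
    show ?thesis
      unfolding s[OF ab(1)] using ee ab by auto
  qed
  ultimately show False
    by simp
qed

lemma isthmus_edge: "isthmus G e \<Longrightarrow> e \<in> edges G"
  unfolding isthmus_def cut_def by blast

lemma isthmus_not_in_circle: "is_graph G \<Longrightarrow> isthmus G e \<Longrightarrow> circle G C \<Longrightarrow> e \<notin> tedges C"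
  by (rule isthmus_not_in_even_set) (auto intro: circle_even_set dest: track_edges_subset[OF circle_track])

text \<open>Parity forbids \<open>e\<close> to be an isthmus of the graph with edge set
  \<open>A\<close>, so it lies on a circle of that graph.\<close>

lemma even_set_contains_circle:
  assumes G: "is_graph G" and A: "even_set (ends G) A" "A \<subseteq> edges G" and e: "e \<in> A"
  obtains C where "circle G C" "e \<in> tedges C" "tedges C \<subseteq> A"
proof -
  define H where "H = G\<lparr>edges := A\<rparr>"
  have H: "is_graph H"
    using G A by (auto simp: is_graph_def H_def finite_subset)
  have "\<not> isthmus H e"
    using isthmus_not_in_even_set[OF H, of e A] A e by (auto simp: H_def)
  then obtain C where "circle H C" "e \<in> tedges C"
    using not_in_circle_imp_isthmus[OF H] e by (auto simp: H_def)
  moreover from this have "circle G C"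
    using circle_mono[OF \<open>circle H C\<close>] A by (auto simp: H_def)
  moreover have "tedges C \<subseteq> A"
    using track_edges_subset[OF circle_track[OF \<open>circle H C\<close>]] by (simp add: H_def)
  ultimately show thesis
    using that by blast
qed

text \<open>Where \<open>A\<close> has one edge of the circle at a vertex, evenness gives it the
  whole degree there, and so \<open>A\<close> spreads around the circle.\<close>

lemma circle_minimal:
  assumes C: "circle G C" and A: "A \<subseteq> tedges C" "A \<noteq> {}" "even_set (ends G) A"
  shows "A = tedges C"
proof -
  obtain e where e: "e \<in> A"
    using A by blast
  have fin: "finite (tedges C)"
    by (rule track_finite_edges[OF circle_track[OF C]])
  have "tedges C \<subseteq> A"
  proof (rule track_edges_connected[OF circle_track[OF C], of e])
    fix v e f
    assume *: "v \<in> internal C" "f \<in> tedges C" "v \<in> ends G e" "v \<in> ends G f" "e \<in> A"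
    have deg: "deg_in (ends G) (tedges C) v = 2"
      using *(1) by (rule track_deg_in_internal[OF circle_track[OF C]])
    have fA: "finite A"
      using A fin finite_subset by blast
    have "0 < deg_in (ends G) A v" "even (deg_in (ends G) A v)"
      using A(3) * fA by (auto simp: even_set_def deg_in_pos_iff)
    then have "deg_in (ends G) (tedges C) v \<le> deg_in (ends G) A v"
      using deg by (auto elim!: evenE)
    then show "f \<in> A"
      by (rule deg_in_eq_imp_contains[where E = "ends G", OF fA fin A(1) _ *(2,4)])
  qed (use e A in auto)
  then show ?thesis
    using A by blast
qed

text \<open>Replacing \<open>C1\<close> by a circle through \<open>e\<close> in the symmetric difference shrinks \<open>C1 \<union> C2\<close>.\<close>

lemma circle_transitive:
  assumes G: "is_graph G"
  shows "circle G C1 \<Longrightarrow> circle G C2 \<Longrightarrow> e \<in> tedges C1 \<Longrightarrow> f \<in> tedges C2 \<Longrightarrow> tedges C1 \<inter> tedges C2 \<noteq> {}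
    \<Longrightarrow> \<exists>C. circle G C \<and> e \<in> tedges C \<and> f \<in> tedges C"
proof (induction "card (tedges C1 \<union> tedges C2)" arbitrary: C1 rule: less_induct)
  case less
  let ?D = "(tedges C1 - tedges C2) \<union> (tedges C2 - tedges C1)"
  show ?case
  proof (cases "f \<in> tedges C1 \<or> e \<in> tedges C2")
    case True
    then show ?thesis
      using less.prems by blast
  next
    case False
    have sub: "tedges C1 \<subseteq> edges G" "tedges C2 \<subseteq> edges G"
      using less.prems(1,2) by (auto dest!: circle_track track_edges_subset)
    have D: "even_set (ends G) ?D"
      using less.prems by (intro even_set_sym_diff circle_even_set)
    obtain D1 where D1: "circle G D1" "e \<in> tedges D1" "tedges D1 \<subseteq> ?D"
      using even_set_contains_circle[OF G D, of e] sub less.prems False by blast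
    show ?thesis
    proof (cases "f \<in> tedges D1")
      case True
      then show ?thesis
        using D1 by blast
    next
      case fD1: False
      have "even_set (ends G) (?D - tedges D1)"
        using even_set_diff[OF D circle_even_set[OF D1(1)] D1(3)] .
      then obtain D2 where D2: "circle G D2" "f \<in> tedges D2" "tedges D2 \<subseteq> ?D - tedges D1"
        using even_set_contains_circle[OF G, of "?D - tedges D1" f] sub less.prems False fD1 by blast
      \<comment> \<open>By minimality \<open>D1\<close> would otherwise be all of \<open>C1\<close>,
        including the edges shared with \<open>C2\<close> that the symmetric difference
        omits.\<close>
      have "\<not> tedges D1 \<subseteq> tedges C1"
        using circle_minimal[OF less.prems(1) _ _ circle_even_set[OF D1(1)]] D1 less.prems by blast
      then have meet: "tedges D1 \<inter> tedges C2 \<noteq> {}"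
        using D1 by blast
      \<comment> \<open>In the same way \<open>D2\<close> has an edge in \<open>C1\<close> outside
        \<open>C2\<close>. As \<open>D2\<close> avoids \<open>D1\<close>, this edge is lost when
        \<open>D1\<close> replaces \<open>C1\<close>.\<close>
      have "\<not> tedges D2 \<subseteq> tedges C2"
        using circle_minimal[OF less.prems(2) _ _ circle_even_set[OF D2(1)]] D2 less.prems by blast
      then have "tedges D1 \<union> tedges C2 \<subset> tedges C1 \<union> tedges C2"
        using D1 D2 by blast
      moreover have "finite (tedges C1 \<union> tedges C2)"
        using less.prems(1,2) by (auto dest!: circle_track track_finite_edges)
      ultimately have "card (tedges D1 \<union> tedges C2) < card (tedges C1 \<union> tedges C2)"
        by (intro psubset_card_mono)
      then show ?thesis
        using less.hyps[of D1] D1 less.prems meet by blast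
    qed
  qed
qed

text \<open>An even set is used up by removing circles from it one after another, and signs
  multiply.\<close>

lemma balanced_iff_even_sets:
  assumes G: "is_graph G"
  shows "balanced G \<sigma> \<longleftrightarrow> (\<forall>A \<subseteq> edges G. even_set (ends G) A \<longrightarrow> (\<Prod>e\<in>A. \<sigma> e) = 1)"
proof
  assume b: "balanced G \<sigma>"
  have "(\<Prod>e\<in>A. \<sigma> e) = 1" if "A \<subseteq> edges G" "even_set (ends G) A" for A
    using that
  proof (induction "card A" arbitrary: A rule: less_induct)
    case less
    show ?case
    proof (cases "A = {}")
      case False
      then obtain e where "e \<in> A"
        by blast
      then obtain C where C: "circle G C" "e \<in> tedges C" "tedges C \<subseteq> A"
        using even_set_contains_circle[OF G] less.prems by metis
      have fin: "finite A"
        using less.prems by (simp add: even_set_def)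
      have "card (A - tedges C) < card A"
        using C fin by (intro psubset_card_mono) auto
      moreover have "even_set (ends G) (A - tedges C)"
        using even_set_diff less.prems C circle_even_set by blast
      ultimately have "(\<Prod>e\<in>A - tedges C. \<sigma> e) = 1"
        using less.hyps[of "A - tedges C"] less.prems by blast
      moreover have "(\<Prod>e\<in>tedges C. \<sigma> e) = 1"
        using b C by (auto simp: balanced_def track_sign_def)
      ultimately show ?thesis
        using prod.subset_diff[OF C(3) fin, of \<sigma>] by simp
    qed simp
  qed
  then show "\<forall>A \<subseteq> edges G. even_set (ends G) A \<longrightarrow> (\<Prod>e\<in>A. \<sigma> e) = 1"
    by blast
next
  assume *: "\<forall>A \<subseteq> edges G. even_set (ends G) A \<longrightarrow> (\<Prod>e\<in>A. \<sigma> e) = 1"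
  show "balanced G \<sigma>"
    unfolding balanced_def track_sign_def
  proof (intro allI impI)
    fix C assume C: "circle G C"
    show "(\<Prod>e\<in>tedges C. \<sigma> e) = 1"
      using * circle_even_set[OF C] track_edges_subset[OF circle_track[OF C]] by blast
  qed
qed

section \<open>Subgraphs and connectedness\<close>

lemma subgraph_trans: "subgraph A B \<Longrightarrow> subgraph B C \<Longrightarrow> subgraph A C"
  by (auto simp: subgraph_def)

lemma walk_in_closed_set:
  assumes "walk H vs es" "hd vs \<in> X"
    and "\<And>e a b. e \<in> edges H \<Longrightarrow> ends H e = {a, b} \<Longrightarrow> a \<in> X \<Longrightarrow> b \<in> X"
  shows "set vs \<subseteq> X"
  using assms(1,2)
proof (induction es arbitrary: vs)
  case Nil
  then show ?case
    by (auto simp: walk_Nil_iff)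
next
  case (Cons e es)
  then obtain u us where vs: "vs = u # us" "e \<in> edges H" "ends H e = {u, hd us}" "walk H us es"
    by (auto simp: walk_Cons_iff)
  then have "hd us \<in> X"
    using assms(3) Cons.prems by auto
  then show ?case
    using Cons vs by auto
qed

lemma connected_graphI:
  assumes x: "x \<in> verts H" and r: "\<And>u. u \<in> verts H \<Longrightarrow> \<exists>vs es. walk H vs es \<and> hd vs = x \<and> last vs = u"
  shows "connected_graph H"
  unfolding connected_graph_def
proof (intro conjI ballI)
  fix u w assume "u \<in> verts H" "w \<in> verts H"
  then obtain vs es ws fs where *: "walk H vs es" "hd vs = x" "last vs = u" "walk H ws fs" "hd ws = x" "last ws = w"
    using r by meson
  have ne: "vs \<noteq> []" "ws \<noteq> []"
    using * by (auto dest: walk_nonempty)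
  have "walk H (rev vs @ tl ws) (rev es @ fs)"
    using * ne by (intro walk_append walk_rev) (auto simp: last_rev)
  moreover have "hd (rev vs @ tl ws) = u"
    using * ne by (simp add: hd_rev hd_append)
  moreover have "last (rev vs @ tl ws) = w"
    using * ne by (cases ws) (auto simp: last_append last_rev)
  ultimately show "\<exists>vs es. walk H vs es \<and> hd vs = u \<and> last vs = w"
    by blast
qed (use x in blast)

lemma connected_Un:
  assumes H: "connected_graph H" and K: "connected_graph K" and x: "x \<in> verts H" "x \<in> verts K"
    and U: "verts U = verts H \<union> verts K" "edges U = edges H \<union> edges K" "ends U = ends H" "ends U = ends K"
  shows "connected_graph U"
proof (rule connected_graphI)
  show "x \<in> verts U"
    using x U by simp
  fix u assume "u \<in> verts U"
  then consider "u \<in> verts H" | "u \<in> verts K"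
    using U by auto
  then show "\<exists>vs es. walk U vs es \<and> hd vs = x \<and> last vs = u"
  proof cases
    case 1
    then obtain vs es where "walk H vs es" "hd vs = x" "last vs = u"
      using H x by (meson connected_graph_def)
    then show ?thesis
      using walk_mono[of H vs es U] U by auto
  next
    case 2
    then obtain vs es where "walk K vs es" "hd vs = x" "last vs = u"
      using K x by (meson connected_graph_def)
    then show ?thesis
      using walk_mono[of K vs es U] U by auto
  qed
qed

text \<open>A walk that starts in M never leaves it. This serves to identify a block, or a union of
  blocks, with a circle inside it.\<close>

lemma connected_graph_eqI:
  fixes H M :: "('v, 'e) graph"
  assumes M: "subgraph M H" and H: "is_graph H" "connected_graph H" and ne: "verts M \<noteq> {}"
    and touch: "\<And>e. e \<in> edges H \<Longrightarrow> ends H e \<inter> verts M \<noteq> {} \<Longrightarrow> e \<in> edges M"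
  shows "H = M"
proof -
  obtain x where x: "x \<in> verts M"
    using ne by blast
  have e: "ends M = ends H" "is_graph M" "verts M \<subseteq> verts H" "edges M \<subseteq> edges H"
    using M by (auto simp: subgraph_def)
  have "w \<in> verts M" if wH: "w \<in> verts H" for w
  proof -
    have "x \<in> verts H"
      using x e by blast
    then obtain vs es where vs: "walk H vs es" "hd vs = x" "last vs = w"
      using H(2) wH by (meson connected_graph_def)
    have "set vs \<subseteq> verts M"
    proof (rule walk_in_closed_set[OF vs(1)])
      fix f a b assume f: "f \<in> edges H" "ends H f = {a, b}" "a \<in> verts M"
      then have "f \<in> edges M"
        using touch by auto
      then show "b \<in> verts M"
        using e f by (auto simp: is_graph_def)
    qed (use vs x in auto)
    then show ?thesis
      using vs walk_hd_last[OF vs(1)] by auto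
  qed
  then have V: "verts H = verts M"
    using e by blast
  moreover have "edges H \<subseteq> edges M"
  proof
    fix f assume f: "f \<in> edges H"
    obtain a b where "ends H f = {a, b}" "a \<in> verts H" "b \<in> verts H"
      using graph_endsE[OF H(1) f] .
    then show "f \<in> edges M"
      using touch[OF f] V by auto
  qed
  ultimately show ?thesis
    using e by (intro graph.equality) auto
qed

lemma track_graph_simps [simp]:
  "verts (track_graph G P) = tverts P" "edges (track_graph G P) = tedges P" "ends (track_graph G P) = ends G"
  by (simp_all add: track_graph_def)

lemma track_graph_subgraph:
  assumes "is_graph G" "track G P"
  shows "subgraph (track_graph G P) G"
proof -
  have "is_graph (track_graph G P)"
    unfolding is_graph_def
  proof (intro conjI ballI)
    fix e assume "e \<in> edges (track_graph G P)"
    then have e: "e \<in> tedges P"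
      by simp
    then show "ends (track_graph G P) e \<subseteq> verts (track_graph G P)"
      using track_ends_subset[OF assms(2)] by simp
    show "card (ends (track_graph G P) e) \<in> {1, 2}"
      using e assms(1) track_edges_subset[OF assms(2)] by (auto simp: is_graph_def)
  qed (use track_finite_verts[OF assms(2)] track_finite_edges[OF assms(2)] in auto)
  then show ?thesis
    using track_verts_subset[OF assms(2)] track_edges_subset[OF assms(2)] by (simp add: subgraph_def)
qed

lemma track_graph_connected:
  assumes "track G P"
  shows "connected_graph (track_graph G P)"
proof -
  have main: "connected_graph (track_graph G P)" if w: "walk G vs es" and P: "tverts P = set vs" "tedges P = set es" for vs es
  proof (rule connected_graphI)
    have w': "walk (track_graph G P) vs es"
      using w by (rule walk_restrict) (auto simp: P)
    show "hd vs \<in> verts (track_graph G P)"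
      using walk_hd_last[OF w] P by simp
    fix u assume "u \<in> verts (track_graph G P)"
    then obtain i where i: "i < length vs" "vs ! i = u"
      using P by (auto simp: in_set_conv_nth)
    then have "walk (track_graph G P) (take (Suc i) vs) (take i es)"
      using walk_take[OF w'] walk_length[OF w] by simp
    moreover have "hd (take (Suc i) vs) = hd vs"
      by (cases vs) auto
    moreover have "last (take (Suc i) vs) = u"
      using i by (simp add: take_Suc_conv_app_nth)
    ultimately show "\<exists>vs' es'. walk (track_graph G P) vs' es' \<and> hd vs' = hd vs \<and> last vs' = u"
      by blast
  qed
  show ?thesis
    using assms by (cases rule: trackE) (rule main; simp)+
qed

section \<open>Blocks\<close>

text \<open>Vertices and edges are bounded in number by those of G, so some cocircular extension of
  \<open>H\<close> has greatest size, and greatest size implies maximality.\<close>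

lemma cocircular_block:
  fixes H :: "('v, 'e) graph"
  assumes G: "is_graph G" and H: "cocircular G H"
  obtains B where "block G B" "subgraph H B"
proof -
  define m where "m B = card (verts B) + card (edges B)" for B :: "('v, 'e) graph"
  have bound: "m B \<le> m G" if "cocircular G B" for B
    using that G unfolding m_def cocircular_def subgraph_def is_graph_def
    by (intro add_mono card_mono) auto
  have "\<exists>B. (cocircular G B \<and> subgraph H B) \<and> (\<forall>B'. cocircular G B' \<and> subgraph H B' \<longrightarrow> m B' \<le> m B)"
  proof (rule ex_has_greatest_nat[where k = H and b = "Suc (m G)"])
    show "cocircular G H \<and> subgraph H H"
      using H by (auto simp: cocircular_def subgraph_def)
    show "\<forall>y. cocircular G y \<and> subgraph H y \<longrightarrow> m y < Suc (m G)"
      using bound by (auto simp: less_Suc_eq_le)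
  qed
  then obtain B where B: "cocircular G B" "subgraph H B"
    and max: "\<And>B'. cocircular G B' \<Longrightarrow> subgraph H B' \<Longrightarrow> m B' \<le> m B"
    by blast
  have "block G B"
    unfolding block_def
  proof (intro conjI allI impI)
    fix B' assume B': "cocircular G B' \<and> subgraph B B'"
    then have "m B' \<le> m B"
      using max[of B'] B subgraph_trans[of H B B'] by blast
    have sub: "verts B \<subseteq> verts B'" "edges B \<subseteq> edges B'" "ends B = ends B'"
      using B' by (auto simp: subgraph_def)
    have fin: "finite (verts B')" "finite (edges B')"
      using B' by (auto simp: cocircular_def subgraph_def is_graph_def)
    have "card (verts B) \<le> card (verts B')" "card (edges B) \<le> card (edges B')"
      using sub fin by (simp_all add: card_mono)
    then have "card (verts B) = card (verts B')" "card (edges B) = card (edges B')"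
      using \<open>m B' \<le> m B\<close> by (auto simp: m_def)
    then have "verts B = verts B'" "edges B = edges B'"
      using sub fin by (simp_all add: card_subset_eq)
    then show "B' = B"
      using sub by (intro graph.equality) auto
  qed (use B in blast)
  then show thesis
    using that B by blast
qed

lemma circle_cocircular:
  assumes G: "is_graph G" and C: "circle G C"
  shows "cocircular G (track_graph G C)"
  using track_graph_subgraph[OF G circle_track[OF C]] track_graph_connected[OF circle_track[OF C]] C
  unfolding cocircular_def by auto

lemma circle_in_track_graph: "circle G C \<Longrightarrow> circle (track_graph G C) C"
  by (erule circle_restrict) auto

lemma subgraph_circle: "subgraph H G \<Longrightarrow> circle H C \<Longrightarrow> circle G C"
  using circle_mono[of H C G] by (auto simp: subgraph_def)

lemma circle_in_nontrivial_block:
  assumes G: "is_graph G" and C: "circle G C"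
  obtains B where "nontrivial_block G B" "subgraph (track_graph G C) B"
proof -
  obtain B where B: "block G B" "subgraph (track_graph G C) B"
    using cocircular_block[OF G circle_cocircular[OF G C]] .
  then have "nontrivial_block G B"
    using subgraph_circle[OF B(2) circle_in_track_graph[OF C]] by (auto simp: nontrivial_block_def)
  then show thesis
    using that B by blast
qed

lemma nontrivial_block_subgraph: "nontrivial_block G B \<Longrightarrow> subgraph B G"
  and nontrivial_block_connected: "nontrivial_block G B \<Longrightarrow> connected_graph B"
  by (auto simp: nontrivial_block_def block_def cocircular_def)

lemma nontrivial_block_edge_in_circle:
  assumes B: "nontrivial_block G B" and f: "f \<in> edges B"
  obtains C where "circle G C" "f \<in> tedges C"
proof -
  obtain D where D: "circle B D"
    using B by (auto simp: nontrivial_block_def)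
  then obtain e where e: "e \<in> tedges D"
    using circle_nontrivial by blast
  then have eB: "e \<in> edges B"
    using track_edges_subset[OF circle_track[OF D]] by blast
  show thesis
  proof (cases "e = f")
    case True
    then show thesis
      using that subgraph_circle[OF nontrivial_block_subgraph[OF B] D] e by blast
  next
    case False
    then show thesis
      using that B eB f unfolding nontrivial_block_def block_def cocircular_def by blast
  qed
qed

text \<open>Transitivity through the common edge \<open>b\<close> puts every edge of the circle on a
  common circle with every edge of the block, so maximality applies to the union.\<close>

lemma nontrivial_block_absorbs_circle:
  fixes B :: "('v, 'e) graph"
  assumes G: "is_graph G" and B: "nontrivial_block G B" and C: "circle G C"
    and b: "b \<in> edges B" "b \<in> tedges C"
  shows "subgraph (track_graph G C) B"
proof -
  define U :: "('v, 'e) graph" where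
    "U = \<lparr>verts = verts B \<union> tverts C, edges = edges B \<union> tedges C, ends = ends G\<rparr>"
  have BG: "is_graph B" "verts B \<subseteq> verts G" "edges B \<subseteq> edges G" "ends B = ends G" "connected_graph B"
    and cocirc: "\<And>e f. e \<in> edges B \<Longrightarrow> f \<in> edges B \<Longrightarrow> e \<noteq> f \<Longrightarrow> \<exists>C. circle G C \<and> e \<in> tedges C \<and> f \<in> tedges C"
    using B by (auto simp: nontrivial_block_def block_def cocircular_def subgraph_def)
  have T: "subgraph (track_graph G C) G" "connected_graph (track_graph G C)"
    using track_graph_subgraph[OF G circle_track[OF C]] track_graph_connected[OF circle_track[OF C]] .
  have U: "subgraph U G" "subgraph B U" "subgraph (track_graph G C) U"
    using BG T by (auto simp: subgraph_def is_graph_def U_def)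
  obtain x y where "ends G b = {x, y}" "x \<in> verts B"
    using graph_endsE[OF BG(1) b(1)] BG(4) by metis
  then have x: "x \<in> verts B" "x \<in> tverts C"
    using track_ends_subset[OF circle_track[OF C] b(2)] by auto
  have "connected_graph U"
    using BG(5) T(2) by (rule connected_Un[where x = x]) (use x BG in \<open>auto simp: U_def\<close>)
  moreover have mixed: "\<exists>D. circle G D \<and> e \<in> tedges D \<and> f \<in> tedges D" if ef: "e \<in> edges B" "f \<in> tedges C" for e f
  proof (cases "e = b")
    case True
    then show ?thesis
      using C b ef by blast
  next
    case False
    then obtain D where D: "circle G D" "e \<in> tedges D" "b \<in> tedges D"
      using cocirc b ef by blast
    show ?thesis
      by (rule circle_transitive[OF G D(1) C D(2) ef(2)]) (use b D in blast)
  qed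
  have "\<exists>D. circle G D \<and> e \<in> tedges D \<and> f \<in> tedges D" if ef: "e \<in> edges U" "f \<in> edges U" "e \<noteq> f" for e f
  proof -
    consider "e \<in> edges B" "f \<in> edges B" | "e \<in> edges B" "f \<in> tedges C" | "e \<in> tedges C" "f \<in> edges B"
      | "e \<in> tedges C" "f \<in> tedges C"
      using ef by (auto simp: U_def)
    then show ?thesis
      using cocirc[of e f] mixed[of e f] mixed[of f e] C \<open>e \<noteq> f\<close> by cases blast+
  qed
  ultimately have "cocircular G U"
    using U unfolding cocircular_def by blast
  then have "U = B"
    using B U unfolding nontrivial_block_def block_def by blast
  then show ?thesis
    using U by simp
qed

section \<open>Joining paths\<close>

lemma open_path_oriented:
  assumes "open_path G P" "v \<in> termini P"
  obtains vs es where "walk G vs es" "distinct vs" "hd vs = v" "tverts P = set vs" "tedges P = set es"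
    "termini P = {v, last vs}"
proof -
  obtain vs es where *: "walk G vs es" "distinct vs" "P = \<lparr>tverts = set vs, tedges = set es, termini = {hd vs, last vs}\<rparr>"
    using assms by (auto simp: open_path_def)
  consider "v = hd vs" | "v = last vs"
    using assms(2) * by auto
  then show thesis
  proof cases
    case 1
    then show thesis
      using that * by simp
  next
    case 2
    then show thesis
      using that[of "rev vs" "rev es"] * walk_rev[OF *(1)] walk_nonempty[OF *(1)]
      by (auto simp: hd_rev last_rev)
  qed
qed

text \<open>Only termini may be shared. If the other two termini coincide as well, the result is a
  closed path, which is why the conclusion speaks of \<open>path\<close> and not of
  \<open>open_path\<close>.\<close>

lemma path_join:
  assumes P: "open_path G P" "nontrivial P" and Q: "open_path G Q" "nontrivial Q"
    and v: "v \<in> termini P" "v \<in> termini Q"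
    and disj: "tverts P \<inter> tverts Q \<subseteq> termini P \<inter> termini Q" "tedges P \<inter> tedges Q = {}"
  shows "path G \<lparr>tverts = tverts P \<union> tverts Q, tedges = tedges P \<union> tedges Q,
     termini = (termini P \<union> termini Q) - {v}\<rparr>"
proof -
  obtain us es where us: "walk G us es" "distinct us" "hd us = v" "tverts P = set us" "tedges P = set es"
    "termini P = {v, last us}"
    using open_path_oriented[OF P(1) v(1)] .
  define vs where "vs = rev us"
  define ds where "ds = rev es"
  have vs: "walk G vs ds" "distinct vs" "last vs = v" "tverts P = set vs" "tedges P = set ds"
    "termini P = {v, hd vs}"
    using us walk_rev[OF us(1)] walk_nonempty[OF us(1)] by (auto simp: vs_def ds_def hd_rev last_rev)
  obtain ws fs where ws: "walk G ws fs" "distinct ws" "hd ws = v" "tverts Q = set ws" "tedges Q = set fs"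
    "termini Q = {v, last ws}"
    using open_path_oriented[OF Q(1) v(2)] .
  have ne: "vs \<noteq> []" "ws \<noteq> []"
    using vs ws by (auto dest: walk_nonempty)
  have neq: "hd vs \<noteq> v" "last ws \<noteq> v"
    using open_path_termini[OF P] open_path_termini[OF Q] vs(6) ws(6) by (auto simp: card_insert_if split: if_splits)
  have tlw: "tl ws \<noteq> []" "ws = v # tl ws"
    using neq ne ws(3) by (cases ws; auto)+
  have W: "walk G (vs @ tl ws) (ds @ fs)"
    using walk_append[OF vs(1) ws(1)] vs(3) ws(3) by simp
  have V: "set (vs @ tl ws) = tverts P \<union> tverts Q"
    using vs ws ne tlw(2) by (metis Un_insert_right last_in_set insert_absorb list.simps(15) set_append sup.absorb_iff1 Un_insert_left UnI1)
  have E: "set (ds @ fs) = tedges P \<union> tedges Q"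
    using vs ws by simp
  have hl: "hd (vs @ tl ws) = hd vs" "last (vs @ tl ws) = last ws"
    using ne tlw by (auto simp: hd_append last_append last_tl)
  have dE: "distinct (ds @ fs)"
    using walk_distinct_edges[OF vs(1,2)] walk_distinct_edges[OF ws(1,2)] disj(2) vs(5) ws(5) by auto
  have vt: "v \<notin> set (tl ws)"
    using ws(2) tlw(2) by (metis distinct.simps(2))
  have common: "x = v \<or> (x = hd vs \<and> x = last ws)" if "x \<in> set vs" "x \<in> set ws" for x
    using disj(1) that unfolding vs(4,6) ws(4,6) by auto
  show ?thesis
  proof (cases "hd vs = last ws")
    case True
    have "hd vs \<notin> set (tl vs)"
      using vs(2) ne by (cases vs) auto
    then have "set (tl vs) \<inter> set (tl ws) = {}"
      using common vt
      using list.set_sel(2)[OF ne(1)] list.set_sel(2)[OF ne(2)] by blast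
    then have "distinct (tl (vs @ tl ws))"
      using vs(2) ws(2) ne by (simp add: distinct_tl)
    moreover have "ds @ fs \<noteq> []"
      using P(2) vs(5) by (auto simp: nontrivial_def)
    moreover have "(termini P \<union> termini Q) - {v} = {hd (vs @ tl ws)}"
      using vs(6) ws(6) True neq hl by auto
    ultimately have "closed_path G \<lparr>tverts = tverts P \<union> tverts Q, tedges = tedges P \<union> tedges Q,
        termini = (termini P \<union> termini Q) - {v}\<rparr>"
      unfolding closed_path_def using W V E hl True dE
      by (intro exI[of _ "vs @ tl ws"] exI[of _ "ds @ fs"]) auto
    then show ?thesis
      by (simp add: path_def)
  next
    case False
    have "set vs \<inter> set (tl ws) = {}"
      using common vt False list.set_sel(2)[OF ne(2)] by blast
    then have "distinct (vs @ tl ws)"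
      using vs(2) ws(2) by (simp add: distinct_tl)
    moreover have "(termini P \<union> termini Q) - {v} = {hd (vs @ tl ws), last (vs @ tl ws)}"
      using vs(6) ws(6) neq hl by auto
    ultimately have "open_path G \<lparr>tverts = tverts P \<union> tverts Q, tedges = tedges P \<union> tedges Q,
        termini = (termini P \<union> termini Q) - {v}\<rparr>"
      unfolding open_path_def using W V E
      by (intro exI[of _ "vs @ tl ws"] exI[of _ "ds @ fs"]) auto
    then show ?thesis
      by (simp add: path_def)
  qed
qed

text \<open>Meant is the segment between \<open>u\<close> and \<open>v\<close>. Only the parity of
  its degrees is recorded, since this is what completes it to an even set with another path between
  the same vertices.\<close>

lemma open_path_segment_parity:
  assumes P: "open_path G P" and v: "v \<in> termini P" and u: "u \<in> tverts P" "u \<noteq> v"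
  obtains A where "A \<subseteq> tedges P" "\<And>x. odd (deg_in (ends G) A x) \<longleftrightarrow> x = u \<or> x = v"
proof -
  obtain vs es where vs: "walk G vs es" "distinct vs" "hd vs = v" "tverts P = set vs" "tedges P = set es"
    "termini P = {v, last vs}"
    using open_path_oriented[OF P v] .
  obtain i where i: "i < length vs" "vs ! i = u"
    using u vs(4) by (auto simp: in_set_conv_nth)
  have w: "walk G (take (Suc i) vs) (take i es)"
    using walk_take[OF vs(1)] i walk_length[OF vs(1)] by simp
  have hl: "hd (take (Suc i) vs) = v" "last (take (Suc i) vs) = u"
    using i vs(3) by (auto simp: take_Suc_conv_app_nth hd_append hd_conv_nth)
  have "odd (deg_in (ends G) (set (take i es)) x) \<longleftrightarrow> x = u \<or> x = v" for x
    using walk_deg_in_distinct[OF w, of x] walk_hd_last[OF w] hl u(2) vs(2) by auto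
  then show thesis
    using that[of "set (take i es)"] vs(5) by (auto dest: in_set_takeD)
qed

text \<open>A loop becomes the closed path at its vertex, never a circle. These tracks therefore
  have no internal vertices; they are the start of the linking and also the subdivision that retains
  every edge.\<close>

definition edge_track :: "('e \<Rightarrow> 'v set) \<Rightarrow> 'e \<Rightarrow> ('v, 'e) track" where
  "edge_track E e = \<lparr>tverts = E e, tedges = {e}, termini = E e\<rparr>"

lemma edge_track_path:
  assumes G: "is_graph G" and e: "e \<in> edges G"
  shows "path G (edge_track (ends G) e)"
proof -
  obtain a b where ab: "ends G e = {a, b}" "a \<in> verts G" "b \<in> verts G"
    using graph_endsE[OF G e] .
  then have w: "walk G [a, b] [e]"
    using e by (simp add: walk_Cons_Cons)
  show ?thesis
  proof (cases "a = b")
    case True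
    then have "closed_path G (edge_track (ends G) e)"
      unfolding closed_path_def edge_track_def using w ab
      by (intro exI[of _ "[a, b]"] exI[of _ "[e]"]) auto
    then show ?thesis
      by (simp add: path_def)
  next
    case False
    then have "open_path G (edge_track (ends G) e)"
      unfolding open_path_def edge_track_def using w ab
      by (intro exI[of _ "[a, b]"] exI[of _ "[e]"]) auto
    then show ?thesis
      by (simp add: path_def)
  qed
qed

section \<open>Linking edges into tracks\<close>

text \<open>At a vertex \<open>v \<in> L\<close> the edges \<open>N v\<close> (two links or one loop) are to be consecutive in a track.\<close>

locale linkage =
  fixes H :: "('v, 'e) graph" and F :: "'e set" and L :: "'v set" and N :: "'v \<Rightarrow> 'e set"
  assumes graph: "is_graph H"
    and F_edges: "F \<subseteq> edges H"
    and N_subset: "v \<in> L \<Longrightarrow> N v \<subseteq> {e \<in> F. v \<in> ends H e}"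
    and N_degree: "v \<in> L \<Longrightarrow> deg_in (ends H) (N v) v = 2"
    and not_N: "v \<in> L \<Longrightarrow> e \<in> edges H \<Longrightarrow> v \<in> ends H e \<Longrightarrow> e \<notin> N v \<Longrightarrow> circle H C \<Longrightarrow> e \<notin> tedges C"
begin

definition edges_at :: "('v, 'e) track \<Rightarrow> 'v \<Rightarrow> 'e set" where
  "edges_at P v = {e \<in> tedges P. v \<in> ends H e}"

text \<open>A stage of the linking process. Internal vertices are those where the prescribed link
  has been made; a vertex of \<open>L\<close> may still be a terminus.\<close>

definition linked :: "('v, 'e) track set \<Rightarrow> bool" where
  "linked \<D> \<longleftrightarrow> finite \<D> \<and> (\<forall>P \<in> \<D>. track H P \<and> nontrivial P) \<and> (\<Union>P \<in> \<D>. tedges P) = F \<and>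
     pairwise (\<lambda>P Q. disjnt (tedges P) (tedges Q)) \<D> \<and>
     (\<forall>P \<in> \<D>. \<forall>v \<in> internal P. v \<in> L \<and> edges_at P v = N v)"

lemma finite_F: "finite F"
  using graph F_edges finite_subset by (auto simp: is_graph_def)

lemma finite_N: "v \<in> L \<Longrightarrow> finite (N v)"
  using N_subset[of v] finite_F by (auto intro: finite_subset)

lemma linked_single_edges: "linked (edge_track (ends H) ` F)"
proof -
  have "track H (edge_track (ends H) e)" if "e \<in> F" for e
    using edge_track_path[OF graph] that F_edges by (auto simp: track_def)
  then show ?thesis
    using finite_F unfolding linked_def pairwise_def
    by (auto simp: edge_track_def nontrivial_def internal_def disjnt_def)
qed

lemma finite_edges_at: "track H P \<Longrightarrow> finite (edges_at P v)"
  unfolding edges_at_def by (auto dest: track_finite_edges)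

lemma deg_in_edges_at: "track H P \<Longrightarrow> deg_in (ends H) (edges_at P v) v = deg_in (ends H) (tedges P) v"
  unfolding edges_at_def by (intro deg_in_at track_finite_edges)

lemma edges_at_eq_N:
  assumes "track H P" "v \<in> L" "deg_in (ends H) (tedges P) v = 2" "edges_at P v \<subseteq> N v"
  shows "edges_at P v = N v"
proof -
  have "e \<in> edges_at P v" if "e \<in> N v" for e
    by (rule deg_in_eq_imp_contains[where E = "ends H", OF finite_edges_at[OF assms(1)] finite_N[OF assms(2)] assms(4) _ that])
      (use N_subset[OF assms(2)] N_degree[OF assms(2)] assms deg_in_edges_at that in auto)
  then show ?thesis
    using assms(4) by blast
qed

text \<open>Edges at \<open>v\<close> outside \<open>N v\<close> lie on no circle, so the degree 2
  of the circle at \<open>v\<close> comes from \<open>N v\<close> alone.\<close>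

lemma circle_at_L:
  assumes C: "circle H C" and v: "v \<in> L" "v \<in> tverts C"
  shows "edges_at C v = N v"
proof (rule edges_at_eq_N[OF circle_track[OF C] v(1)])
  show "deg_in (ends H) (tedges C) v = 2"
    using circle_deg_in[OF C, of v] v by simp
  show "edges_at C v \<subseteq> N v"
  proof
    fix e assume e: "e \<in> edges_at C v"
    then have "e \<in> edges H"
      using track_edges_subset[OF circle_track[OF C]] by (auto simp: edges_at_def)
    then show "e \<in> N v"
      using not_N[OF v(1) _ _ _ C, of e] e by (auto simp: edges_at_def)
  qed
qed

lemma linkedD:
  assumes "linked \<D>"
  shows "finite \<D>" "P \<in> \<D> \<Longrightarrow> track H P" "P \<in> \<D> \<Longrightarrow> nontrivial P" "(\<Union>P \<in> \<D>. tedges P) = F"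
    "P \<in> \<D> \<Longrightarrow> Q \<in> \<D> \<Longrightarrow> e \<in> tedges P \<Longrightarrow> e \<in> tedges Q \<Longrightarrow> P = Q"
    "P \<in> \<D> \<Longrightarrow> v \<in> internal P \<Longrightarrow> v \<in> L" "P \<in> \<D> \<Longrightarrow> v \<in> internal P \<Longrightarrow> edges_at P v = N v"
  using assms unfolding linked_def pairwise_def disjnt_def by blast+

text \<open>At an internal vertex of \<open>P\<close> on the circle, the edges of \<open>P\<close>
  and those of \<open>C\<close> are both exactly \<open>N v\<close>, so \<open>P\<close> cannot
  leave the circle. A track therefore lies on a circle or consists of edges on no circle.\<close>

lemma linked_circle_contains:
  assumes \<D>: "linked \<D>" and P: "P \<in> \<D>" and C: "circle H C" and meet: "e \<in> tedges P" "e \<in> tedges C"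
  shows "tedges P \<subseteq> tedges C"
proof (rule track_edges_connected[OF linkedD(2)[OF \<D> P] meet])
  fix v e f
  assume *: "v \<in> internal P" "e \<in> tedges P" "f \<in> tedges P" "v \<in> ends H e" "v \<in> ends H f" "e \<in> tedges C"
  have v: "v \<in> L" "edges_at P v = N v"
    using linkedD(6,7)[OF \<D> P *(1)] by auto
  have "v \<in> tverts C"
    using track_ends_subset[OF circle_track[OF C] *(6)] *(4) by blast
  then have "edges_at C v = N v"
    using circle_at_L[OF C v(1)] by simp
  then show "f \<in> tedges C"
    using v *(3,5) by (auto simp: edges_at_def)
qed

text \<open>Both moves, merging two paths and dropping the terminus of a closed path, replace some
  tracks by one with the same edges.\<close>

lemma linked_replace:
  assumes \<D>: "linked \<D>" and \<P>: "\<P> \<subseteq> \<D>" and R: "track H R" "tedges R = (\<Union>P \<in> \<P>. tedges P)" "\<P> \<noteq> {}"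
    and int: "\<And>v. v \<in> internal R \<Longrightarrow> v \<in> L \<and> edges_at R v = N v"
  shows "linked (insert R (\<D> - \<P>))"
  unfolding linked_def
proof (intro conjI)
  show "finite (insert R (\<D> - \<P>))"
    using linkedD(1)[OF \<D>] by simp
  obtain P where "P \<in> \<P>" "P \<in> \<D>"
    using R(3) \<P> by blast
  then have "nontrivial R"
    using R(2) linkedD(3)[OF \<D>, of P] by (auto simp: nontrivial_def)
  then show "\<forall>P \<in> insert R (\<D> - \<P>). track H P \<and> nontrivial P"
    using R(1) linkedD(2,3)[OF \<D>] by auto
  show "(\<Union>P \<in> insert R (\<D> - \<P>). tedges P) = F"
    unfolding linkedD(4)[OF \<D>, symmetric] using R(2) \<P> by auto
  have "disjnt (tedges R) (tedges Q)" if "Q \<in> \<D> - \<P>" for Q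
    unfolding disjnt_def R(2) using linkedD(5)[OF \<D>] that \<P> by blast
  then show "pairwise (\<lambda>P Q. disjnt (tedges P) (tedges Q)) (insert R (\<D> - \<P>))"
    using \<D> unfolding linked_def pairwise_insert
    by (auto simp: disjnt_sym intro: pairwise_subset)
  show "\<forall>P \<in> insert R (\<D> - \<P>). \<forall>v \<in> internal P. v \<in> L \<and> edges_at P v = N v"
    using int linkedD(6,7)[OF \<D>] by auto
qed

text \<open>A common vertex internal to one of the paths would have an edge outside \<open>N u\<close> lying in a circle.\<close>

lemma linked_overlap:
  assumes \<D>: "linked \<D>" and PQ: "P \<in> \<D>" "Q \<in> \<D>" "P \<noteq> Q" "open_path H P" "open_path H Q"
    and v: "v \<in> termini P" "v \<in> termini Q" and u: "u \<in> tverts P" "u \<in> tverts Q"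
  shows "u \<in> termini P"
proof (rule ccontr)
  assume "u \<notin> termini P"
  then have uP: "u \<in> internal P"
    using u by (simp add: internal_def)
  have disj: "tedges P \<inter> tedges Q = {}"
    using linkedD(5)[OF \<D>] PQ by blast
  have uL: "u \<in> L" "edges_at P u = N u"
    using linkedD(6,7)[OF \<D> PQ(1) uP] by auto
  obtain f where f: "f \<in> tedges Q" "u \<in> ends H f"
    using track_edge_at[OF linkedD(2,3)[OF \<D> PQ(2)] u(2)] by blast
  have fN: "f \<notin> N u"
    using f disj uL(2) by (auto simp: edges_at_def)
  have "u \<notin> internal Q"
    using linkedD(7)[OF \<D> PQ(2)] f fN by (auto simp: edges_at_def)
  then have uQ: "u \<in> termini Q"
    using u by (simp add: internal_def)
  have uv: "u \<noteq> v"
    using \<open>u \<notin> termini P\<close> v by blast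
  \<comment> \<open>The segment of \<open>P\<close> and the whole of \<open>Q\<close> both join
    \<open>u\<close> and \<open>v\<close>. Their union is even and contains \<open>f\<close>, which
    therefore lies on a circle.\<close>
  obtain A where A: "A \<subseteq> tedges P" "\<And>x. odd (deg_in (ends H) A x) \<longleftrightarrow> x = u \<or> x = v"
    by (rule open_path_segment_parity[OF PQ(4) v(1) u(1) uv]) blast
  have fin: "finite A" "finite (tedges Q)"
    using A(1) linkedD(2)[OF \<D>] PQ finite_subset track_finite_edges by metis+
  have tQ: "termini Q = {u, v}"
    using open_path_termini[OF PQ(5) linkedD(3)[OF \<D> PQ(2)]] uQ v(2) uv
    by (auto simp: card_2_iff)
  have oddQ: "odd (deg_in (ends H) (tedges Q) x) \<longleftrightarrow> x = u \<or> x = v" for x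
  proof (cases "x \<in> termini Q")
    case True
    then show ?thesis
      using open_path_deg_in_terminus[OF PQ(5) linkedD(3)[OF \<D> PQ(2)] True] tQ by auto
  next
    case False
    then have "even (deg_in (ends H) (tedges Q) x)"
      using track_deg_in_internal[OF linkedD(2)[OF \<D> PQ(2)], of x]
        track_deg_in_outside[OF linkedD(2)[OF \<D> PQ(2)], of x] by (cases "x \<in> tverts Q") (auto simp: internal_def)
    then show ?thesis
      using tQ False by auto
  qed
  have "even (deg_in (ends H) (A \<union> tedges Q) x)" for x
  proof -
    have "A \<inter> tedges Q = {}"
      using A disj by blast
    then show ?thesis
      using deg_in_union[OF fin, of "ends H" x] A(2)[of x] oddQ[of x] by (metis odd_add)
  qed
  then have "even_set (ends H) (A \<union> tedges Q)"
    using fin by (simp add: even_set_def)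
  moreover have sub: "A \<union> tedges Q \<subseteq> edges H"
    using A track_edges_subset[OF linkedD(2)[OF \<D> PQ(1)]] track_edges_subset[OF linkedD(2)[OF \<D> PQ(2)]] by blast
  ultimately obtain C where "circle H C" "f \<in> tedges C"
    using even_set_contains_circle[OF graph _ _, of "A \<union> tedges Q" f] f by blast
  then show False
    using not_N[OF uL(1) _ f(2) fN] f(1) sub by blast
qed

text \<open>Dropping the terminus of a closed path keeps the number of tracks; the second summand
  makes this move a decrease too.\<close>

definition weight :: "('v, 'e) track set \<Rightarrow> nat" where
  "weight \<D> = card \<D> + card {P \<in> \<D>. termini P \<noteq> {}}"

lemma weight_replace:
  assumes "finite \<D>" "\<P> \<subseteq> \<D>" "\<And>P. P \<in> \<P> \<Longrightarrow> termini P \<noteq> {}"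
    "termini R = {} \<and> \<P> \<noteq> {} \<or> card \<P> = 2"
  shows "weight (insert R (\<D> - \<P>)) < weight \<D>"
proof -
  have fin: "finite \<P>"
    using assms finite_subset by blast
  have "card (insert R (\<D> - \<P>)) \<le> Suc (card (\<D> - \<P>))"
    by (rule card_insert_le_m1) (use assms in \<open>auto simp: card_insert_if\<close>)
  moreover have "card (\<D> - \<P>) = card \<D> - card \<P>" "card \<P> \<le> card \<D>"
    using assms fin by (auto simp: card_Diff_subset intro: card_mono)
  moreover have "{P \<in> \<D>. termini P \<noteq> {}} = {P \<in> \<D> - \<P>. termini P \<noteq> {}} \<union> \<P>"
    using assms by auto
  then have "card {P \<in> \<D>. termini P \<noteq> {}} = card {P \<in> \<D> - \<P>. termini P \<noteq> {}} + card \<P>"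
    using assms fin by (subst card_Un_disjoint[symmetric]) auto
  moreover have "{P \<in> insert R (\<D> - \<P>). termini P \<noteq> {}} \<subseteq>
      {P \<in> \<D> - \<P>. termini P \<noteq> {}} \<union> (if termini R = {} then {} else {R})"
    by auto
  then have "card {P \<in> insert R (\<D> - \<P>). termini P \<noteq> {}} \<le>
      card ({P \<in> \<D> - \<P>. termini P \<noteq> {}} \<union> (if termini R = {} then {} else {R}))"
    using assms by (intro card_mono) auto
  then have "card {P \<in> insert R (\<D> - \<P>). termini P \<noteq> {}} \<le>
      card {P \<in> \<D> - \<P>. termini P \<noteq> {}} + (if termini R = {} then 0 else 1)"
    using card_Un_le[of "{P \<in> \<D> - \<P>. termini P \<noteq> {}}" "if termini R = {} then {} else {R}"]
    by (auto split: if_splits)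
  moreover have "0 < card \<P>"
    using assms fin by (auto simp: card_gt_0_iff)
  ultimately show ?thesis
    using assms(4) unfolding weight_def by (auto split: if_splits)
qed

text \<open>Read as a circle, the track passes through \<open>v\<close> and so uses exactly
  \<open>N v\<close> there: the link is already in place and only the terminus has to be
  dropped.\<close>

lemma closed_path_to_circle:
  assumes \<D>: "linked \<D>" and P: "P \<in> \<D>" "closed_path H P" and v: "v \<in> L" "v \<in> termini P"
  shows "\<exists>\<D>'. linked \<D>' \<and> weight \<D>' < weight \<D>"
proof -
  define R where "R = P\<lparr>termini := {}\<rparr>"
  have R: "circle H R"
    using P by (auto simp: circle_def R_def)
  have t: "termini P = {v}"
    using closed_path_termini[OF P(2)] v by auto
  have vR: "v \<in> tverts R"
    using track_termini_subset[OF linkedD(2)[OF \<D> P(1)]] v(2) by (auto simp: R_def)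
  have "x \<in> L \<and> edges_at R x = N x" if x: "x \<in> internal R" for x
  proof (cases "x = v")
    case True
    then show ?thesis
      using circle_at_L[OF R v(1) vR] v by simp
  next
    case False
    then have "x \<in> internal P"
      using x t by (auto simp: internal_def R_def)
    then show ?thesis
      using linkedD(6,7)[OF \<D> P(1)] by (auto simp: edges_at_def R_def)
  qed
  then have "linked (insert R (\<D> - {P}))"
    using P R by (intro linked_replace[OF \<D>]) (auto simp: R_def circle_track)
  moreover have "weight (insert R (\<D> - {P})) < weight \<D>"
    using linkedD(1)[OF \<D>] P v by (intro weight_replace) (auto simp: R_def)
  ultimately show ?thesis
    by blast
qed

text \<open>Tracks containing edges of \<open>N v\<close> end at \<open>v\<close>. A closed one
  becomes a circle; otherwise each is an open path of degree 1 at \<open>v\<close>, so two different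
  paths end there and can be joined.\<close>

lemma linked_progress:
  assumes \<D>: "linked \<D>" and v: "v \<in> L" and free: "\<And>P. P \<in> \<D> \<Longrightarrow> v \<notin> internal P"
  shows "\<exists>\<D>'. linked \<D>' \<and> weight \<D>' < weight \<D>"
proof (rule ccontr)
  assume stuck: "\<not> ?thesis"
  have end_at: "v \<in> termini P \<and> open_path H P" if P: "P \<in> \<D>" and n: "n \<in> tedges P" "n \<in> N v" for P n
  proof -
    have "v \<in> tverts P"
      using n N_subset[OF v] track_ends_subset[OF linkedD(2)[OF \<D> P] n(1)] by blast
    then have t: "v \<in> termini P"
      using free[OF P] by (simp add: internal_def)
    then have "\<not> circle H P"
      by (auto simp: circle_iff)
    moreover have "\<not> closed_path H P"
      using closed_path_to_circle[OF \<D> P _ v t] stuck by blast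
    ultimately show ?thesis
      using t linkedD(2)[OF \<D> P] by (auto simp: track_def path_def)
  qed
  have Nv: "finite (N v)" "\<And>e. e \<in> N v \<Longrightarrow> e \<in> F \<and> v \<in> ends H e"
    using finite_N[OF v] N_subset[OF v] by auto
  have "N v \<noteq> {}"
    using N_degree[OF v] by (auto simp: deg_in_def)
  then obtain n where n: "n \<in> N v"
    by blast
  then obtain P where P: "P \<in> \<D>" "n \<in> tedges P"
    using Nv linkedD(4)[OF \<D>] by blast
  have P': "v \<in> termini P" "open_path H P" "nontrivial P" "track H P"
    using end_at[OF P n] linkedD(2,3)[OF \<D> P(1)] by auto
  have degP: "deg_in (ends H) (tedges P) v = 1"
    using open_path_deg_in_terminus[OF P'(2,3,1)] .
  \<comment> \<open>A loop would give an open path degree 2 at its terminus; hence \<open>n\<close>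
    is a link and \<open>N v\<close> has a second edge.\<close>
  have "inc (ends H) n v \<le> 1"
    using deg_in_ge_inc[OF track_finite_edges[OF P'(4)] P(2), of "ends H" v] degP by simp
  then have inc_n: "inc (ends H) n v = 1"
    using inc_pos_iff[of "ends H" n v] Nv(2)[OF n] by simp
  have "N v \<noteq> {n}"
    using N_degree[OF v] inc_n by (auto simp: deg_in_def)
  then obtain m where m: "m \<in> N v" "m \<noteq> n"
    using n by blast
  then obtain Q where Q: "Q \<in> \<D>" "m \<in> tedges Q"
    using Nv linkedD(4)[OF \<D>] by blast
  have Q': "v \<in> termini Q" "open_path H Q" "nontrivial Q" "track H Q"
    using end_at[OF Q m(1)] linkedD(2,3)[OF \<D> Q(1)] by auto
  have degQ: "deg_in (ends H) (tedges Q) v = 1"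
    using open_path_deg_in_terminus[OF Q'(2,3,1)] .
  have two: "2 \<le> deg_in (ends H) {n, m} v"
    using m n Nv(2) inc_pos_iff[of "ends H" n v] inc_pos_iff[of "ends H" m v]
    by (simp add: deg_in_def)
  have PQ: "P \<noteq> Q"
  proof
    assume "P = Q"
    then have "deg_in (ends H) {n, m} v \<le> deg_in (ends H) (tedges P) v"
      using P Q by (intro deg_in_mono track_finite_edges[OF P'(4)]) auto
    then show False
      using two degP by simp
  qed
  define R where "R = \<lparr>tverts = tverts P \<union> tverts Q, tedges = tedges P \<union> tedges Q,
     termini = (termini P \<union> termini Q) - {v}\<rparr>"
  have overlap: "tverts P \<inter> tverts Q \<subseteq> termini P \<inter> termini Q"
    using linked_overlap[OF \<D> P(1) Q(1) PQ P'(2) Q'(2) P'(1) Q'(1)]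
      linked_overlap[OF \<D> Q(1) P(1) PQ[symmetric] Q'(2) P'(2) Q'(1) P'(1)] by blast
  have disj: "tedges P \<inter> tedges Q = {}"
    using linkedD(5)[OF \<D> P(1) Q(1)] PQ by blast
  have R: "track H R"
    using path_join[OF P'(2,3) Q'(2,3) P'(1) Q'(1) overlap disj] by (simp add: R_def track_def)
  have "x \<in> L \<and> edges_at R x = N x" if x: "x \<in> internal R" for x
  proof -
    have "x = v \<or> x \<in> internal P \<or> x \<in> internal Q"
      using x by (auto simp: internal_def R_def)
    then consider "x = v" | "x \<in> internal P" "x \<notin> tverts Q" | "x \<in> internal Q" "x \<notin> tverts P"
      using overlap by (auto simp: internal_def)
    then show ?thesis
    proof cases
      case 1
      \<comment> \<open>At \<open>v\<close> both \<open>N v\<close> and the edges of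
        \<open>R\<close> contain \<open>n\<close> and \<open>m\<close> and have degree 2, so each of
        them is just this pair.\<close>
      have NR: "{n, m} \<subseteq> N v" "{n, m} \<subseteq> edges_at R v"
        using n m P Q Nv(2) by (auto simp: R_def edges_at_def)
      have "deg_in (ends H) (tedges R) v = 2"
        using deg_in_union[OF track_finite_edges[OF P'(4)] track_finite_edges[OF Q'(4)] disj, of "ends H" v] degP degQ
        by (simp add: R_def)
      then have d1: "deg_in (ends H) (edges_at R v) v \<le> deg_in (ends H) {n, m} v"
        using deg_in_edges_at[OF R] two by simp
      have "e \<in> {n, m}" if "e \<in> edges_at R v" for e
        by (rule deg_in_eq_imp_contains[where E = "ends H" and v = v, OF _ finite_edges_at[OF R] NR(2) d1 that])
          (use that in \<open>auto simp: edges_at_def\<close>)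
      moreover have d2: "deg_in (ends H) (N v) v \<le> deg_in (ends H) {n, m} v"
        using N_degree[OF v] two by simp
      have "e \<in> {n, m}" if "e \<in> N v" for e
        by (rule deg_in_eq_imp_contains[where E = "ends H" and v = v, OF _ Nv(1) NR(1) d2 that])
          (use that Nv(2) in auto)
      ultimately show ?thesis
        using NR v 1 by blast
    next
      case 2
      then have "edges_at R x = edges_at P x"
        using track_ends_subset[OF Q'(4)] by (auto simp: edges_at_def R_def)
      then show ?thesis
        using linkedD(6,7)[OF \<D> P(1) 2(1)] by simp
    next
      case 3
      then have "edges_at R x = edges_at Q x"
        using track_ends_subset[OF P'(4)] by (auto simp: edges_at_def R_def)
      then show ?thesis
        using linkedD(6,7)[OF \<D> Q(1) 3(1)] by simp
    qed
  qed
  then have "linked (insert R (\<D> - {P, Q}))"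
    using P Q R by (intro linked_replace[OF \<D>]) (auto simp: R_def)
  moreover have "weight (insert R (\<D> - {P, Q})) < weight \<D>"
    using linkedD(1)[OF \<D>] P Q P' Q' PQ by (intro weight_replace) auto
  ultimately show False
    using stuck by blast
qed

text \<open>A family of least weight admits no further move.\<close>

lemma linked_exists:
  obtains \<D> where "linked \<D>" "\<And>v. v \<in> L \<Longrightarrow> \<exists>P \<in> \<D>. v \<in> internal P"
proof -
  obtain \<D> where \<D>: "linked \<D>" "\<And>\<D>'. linked \<D>' \<Longrightarrow> weight \<D> \<le> weight \<D>'"
    using ex_has_least_nat[where P = linked and m = weight, OF linked_single_edges] by blast
  have "\<exists>P \<in> \<D>. v \<in> internal P" if "v \<in> L" for v
    using linked_progress[OF \<D>(1) that] \<D>(2) by (meson not_le)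
  then show thesis
    using that \<D>(1) by blast
qed

end

section \<open>Property 2 and Construction A\<close>

abbreviation neg_edges :: "('v, 'e) graph \<Rightarrow> ('e \<Rightarrow> int) \<Rightarrow> 'e set" where
  "neg_edges G \<sigma> \<equiv> {e \<in> edges G. \<sigma> e = -1}"

lemma neg_degree_le_degree: "finite (edges G) \<Longrightarrow> neg_degree G \<sigma> v \<le> degree G v"
  by (simp add: neg_degree_eq_deg_in degree_eq_deg_in deg_in_mono)

lemma neg_degree_pos_iff:
  "finite (edges G) \<Longrightarrow> 0 < neg_degree G \<sigma> v \<longleftrightarrow> (\<exists>e \<in> neg_edges G \<sigma>. v \<in> ends G e)"
  by (simp add: neg_degree_eq_deg_in deg_in_pos_iff)

lemma property2_neg_degree_le:
  assumes "property2 G \<sigma>" "is_graph G" "v \<in> verts G"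
  shows "neg_degree G \<sigma> v \<le> 2"
proof -
  have *: "degree G v > 3 \<longrightarrow> neg_degree G \<sigma> v = 0" "degree G v = 3 \<longrightarrow> neg_degree G \<sigma> v \<in> {0, 2}"
    using assms by (auto simp: property2_def)
  consider "degree G v > 3" | "degree G v = 3" | "degree G v \<le> 2"
    by linarith
  then show ?thesis
    using * neg_degree_le_degree[OF graph_finite(1)[OF assms(2)], of \<sigma> v] by cases auto
qed

text \<open>A circle through \<open>v\<close> contains all negative edges there, and these already
  account for its degree 2 at \<open>v\<close>.\<close>

lemma property2_positive_not_in_circle:
  assumes p2: "property2 G \<sigma>" and G: "is_graph G" and v: "v \<in> verts G" "neg_degree G \<sigma> v = 2"
    and e: "v \<in> ends G e" "\<sigma> e \<noteq> -1" and C: "circle G C"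
  shows "e \<notin> tedges C"
proof
  assume eC: "e \<in> tedges C"
  then have vC: "v \<in> tverts C"
    using track_ends_subset[OF circle_track[OF C]] e by blast
  have fin: "finite (edges G)"
    using G by (rule graph_finite)
  let ?N = "{e \<in> neg_edges G \<sigma>. v \<in> ends G e}"
  have sub: "?N \<subseteq> tedges C"
    using p2 v C vC unfolding property2_def by fastforce
  have "deg_in (ends G) ?N v = 2"
    using v(2) fin by (subst deg_in_at) (simp_all add: neg_degree_eq_deg_in)
  moreover have "deg_in (ends G) (insert e ?N) v = inc (ends G) e v + deg_in (ends G) ?N v"
    using fin e by (intro deg_in_insert) auto
  moreover have "deg_in (ends G) (insert e ?N) v \<le> deg_in (ends G) (tedges C) v"
    using eC sub by (intro deg_in_mono track_finite_edges[OF circle_track[OF C]]) auto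
  moreover have "0 < inc (ends G) e v"
    using e by (simp add: inc_pos_iff)
  ultimately show False
    using circle_deg_in[OF C, of v] vC by simp
qed

lemma connected_block_union_is_graph:
  assumes G: "is_graph G" and M: "connected_block_union G M"
  shows "is_graph M"
proof -
  obtain \<B> where \<B>: "\<And>B. B \<in> \<B> \<Longrightarrow> nontrivial_block G B"
    "M = \<lparr>verts = (\<Union>B \<in> \<B>. verts B), edges = (\<Union>B \<in> \<B>. edges B), ends = ends G\<rparr>"
    using M unfolding connected_block_union_def by blast
  have BG: "verts B \<subseteq> verts G" "edges B \<subseteq> edges G" "ends B = ends G" "is_graph B" if "B \<in> \<B>" for B
    using nontrivial_block_subgraph[OF \<B>(1)[OF that]] by (auto simp: subgraph_def)
  have "verts M \<subseteq> verts G" "edges M \<subseteq> edges G"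
    using BG unfolding \<B>(2) by auto
  then have fin: "finite (verts M)" "finite (edges M)"
    using graph_finite[OF G] finite_subset by auto
  show ?thesis
    unfolding is_graph_def
  proof (intro conjI ballI fin)
    fix e assume "e \<in> edges M"
    then obtain B where B: "B \<in> \<B>" "e \<in> edges B"
      unfolding \<B>(2) by auto
    have "ends G e \<subseteq> verts B" "card (ends G e) \<in> {1, 2}"
      using BG(3,4)[OF B(1)] B(2) by (auto simp: is_graph_def)
    then show "ends M e \<subseteq> verts M" "card (ends M e) \<in> {1, 2}"
      using B(1) unfolding \<B>(2) by auto
  qed
qed

text \<open>Every edge of a nontrivial block is on a circle, and no such edge attaches to
  \<open>P\<close> from outside. So a connected union of blocks around \<open>P\<close> cannot
  extend beyond it; this is applied to one block first and then to arbitrary unions.\<close>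

lemma isolated_circle_megablock:
  fixes G :: "('v, 'e) graph"
  assumes G: "is_graph G" and P: "circle G P"
    and touch: "\<And>v e C. v \<in> tverts P \<Longrightarrow> v \<in> ends G e \<Longrightarrow> circle G C \<Longrightarrow> e \<in> tedges C \<Longrightarrow> e \<in> tedges P"
  shows "megablock G (track_graph G P)"
proof -
  let ?M = "track_graph G P"
  have ne: "verts ?M \<noteq> {}"
    using track_verts_nonempty[OF circle_track[OF P]] by simp
  obtain B where B: "nontrivial_block G B" "subgraph ?M B"
    using circle_in_nontrivial_block[OF G P] .
  have "B = ?M"
  proof (rule connected_graph_eqI[OF B(2) _ nontrivial_block_connected[OF B(1)] ne])
    show "is_graph B"
      using nontrivial_block_subgraph[OF B(1)] by (simp add: subgraph_def)
    fix e assume e: "e \<in> edges B" "ends B e \<inter> verts ?M \<noteq> {}"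
    obtain C where C: "circle G C" "e \<in> tedges C"
      using nontrivial_block_edge_in_circle[OF B(1) e(1)] .
    have "ends B = ends G"
      using B(2) by (auto simp: subgraph_def)
    then show "e \<in> edges ?M"
      using touch[OF _ _ C] e(2) by auto
  qed
  then have M: "nontrivial_block G ?M"
    using B by simp
  have "connected_block_union G ?M"
    unfolding connected_block_union_def
    using M nontrivial_block_connected[OF M] by (intro exI[of _ "{?M}"]) (auto simp: track_graph_def)
  moreover have "M' = ?M" if M': "connected_block_union G M'" "subgraph ?M M'" for M'
  proof -
    obtain \<B> where \<B>: "\<And>B. B \<in> \<B> \<Longrightarrow> nontrivial_block G B"
      "M' = \<lparr>verts = (\<Union>B \<in> \<B>. verts B), edges = (\<Union>B \<in> \<B>. edges B), ends = ends G\<rparr>"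
      "connected_graph M'"
      using M' unfolding connected_block_union_def by blast
    have "is_graph M'"
      using connected_block_union_is_graph[OF G M'(1)] .
    then show ?thesis
    proof (rule connected_graph_eqI[OF M'(2) _ \<B>(3) ne])
      fix e assume e: "e \<in> edges M'" "ends M' e \<inter> verts ?M \<noteq> {}"
      then obtain B where B: "B \<in> \<B>" "e \<in> edges B"
        unfolding \<B>(2) by auto
      obtain C where C: "circle G C" "e \<in> tedges C"
        using nontrivial_block_edge_in_circle[OF \<B>(1)[OF B(1)] B(2)] .
      show "e \<in> edges ?M"
        using touch[OF _ _ C] e(2) unfolding \<B>(2) by auto
    qed
  qed
  ultimately show ?thesis
    unfolding megablock_def by blast
qed

lemma property2_imp_constructionA:
  assumes G: "is_graph G" and \<sigma>: "signing G \<sigma>" and p2: "property2 G \<sigma>"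
  shows "constructionA G \<sigma>"
proof -
  define N where "N v = {e \<in> neg_edges G \<sigma>. v \<in> ends G e}" for v
  define L where "L = {v \<in> verts G. neg_degree G \<sigma> v = 2}"
  have fin: "finite (edges G)"
    using G by (rule graph_finite)
  interpret linkage G "neg_edges G \<sigma>" L N
  proof
    show "deg_in (ends G) (N v) v = 2" if "v \<in> L" for v
      using that fin unfolding N_def L_def by (subst deg_in_at) (simp_all add: neg_degree_eq_deg_in)
    show "e \<notin> tedges C" if "v \<in> L" "e \<in> edges G" "v \<in> ends G e" "e \<notin> N v" "circle G C" for v e C
      using property2_positive_not_in_circle[OF p2 G _ _ that(3) _ that(5)] that by (auto simp: L_def N_def)
  qed (use G in \<open>auto simp: N_def\<close>)
  obtain \<D> where \<D>: "linked \<D>" "\<And>v. v \<in> L \<Longrightarrow> \<exists>P \<in> \<D>. v \<in> internal P"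
    using linked_exists by blast
  note D = linkedD[OF \<D>(1)]
  have neg: "\<exists>e\<in>tedges P. v \<in> ends G e \<and> e \<in> N v" "v \<in> verts G" "0 < neg_degree G \<sigma> v" "degree G v \<le> 3"
    if P: "P \<in> \<D>" and v: "v \<in> tverts P" for P v
  proof -
    obtain e where e: "e \<in> tedges P" "v \<in> ends G e"
      using track_edge_at[OF D(2,3)[OF P] v] by blast
    then have neg: "e \<in> neg_edges G \<sigma>"
      using D(4) P by blast
    show "\<exists>e\<in>tedges P. v \<in> ends G e \<and> e \<in> N v"
      using e neg by (auto simp: N_def)
    show vG: "v \<in> verts G"
      using track_verts_subset[OF D(2)[OF P]] v by blast
    show pos: "0 < neg_degree G \<sigma> v"
      using neg_degree_pos_iff[OF fin] e neg by blast
    show "degree G v \<le> 3"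
      using p2 vG pos by (metis property2_def not_le not_less0)
  qed
  \<comment> \<open>An edge of \<open>N v\<close> in \<open>P\<close> also belongs to the track in
    which \<open>v\<close> is internal, and tracks do not share edges.\<close>
  have L_unique: "v \<in> internal P" if P: "P \<in> \<D>" and v: "v \<in> tverts P" "v \<in> L" for P v
  proof -
    obtain Q where Q: "Q \<in> \<D>" "v \<in> internal Q"
      using \<D>(2) v by blast
    obtain e where e: "e \<in> tedges P" "e \<in> N v"
      using neg(1)[OF P v(1)] by blast
    then have "e \<in> tedges Q"
      using D(7)[OF Q] by (auto simp: edges_at_def)
    then show ?thesis
      using D(5)[OF P Q(1) e(1)] Q by simp
  qed
  \<comment> \<open>A terminus lies outside \<open>L\<close>, so its negative degree is neither 0
    nor 2, which Property 2 permits only for degree at most 2.\<close>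
  have terminus: "degree G v \<le> 2" if P: "P \<in> \<D>" and v: "v \<in> termini P" for P v
  proof -
    have vP: "v \<in> tverts P"
      using track_termini_subset[OF D(2)[OF P]] v by blast
    have "v \<notin> L"
      using L_unique[OF P vP] v by (auto simp: internal_def)
    then have "neg_degree G \<sigma> v \<noteq> 2" "neg_degree G \<sigma> v \<noteq> 0" "v \<in> verts G"
      using neg(2,3)[OF P vP] by (auto simp: L_def)
    moreover have "degree G v = 3 \<longrightarrow> neg_degree G \<sigma> v \<in> {0, 2}"
      using p2 \<open>v \<in> verts G\<close> by (simp add: property2_def)
    ultimately have "degree G v \<noteq> 3"
      by auto
    then show ?thesis
      using neg(4)[OF P vP] by simp
  qed
  have "admissibleA G P" if P: "P \<in> \<D>" for P
  proof -
    have PT: "track G P"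
      using D(2)[OF P] .
    \<comment> \<open>The three cases give the three kinds of track in Construction A; a path with
      no edge on a circle consists of isthmi.\<close>
    consider C where "path G P" "circle G C" "tedges P \<subseteq> tedges C" | "path G P" "\<And>e. e \<in> tedges P \<Longrightarrow> isthmus G e"
      | "circle G P"
    proof (cases "circle G P")
      case False
      then have pP: "path G P"
        using PT by (simp add: track_def)
      show thesis
      proof (cases "\<exists>C e. circle G C \<and> e \<in> tedges C \<and> e \<in> tedges P")
        case True
        then obtain C e where "circle G C" "e \<in> tedges C" "e \<in> tedges P"
          by blast
        then show thesis
          using that(1)[OF pP] linked_circle_contains[OF \<D>(1) P] by blast
      next
        case False
        then show thesis
          using that(2)[OF pP] not_in_circle_imp_isthmus[OF G] track_edges_subset[OF PT] by blast
      qed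
    qed (use that in blast)
    then show ?thesis
    proof cases
      case 1
      obtain B where B: "nontrivial_block G B" "subgraph (track_graph G C) B"
        using circle_in_nontrivial_block[OF G 1(2)] .
      have BG: "edges B \<subseteq> edges G" "ends B = ends G" "finite (edges B)" "is_graph B"
        using nontrivial_block_subgraph[OF B(1)] by (auto simp: subgraph_def graph_finite)
      have PB: "tedges P \<subseteq> edges B"
        using B(2) 1(3) by (auto simp: subgraph_def)
      have VB: "tverts P \<subseteq> verts B"
      proof
        fix v assume "v \<in> tverts P"
        then obtain e where "e \<in> tedges P" "v \<in> ends G e"
          using track_edge_at[OF PT D(3)[OF P]] by blast
        then show "v \<in> verts B"
          using PB BG by (auto simp: is_graph_def)
      qed
      have "path B P"
        using 1(1) VB PB BG(2) by (rule path_restrict)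
      \<comment> \<open>All edges of the block lie on circles, whereas an edge at \<open>v\<close>
        outside \<open>N v\<close> does not, so the block has only \<open>N v\<close> there.\<close>
      moreover have "degree B v = 2" if v: "v \<in> internal P" for v
      proof -
        have vL: "v \<in> L" "edges_at P v = N v"
          using D(6,7)[OF P v] by auto
        have "{e \<in> edges B. v \<in> ends G e} = N v"
        proof
          show "{e \<in> edges B. v \<in> ends G e} \<subseteq> N v"
          proof
            fix e assume e: "e \<in> {e \<in> edges B. v \<in> ends G e}"
            then obtain C' where "circle G C'" "e \<in> tedges C'"
              using nontrivial_block_edge_in_circle[OF B(1), of e] by blast
            then show "e \<in> N v"
              using not_N[OF vL(1), of e C'] e BG by blast
          qed
          show "N v \<subseteq> {e \<in> edges B. v \<in> ends G e}"
            using PB unfolding vL(2)[symmetric] by (auto simp: edges_at_def)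
        qed
        then show ?thesis
          using deg_in_at[OF BG(3), where E = "ends G" and v = v] N_degree[OF vL(1)] BG by (simp add: degree_eq_deg_in)
      qed
      ultimately have "divalent_path B P"
        using D(3)[OF P] by (simp add: divalent_path_def)
      \<comment> \<open>The terminus lies on the circle \<open>C\<close>, which supplies the lower
        bound.\<close>
      moreover have "degree G v = 2" if v: "v \<in> termini P" for v
      proof -
        have "v \<in> tverts P"
          using track_termini_subset[OF PT] v by blast
        then obtain e where "e \<in> tedges P" "v \<in> ends G e"
          using track_edge_at[OF PT D(3)[OF P]] by blast
        then have "v \<in> tverts C"
          using track_ends_subset[OF circle_track[OF 1(2)]] 1(3) by blast
        then have "2 \<le> degree G v"
          using deg_in_mono[OF fin track_edges_subset[OF circle_track[OF 1(2)]], of "ends G" v] circle_deg_in[OF 1(2), of v] fin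
          by (simp add: degree_eq_deg_in)
        then show ?thesis
          using terminus[OF P v] by simp
      qed
      ultimately show ?thesis
        using neg(4)[OF P] B(1) unfolding admissibleA_def by blast
    next
      case 2
      then show ?thesis
        using neg(4)[OF P] terminus[OF P] unfolding admissibleA_def by blast
    next
      case 3
      have "megablock G (track_graph G P)"
      proof (rule isolated_circle_megablock[OF G 3])
        fix v e C assume v: "v \<in> tverts P" "v \<in> ends G e" and C: "circle G C" "e \<in> tedges C"
        have v': "v \<in> internal P"
          using v(1) circle_internal[OF 3] by simp
        then have "v \<in> L" "edges_at P v = N v"
          using D(6,7)[OF P] by auto
        moreover have "e \<in> edges G"
          using track_edges_subset[OF circle_track[OF C(1)]] C(2) by blast
        ultimately show "e \<in> tedges P"
          using not_N[of v e C] v C by (auto simp: edges_at_def)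
      qed
      then show ?thesis
        using neg(4)[OF P] 3 unfolding admissibleA_def by blast
    qed
  qed
  moreover have "pairwise (\<lambda>P Q. disjnt (tverts P) (tverts Q)) \<D>"
    unfolding pairwise_def disjnt_def
  proof (intro ballI impI)
    fix P Q assume PQ: "P \<in> \<D>" "Q \<in> \<D>" "P \<noteq> Q"
    \<comment> \<open>Two tracks meeting at \<open>v\<close> bring two negative edges, so
      \<open>v\<close> is in \<open>L\<close> and internal to both, which makes them share their
      edges at \<open>v\<close>.\<close>
    have False if v: "v \<in> tverts P" "v \<in> tverts Q" for v
    proof -
      obtain e f where ef: "e \<in> tedges P" "e \<in> N v" "f \<in> tedges Q" "f \<in> N v"
        using neg(1)[OF PQ(1) v(1)] neg(1)[OF PQ(2) v(2)] by blast
      then have "e \<noteq> f"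
        using D(5)[OF PQ(1,2)] PQ(3) by blast
      have "finite (N v)"
        using fin by (auto simp: N_def)
      then have "deg_in (ends G) {e, f} v \<le> deg_in (ends G) (N v) v"
        using ef by (intro deg_in_mono) auto
      moreover have "0 < inc (ends G) e v" "0 < inc (ends G) f v"
        using ef by (auto simp: inc_pos_iff N_def)
      ultimately have "2 \<le> deg_in (ends G) (N v) v"
        using \<open>e \<noteq> f\<close> by (simp add: deg_in_def)
      also have "deg_in (ends G) (N v) v = neg_degree G \<sigma> v"
        using fin unfolding N_def by (subst deg_in_at) (simp_all add: neg_degree_eq_deg_in)
      finally have "v \<in> L"
        using property2_neg_degree_le[OF p2 G] neg(2)[OF PQ(1) v(1)] by (auto simp: L_def intro: antisym)
      then have i: "v \<in> internal P" "v \<in> internal Q"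
        using L_unique PQ v by auto
      then have "e \<in> tedges Q"
        using D(7)[OF PQ(2) i(2)] ef by (auto simp: edges_at_def)
      then show False
        using D(5)[OF PQ(1,2) ef(1)] PQ(3) by blast
    qed
    then show "tverts P \<inter> tverts Q = {}"
      by blast
  qed
  moreover have "\<forall>e \<in> edges G. \<sigma> e = (if e \<in> (\<Union>P \<in> \<D>. tedges P) then -1 else 1)"
    unfolding D(4) using \<sigma> by (auto simp: signing_def)
  ultimately show ?thesis
    unfolding constructionA_def using G by blast
qed

section \<open>From Construction A to Property 2\<close>

lemma admissibleA_track: "admissibleA G P \<Longrightarrow> track G P"
proof -
  have "path G P" if B: "nontrivial_block G B" "path B P" for B
  proof (rule path_restrict[OF B(2)])
    have "track B P"
      using B(2) by (simp add: track_def)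
    then show "tverts P \<subseteq> verts G" "tedges P \<subseteq> edges G" "ends G = ends B"
      using nontrivial_block_subgraph[OF B(1)] track_verts_subset track_edges_subset
      unfolding subgraph_def by fastforce+
  qed
  then show "admissibleA G P \<Longrightarrow> track G P"
    unfolding admissibleA_def track_def divalent_path_def by blast
qed

text \<open>Unlike for blocks, a common vertex suffices: adding a block that contains the circle
  keeps the union connected, and maximality applies.\<close>

lemma megablock_absorbs_circle:
  fixes G :: "('v, 'e) graph"
  assumes G: "is_graph G" and M: "megablock G M" and C: "circle G C" and v: "v \<in> verts M" "v \<in> tverts C"
  shows "tedges C \<subseteq> edges M"
proof -
  obtain B where B: "nontrivial_block G B" "subgraph (track_graph G C) B"
    using circle_in_nontrivial_block[OF G C] .
  obtain \<B> where \<B>: "\<B> \<noteq> {}" "\<And>B. B \<in> \<B> \<Longrightarrow> nontrivial_block G B"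
    "M = \<lparr>verts = (\<Union>B \<in> \<B>. verts B), edges = (\<Union>B \<in> \<B>. edges B), ends = ends G\<rparr>" "connected_graph M"
    using M unfolding megablock_def connected_block_union_def by blast
  have BG: "verts B \<subseteq> verts G" "edges B \<subseteq> edges G" "ends B = ends G" "is_graph B" if "nontrivial_block G B" for B
    using nontrivial_block_subgraph[OF that] by (auto simp: subgraph_def)
  define M' :: "('v, 'e) graph" where
    "M' = \<lparr>verts = (\<Union>B \<in> insert B \<B>. verts B), edges = (\<Union>B \<in> insert B \<B>. edges B), ends = ends G\<rparr>"
  have "connected_graph M'"
    using \<B>(4) nontrivial_block_connected[OF B(1)]
    by (rule connected_Un[where x = v]) (use v B BG[OF B(1)] \<B>(3) in \<open>auto simp: M'_def subgraph_def\<close>)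
  then have cb: "connected_block_union G M'"
    unfolding connected_block_union_def using B \<B>(2) M'_def by (intro exI[of _ "insert B \<B>"]) auto
  have "is_graph M"
    using M connected_block_union_is_graph[OF G] by (auto simp: megablock_def)
  then have "subgraph M M'"
    unfolding subgraph_def \<B>(3) M'_def by auto
  then have "M' = M"
    using M cb unfolding megablock_def by blast
  then have "edges B \<subseteq> edges M"
    by (auto simp: M'_def)
  then show ?thesis
    using B(2) by (auto simp: subgraph_def)
qed

text \<open>Since the chosen tracks have no common vertices, the negative edges at \<open>v\<close>
  are those of the one track \<open>P\<close> through it. If a circle through \<open>v\<close>
  missed one of two such edge ends, \<open>v\<close> would have degree 3 and the circle would use
  both an edge of \<open>P\<close> and an edge outside \<open>P\<close> there, which each of the
  three kinds of track excludes.\<close>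

lemma constructionA_imp_property2:
  assumes \<sigma>: "signing G \<sigma>" and A: "constructionA G \<sigma>"
  shows "property2 G \<sigma>"
  unfolding property2_def
proof (intro ballI)
  fix v assume v: "v \<in> verts G"
  obtain \<A> where G: "is_graph G" and adm: "\<And>P. P \<in> \<A> \<Longrightarrow> admissibleA G P"
    and disj: "pairwise (\<lambda>P Q. disjnt (tverts P) (tverts Q)) \<A>"
    and sign: "\<And>e. e \<in> edges G \<Longrightarrow> \<sigma> e = (if e \<in> (\<Union>P \<in> \<A>. tedges P) then -1 else 1)"
    using A unfolding constructionA_def by blast
  have fin: "finite (edges G)"
    using G by (rule graph_finite)
  show "(degree G v > 3 \<longrightarrow> neg_degree G \<sigma> v = 0) \<and> (degree G v = 3 \<longrightarrow> neg_degree G \<sigma> v \<in> {0, 2}) \<and>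
    (neg_degree G \<sigma> v = 2 \<longrightarrow>
      (\<forall>C. circle G C \<and> v \<in> tverts C \<longrightarrow> {e \<in> edges G. v \<in> ends G e \<and> \<sigma> e = -1} \<subseteq> tedges C))"
  proof (cases "neg_degree G \<sigma> v = 0")
    case False
    then obtain e where e: "e \<in> edges G" "\<sigma> e = -1" "v \<in> ends G e"
      using neg_degree_pos_iff[OF fin, of \<sigma> v] by auto
    then have "e \<in> (\<Union>P \<in> \<A>. tedges P)"
      using sign[OF e(1)] by (metis one_neq_neg_one)
    then obtain P where P: "P \<in> \<A>" "e \<in> tedges P"
      by blast
    note ad = adm[OF P(1)]
    have PT: "track G P"
      using admissibleA_track[OF ad] .
    have vP: "v \<in> tverts P"
      using track_ends_subset[OF PT P(2)] e by blast
    have at: "{e \<in> edges G. v \<in> ends G e \<and> \<sigma> e = -1} = {e \<in> tedges P. v \<in> ends G e}"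
    proof (intro equalityI subsetI)
      fix f assume f: "f \<in> {e \<in> edges G. v \<in> ends G e \<and> \<sigma> e = -1}"
      then have "f \<in> (\<Union>P \<in> \<A>. tedges P)"
        using sign[of f] by (metis (mono_tags, lifting) mem_Collect_eq one_neq_neg_one)
      then obtain Q where Q: "Q \<in> \<A>" "f \<in> tedges Q"
        by blast
      have "v \<in> tverts Q"
        using track_ends_subset[OF admissibleA_track[OF adm[OF Q(1)]] Q(2)] f by blast
      then have "P = Q"
        using disj vP P(1) Q(1) unfolding pairwise_def disjnt_def by blast
      then show "f \<in> {e \<in> tedges P. v \<in> ends G e}"
        using Q f by simp
    next
      fix f assume f: "f \<in> {e \<in> tedges P. v \<in> ends G e}"
      then have "f \<in> edges G"
        using track_edges_subset[OF PT] by blast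
      then show "f \<in> {e \<in> edges G. v \<in> ends G e \<and> \<sigma> e = -1}"
        using sign[of f] P(1) f by auto
    qed
    have "neg_degree G \<sigma> v = deg_in (ends G) {e \<in> neg_edges G \<sigma>. v \<in> ends G e} v"
      using fin by (subst deg_in_at) (simp_all add: neg_degree_eq_deg_in)
    also have "{e \<in> neg_edges G \<sigma>. v \<in> ends G e} = {e \<in> tedges P. v \<in> ends G e}"
      using at by blast
    finally have nd: "neg_degree G \<sigma> v = deg_in (ends G) (tedges P) v"
      using deg_in_at[OF track_finite_edges[OF PT], where E = "ends G" and v = v] by simp
    have d3: "degree G v \<le> 3" and dt: "v \<in> termini P \<Longrightarrow> degree G v \<le> 2"
      using ad vP unfolding admissibleA_def by (auto simp: circle_iff)
    have int: "v \<in> internal P" if "degree G v = 3"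
      using that dt vP by (auto simp: internal_def)
    have "{e \<in> tedges P. v \<in> ends G e} \<subseteq> tedges C" if nd2: "neg_degree G \<sigma> v = 2" and C: "circle G C" and vC: "v \<in> tverts C" for C
    proof (rule ccontr)
      assume no: "\<not> ?thesis"
      have finC: "finite (tedges C)" and CG: "tedges C \<subseteq> edges G"
        using circle_track[OF C] by (auto dest: track_finite_edges track_edges_subset)
      have finP: "finite (tedges P)" and PG: "tedges P \<subseteq> edges G"
        using PT by (auto dest: track_finite_edges track_edges_subset)
      have dC: "deg_in (ends G) (tedges C) v = 2"
        using circle_deg_in[OF C] vC by simp
      obtain g where g: "g \<in> tedges P" "v \<in> ends G g" "g \<notin> tedges C"
        using no by blast
      have "deg_in (ends G) (tedges C) v + inc (ends G) g v = deg_in (ends G) (insert g (tedges C)) v"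
        using g finC by (simp add: deg_in_insert)
      also have "\<dots> \<le> degree G v"
        using g CG PG unfolding degree_eq_deg_in[OF fin] by (intro deg_in_mono fin) auto
      finally have deg3: "degree G v = 3"
        using d3 dC g inc_pos_iff[of "ends G" g v] by simp
      have dP: "deg_in (ends G) (tedges P) v = 2"
        using nd nd2 by simp
      \<comment> \<open>If \<open>P\<close> and \<open>C\<close> had no common edge at
        \<open>v\<close>, their degrees there would add up to 4.\<close>
      obtain b where b: "b \<in> tedges P" "b \<in> tedges C" "v \<in> ends G b"
      proof (rule ccontr)
        assume none: "\<not> thesis"
        have "deg_in (ends G) (tedges P \<inter> tedges C) v = 0"
        proof (rule ccontr)
          assume "deg_in (ends G) (tedges P \<inter> tedges C) v \<noteq> 0"
          then show False
            using deg_in_pos_iff[of "tedges P \<inter> tedges C" "ends G" v] finP none that by auto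
        qed
        then have "deg_in (ends G) (tedges P - tedges C) v = 2"
          using deg_in_diff[OF finP, of "tedges P \<inter> tedges C" "ends G" v] dP by (simp add: Diff_Int)
        moreover have "deg_in (ends G) (tedges C \<union> (tedges P - tedges C)) v \<le> degree G v"
          using fin CG PG unfolding degree_eq_deg_in[OF fin] by (intro deg_in_mono) auto
        moreover have "deg_in (ends G) (tedges C \<union> (tedges P - tedges C)) v =
            deg_in (ends G) (tedges C) v + deg_in (ends G) (tedges P - tedges C) v"
          using finC finP by (intro deg_in_union) auto
        ultimately show False
          using dC deg3 by simp
      qed
      \<comment> \<open>If all edges of \<open>C\<close> at \<open>v\<close> were in
        \<open>P\<close>, they would by degree be all edges of \<open>P\<close> there,
        \<open>g\<close> included.\<close>
      obtain f where f: "f \<in> tedges C" "v \<in> ends G f" "f \<notin> tedges P"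
      proof (rule ccontr)
        assume none: "\<not> thesis"
        have sub: "{e \<in> tedges C. v \<in> ends G e} \<subseteq> tedges P"
          using none that by blast
        have "deg_in (ends G) {e \<in> tedges C. v \<in> ends G e} v = 2"
          using deg_in_at[OF finC, where E = "ends G" and v = v] dC by simp
        then have "g \<in> {e \<in> tedges C. v \<in> ends G e}"
          by (intro deg_in_eq_imp_contains[where E = "ends G" and v = v, OF _ finP sub _ g(1,2)]) (use finC dP in auto)
        then show False
          using g by blast
      qed
      have vI: "v \<in> internal P"
        using int[OF deg3] .
      \<comment> \<open>A block absorbs \<open>C\<close> and gets degree at least 3 at
        \<open>v\<close>; an isthmus cannot lie on \<open>C\<close>, as \<open>b\<close> does; a
        megablock absorbs \<open>C\<close> and with it \<open>f\<close>.\<close>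
      consider B where "nontrivial_block G B" "divalent_path B P" | "isthmus G b" | "megablock G (track_graph G P)"
        using ad b unfolding admissibleA_def by blast
      then show False
      proof cases
        case 1
        have BG: "edges B \<subseteq> edges G" "ends B = ends G" "finite (edges B)"
          using nontrivial_block_subgraph[OF 1(1)] by (auto simp: subgraph_def is_graph_def)
        have PB: "tedges P \<subseteq> edges B"
          using 1(2) track_edges_subset[of B P] by (simp add: divalent_path_def track_def)
        have "f \<in> edges B"
          using nontrivial_block_absorbs_circle[OF G 1(1) C, of b] PB b f by (auto simp: subgraph_def)
        have "degree B v = 2"
          using 1(2) vI by (auto simp: divalent_path_def)
        moreover have "deg_in (ends G) (insert f (tedges P)) v \<le> degree B v"
          using BG PB \<open>f \<in> edges B\<close> unfolding degree_eq_deg_in[OF BG(3)] BG(2) by (intro deg_in_mono) auto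
        ultimately show False
          using dP f finP inc_pos_iff[of "ends G" f v] by (simp add: deg_in_insert)
      next
        case 2
        then show False
          using isthmus_not_in_circle[OF G _ C] b by blast
      next
        case 3
        then show False
          using megablock_absorbs_circle[OF G 3 C _ vC] vP f by auto
      qed
    qed
    moreover have "neg_degree G \<sigma> v = 2" if "degree G v = 3"
      using nd track_deg_in_internal[OF PT int[OF that]] by simp
    ultimately show ?thesis
      using d3 at by auto
  next
    case True
    then show ?thesis
      by simp
  qed
qed

section \<open>Subdivisions\<close>

lemma closed_pathD: "path G P \<Longrightarrow> \<not> open_path G P \<Longrightarrow> closed_path G P"
  by (simp add: path_def)

locale subdivided =
  fixes G' :: "('v, 'e) graph" and S :: "'e \<Rightarrow> ('v, 'e) track" and G :: "('v, 'e) graph"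
  assumes subdivision: "subdivision G' S G"
begin

lemma graphs: "is_graph G'" "is_graph G"
  using subdivision by (auto simp: subdivision_def)

lemma fin: "finite (edges G')" "finite (edges G)"
  using graphs graph_finite by auto

lemma S_path:
  assumes "e \<in> edges G'"
  shows "path G (S e)" "track G (S e)" "nontrivial (S e)" "termini (S e) = ends G' e" "internal (S e) \<inter> verts G' = {}"
    "finite (tedges (S e))" "tedges (S e) \<subseteq> edges G"
proof -
  show *: "path G (S e)" "nontrivial (S e)" "termini (S e) = ends G' e" "internal (S e) \<inter> verts G' = {}"
    using subdivision assms by (auto simp: subdivision_def)
  show "track G (S e)"
    using * by (simp add: track_def)
  then show "finite (tedges (S e))" "tedges (S e) \<subseteq> edges G"
    by (auto dest: track_finite_edges track_edges_subset)
qed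

lemma S_disjoint:
  assumes "e \<in> edges G'" "f \<in> edges G'" "e \<noteq> f"
  shows "tedges (S e) \<inter> tedges (S f) = {}" "internal (S e) \<inter> internal (S f) = {}"
  using subdivision assms by (auto simp: subdivision_def)

lemma edges_G: "edges G = (\<Union>e \<in> edges G'. tedges (S e))"
  and verts_G: "verts G = verts G' \<union> (\<Union>e \<in> edges G'. internal (S e))"
  using subdivision by (auto simp: subdivision_def)

lemma ends_subset: "e \<in> edges G' \<Longrightarrow> ends G' e \<subseteq> verts G'"
  using graphs by (auto simp: is_graph_def)

text \<open>An open path gives 1 at each of its two termini; a closed path, which replaces a loop,
  gives 2. So incidences at old vertices are unchanged.\<close>

lemma S_deg_in:
  assumes e: "e \<in> edges G'" and v: "v \<in> verts G'"
  shows "deg_in (ends G) (tedges (S e)) v = inc (ends G') e v"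
proof (cases "v \<in> ends G' e")
  case True
  then have vt: "v \<in> termini (S e)"
    using S_path[OF e] by simp
  show ?thesis
  proof (cases "open_path G (S e)")
    case open_S: True
    then have "card (ends G' e) = 2"
      using open_path_termini[OF open_S S_path(3)[OF e]] S_path(4)[OF e] by simp
    then have "ends G' e \<noteq> {v}"
      by auto
    then show ?thesis
      using open_path_deg_in_terminus[OF open_S S_path(3)[OF e] vt] True by (simp add: inc_def)
  next
    case False
    then have cl: "closed_path G (S e)"
      using closed_pathD[OF S_path(1)[OF e]] by blast
    then have "ends G' e = {v}"
      using closed_path_termini[OF cl] S_path(4)[OF e] True by auto
    moreover have "v \<in> tverts (S e)"
      using track_termini_subset[OF S_path(2)[OF e]] vt by blast
    ultimately show ?thesis
      using closed_path_deg_in[OF cl, of v] by (simp add: inc_def)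
  qed
next
  case False
  then have "v \<notin> tverts (S e)"
    using S_path[OF e] v by (auto simp: internal_def)
  then show ?thesis
    using track_deg_in_outside[OF S_path(2)[OF e]] False by (simp add: inc_def)
qed

lemma deg_in_Union_S:
  assumes "A \<subseteq> edges G'"
  shows "deg_in (ends G) (\<Union>e\<in>A. tedges (S e)) v = (\<Sum>e\<in>A. deg_in (ends G) (tedges (S e)) v)"
proof (rule deg_in_UN)
  show "finite A"
    using assms fin finite_subset by blast
  show "finite (tedges (S i))" if "i \<in> A" for i
    using S_path(6) assms that by blast
  show "tedges (S i) \<inter> tedges (S j) = {}" if "i \<in> A" "j \<in> A" "i \<noteq> j" for i j
    using S_disjoint(1) assms that by blast
qed

lemma deg_in_lift:
  assumes "A \<subseteq> edges G'" "v \<in> verts G'"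
  shows "deg_in (ends G) (\<Union>e\<in>A. tedges (S e)) v = deg_in (ends G') A v"
  unfolding deg_in_Union_S[OF assms(1)] deg_in_def[of "ends G'"]
  using S_deg_in assms by (intro sum.cong) auto

lemma degree_eq: "v \<in> verts G' \<Longrightarrow> degree G v = degree G' v"
  using deg_in_lift[of "edges G'" v]
  by (simp add: degree_eq_deg_in[OF fin(1)] degree_eq_deg_in[OF fin(2)] flip: edges_G)

text \<open>As a terminus of another subdivided edge, \<open>v\<close> would be an old
  vertex.\<close>

lemma internal_S_unique:
  assumes "e \<in> edges G'" "v \<in> internal (S e)" "f \<in> edges G'" "v \<in> tverts (S f)"
  shows "e = f"
proof (rule ccontr)
  assume "e \<noteq> f"
  then have "v \<in> termini (S f)"
    using S_disjoint(2)[OF assms(1,3)] assms by (auto simp: internal_def)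
  then have "v \<in> verts G'"
    using S_path(4)[OF assms(3)] ends_subset[OF assms(3)] by blast
  then show False
    using S_path(5)[OF assms(1)] assms(2) by blast
qed

lemma deg_in_lift_internal:
  assumes "A \<subseteq> edges G'" "e \<in> edges G'" "v \<in> internal (S e)"
  shows "deg_in (ends G) (\<Union>e\<in>A. tedges (S e)) v = (if e \<in> A then 2 else 0)"
proof -
  have "deg_in (ends G) (tedges (S f)) v = (if f = e then 2 else 0)" if "f \<in> A" for f
  proof (cases "f = e")
    case True
    then show ?thesis
      using track_deg_in_internal[OF S_path(2)[OF assms(2)] assms(3)] by simp
  next
    case False
    then have "v \<notin> tverts (S f)"
      using internal_S_unique[OF assms(2,3), of f] that assms(1) by blast
    then show ?thesis
      using track_deg_in_outside[OF S_path(2)] that assms(1) False by auto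
  qed
  then have "(\<Sum>f\<in>A. deg_in (ends G) (tedges (S f)) v) = (\<Sum>f\<in>A. if f = e then 2 else 0)"
    by (intro sum.cong) auto
  also have "\<dots> = (if e \<in> A then 2 else 0)"
    using assms(1) fin finite_subset by (subst sum.delta) auto
  finally show ?thesis
    unfolding deg_in_Union_S[OF assms(1)] .
qed

lemma degree_internal: "e \<in> edges G' \<Longrightarrow> v \<in> internal (S e) \<Longrightarrow> degree G v = 2"
  using deg_in_lift_internal[of "edges G'" e v] by (simp add: degree_eq_deg_in[OF fin(2)] flip: edges_G)

lemma deg_in_zero: "A \<subseteq> edges H \<Longrightarrow> is_graph H \<Longrightarrow> v \<notin> verts H \<Longrightarrow> deg_in (ends H) A v = 0"
  unfolding deg_in_def by (rule sum.neutral) (auto simp: is_graph_def inc_def)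

section \<open>Even sets, isthmi and balance under subdivision\<close>

lemma even_set_lift:
  assumes A: "A \<subseteq> edges G'" and even: "even_set (ends G') A"
  shows "even_set (ends G) (\<Union>e\<in>A. tedges (S e))"
  unfolding even_set_def
proof (intro conjI allI)
  have AG: "(\<Union>e\<in>A. tedges (S e)) \<subseteq> edges G"
    using A edges_G by blast
  then show "finite (\<Union>e\<in>A. tedges (S e))"
    using fin finite_subset by blast
  fix v
  consider "v \<in> verts G'" | e where "e \<in> edges G'" "v \<in> internal (S e)" | "v \<notin> verts G"
    using verts_G by blast
  then show "even (deg_in (ends G) (\<Union>e\<in>A. tedges (S e)) v)"
  proof cases
    case 1
    then show ?thesis
      using deg_in_lift[OF A 1] even by (simp add: even_set_def)
  next
    case 2
    then show ?thesis
      using deg_in_lift_internal[OF A 2] by simp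
  next
    case 3
    then show ?thesis
      using deg_in_zero[OF AG graphs(2) 3] by simp
  qed
qed

text \<open>The vertices inside a subdivided edge have degree 2 in G, so by evenness one edge of
  \<open>S e\<close> in \<open>A\<close> brings all of \<open>S e\<close> with it.\<close>

lemma even_set_descend:
  assumes A: "A \<subseteq> edges G" and even: "even_set (ends G) A"
  obtains A' where "A' \<subseteq> edges G'" "even_set (ends G') A'" "A = (\<Union>e\<in>A'. tedges (S e))"
proof -
  define A' where "A' = {e \<in> edges G'. tedges (S e) \<inter> A \<noteq> {}}"
  have sub: "A' \<subseteq> edges G'"
    by (auto simp: A'_def)
  have finA: "finite A"
    using even by (simp add: even_set_def)
  have "tedges (S e) \<subseteq> A" if e: "e \<in> A'" for e
  proof -
    have eG: "e \<in> edges G'"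
      using e sub by blast
    obtain f where f: "f \<in> tedges (S e)" "f \<in> A"
      using e by (auto simp: A'_def)
    show ?thesis
    proof (rule track_edges_connected[OF S_path(2)[OF eG] f])
      fix v g h assume *: "v \<in> internal (S e)" "g \<in> tedges (S e)" "h \<in> tedges (S e)" "v \<in> ends G g"
        "v \<in> ends G h" "g \<in> A"
      have "0 < deg_in (ends G) A v" "even (deg_in (ends G) A v)"
        using deg_in_pos_iff[OF finA, of "ends G" v] * even by (auto simp: even_set_def)
      then have d: "deg_in (ends G) (edges G) v \<le> deg_in (ends G) A v"
        using degree_internal[OF eG *(1)] by (auto simp: degree_eq_deg_in fin elim!: evenE)
      have "h \<in> edges G"
        using *(3) S_path(7)[OF eG] by blast
      then show "h \<in> A"
        by (rule deg_in_eq_imp_contains[where E = "ends G" and v = v, OF finA fin(2) A d _ *(5)])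
    qed
  qed
  then have eq: "A = (\<Union>e\<in>A'. tedges (S e))"
    using A edges_G by (fastforce simp: A'_def)
  have "even (deg_in (ends G') A' v)" for v
  proof (cases "v \<in> verts G'")
    case True
    then show ?thesis
      using deg_in_lift[OF sub True] even eq by (metis even_set_def)
  next
    case False
    then show ?thesis
      using deg_in_zero[OF sub graphs(1) False] by simp
  qed
  then have "even_set (ends G') A'"
    using sub fin finite_subset by (auto simp: even_set_def)
  then show thesis
    using that sub eq by blast
qed

text \<open>The circle descends to an even set of \<open>G'\<close>, and the only edge it can get
  \<open>e\<close> from is the isthmus \<open>f\<close>.\<close>

lemma isthmus_lift:
  assumes "isthmus G' f" "e \<in> tedges (S f)" "circle G C"
  shows "e \<notin> tedges C"
proof
  assume e: "e \<in> tedges C"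
  obtain A' where A': "A' \<subseteq> edges G'" "even_set (ends G') A'" "tedges C = (\<Union>e\<in>A'. tedges (S e))"
    using even_set_descend[OF track_edges_subset[OF circle_track[OF assms(3)]] circle_even_set[OF assms(3)]] .
  then obtain g where g: "g \<in> A'" "e \<in> tedges (S g)"
    using e by blast
  have "f = g"
    using S_disjoint(1)[of f g] isthmus_edge[OF assms(1)] g A'(1) assms(2) by blast
  then show False
    using isthmus_not_in_even_set[OF graphs(1) assms(1) A'(2,1)] g by blast
qed

text \<open>Signs multiply along \<open>S e\<close>, so an even set of \<open>G'\<close> and its
  lift have the same sign. Even sets of the two graphs correspond, and balance is a condition on
  even sets.\<close>

lemma balanced_iff:
  assumes s: "\<And>e. e \<in> edges G' \<Longrightarrow> \<sigma>' e = track_sign \<sigma> (S e)"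
  shows "balanced G \<sigma> \<longleftrightarrow> balanced G' \<sigma>'"
proof -
  have prod: "(\<Prod>e\<in>(\<Union>e\<in>A. tedges (S e)). \<sigma> e) = (\<Prod>e\<in>A. \<sigma>' e)" if A: "A \<subseteq> edges G'" for A
  proof -
    have "(\<Prod>e\<in>(\<Union>e\<in>A. tedges (S e)). \<sigma> e) = (\<Prod>e\<in>A. \<Prod>f\<in>tedges (S e). \<sigma> f)"
    proof (rule prod.UNION_disjoint)
      show "finite A"
        using A fin finite_subset by blast
      show "\<forall>i\<in>A. finite (tedges (S i))"
        using S_path(6) A by blast
      show "\<forall>i\<in>A. \<forall>j\<in>A. i \<noteq> j \<longrightarrow> tedges (S i) \<inter> tedges (S j) = {}"
        using S_disjoint(1) A by blast
    qed
    also have "\<dots> = (\<Prod>e\<in>A. \<sigma>' e)"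
      using s A by (intro prod.cong) (auto simp: track_sign_def)
    finally show ?thesis .
  qed
  show ?thesis
    unfolding balanced_iff_even_sets[OF graphs(1)] balanced_iff_even_sets[OF graphs(2)]
  proof (intro iffI allI impI)
    fix A assume *: "\<forall>A \<subseteq> edges G. even_set (ends G) A \<longrightarrow> (\<Prod>e\<in>A. \<sigma> e) = 1" "A \<subseteq> edges G'" "even_set (ends G') A"
    have "(\<Union>e\<in>A. tedges (S e)) \<subseteq> edges G"
      using *(2) edges_G by blast
    then show "(\<Prod>e\<in>A. \<sigma>' e) = 1"
      using prod[OF *(2)] * even_set_lift[OF *(2,3)] by metis
  next
    fix A assume *: "\<forall>A \<subseteq> edges G'. even_set (ends G') A \<longrightarrow> (\<Prod>e\<in>A. \<sigma>' e) = 1" "A \<subseteq> edges G" "even_set (ends G) A"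
    obtain A' where A': "A' \<subseteq> edges G'" "even_set (ends G') A'" "A = (\<Union>e\<in>A'. tedges (S e))"
      using even_set_descend[OF *(2,3)] .
    then show "(\<Prod>e\<in>A. \<sigma> e) = 1"
      using prod[OF A'(1)] * by metis
  qed
qed

text \<open>The merged edge keeps the name \<open>e1\<close> and is subdivided by the two old paths
  joined at \<open>v\<close>, so G stays the same. If the two edges are parallel, then
  \<open>a = b\<close>, the merged edge is a loop and the joined path is closed.\<close>

lemma suppress_divalent:
  assumes v: "v \<in> verts G'" "degree G' v = 2" "\<And>e. e \<in> edges G' \<Longrightarrow> ends G' e \<noteq> {v}"
  obtains G'' S'' where "subdivision G'' S'' G" "card (edges G'') < card (edges G')"
proof -
  have inc1: "inc (ends G') e v = of_bool (v \<in> ends G' e)" if "e \<in> edges G'" for e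
    using v(3)[OF that] by (auto simp: inc_def)
  have "card {e \<in> edges G'. v \<in> ends G' e} = 2"
    using v(2) inc1 fin by (simp add: degree_eq_deg_in deg_in_def Int_def)
  then obtain e1 e2 where at: "{e \<in> edges G'. v \<in> ends G' e} = {e1, e2}" and ne: "e1 \<noteq> e2"
    by (auto simp: card_2_iff)
  have e: "e1 \<in> edges G'" "v \<in> ends G' e1" "e2 \<in> edges G'" "v \<in> ends G' e2"
    using at by blast+
  have link: "\<exists>a. ends G' e = {v, a} \<and> a \<noteq> v" if e: "e \<in> edges G'" "v \<in> ends G' e" for e
  proof -
    obtain a b where ab: "ends G' e = {a, b}"
      using graph_endsE[OF graphs(1) e(1)] .
    then show ?thesis
      using e v(3)[OF e(1)] by (auto simp: insert_commute)
  qed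
  obtain a b where a: "ends G' e1 = {v, a}" "a \<noteq> v" and b: "ends G' e2 = {v, b}" "b \<noteq> v"
    using link[OF e(1,2)] link[OF e(3,4)] by blast
  have abV: "a \<in> verts G'" "b \<in> verts G'"
    using a b ends_subset[OF e(1)] ends_subset[OF e(3)] by auto
  have t: "termini (S e1) = {v, a}" "termini (S e2) = {v, b}"
    using S_path(4)[OF e(1)] S_path(4)[OF e(3)] a b by simp_all
  have op: "open_path G (S e1)" "open_path G (S e2)"
    using closed_pathD[OF S_path(1)[OF e(1)]] closed_pathD[OF S_path(1)[OF e(3)]] t a(2) b(2)
      closed_path_termini[of G "S e1"] closed_path_termini[of G "S e2"] by fastforce+
  define R where "R = \<lparr>tverts = tverts (S e1) \<union> tverts (S e2), tedges = tedges (S e1) \<union> tedges (S e2),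
    termini = (termini (S e1) \<union> termini (S e2)) - {v}\<rparr>"
  have overlap: "tverts (S e1) \<inter> tverts (S e2) \<subseteq> termini (S e1) \<inter> termini (S e2)"
  proof
    fix x assume x: "x \<in> tverts (S e1) \<inter> tverts (S e2)"
    then have "x \<notin> internal (S e1)" "x \<notin> internal (S e2)"
      using internal_S_unique[OF e(1) _ e(3), of x] internal_S_unique[OF e(3) _ e(1), of x] ne by auto
    then show "x \<in> termini (S e1) \<inter> termini (S e2)"
      using x by (auto simp: internal_def)
  qed
  have R: "path G R"
    unfolding R_def
    by (rule path_join[OF op(1) S_path(3)[OF e(1)] op(2) S_path(3)[OF e(3)] _ _ overlap S_disjoint(1)[OF e(1,3) ne]])
      (use t in auto)
  have tR: "termini R = {a, b}"
    using t a b by (auto simp: R_def)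
  have tsub: "termini (S e1) \<subseteq> tverts (S e1)"
    using track_termini_subset[OF S_path(2)[OF e(1)]] .
  have iR: "internal R = insert v (internal (S e1) \<union> internal (S e2))"
  proof -
    have "v \<in> tverts (S e1)"
      using tsub t by blast
    moreover have "a \<notin> internal (S e2)" "b \<notin> internal (S e1)"
      using abV S_path(5)[OF e(1)] S_path(5)[OF e(3)] by auto
    moreover have "v \<notin> {a, b}"
      using a b by auto
    ultimately show ?thesis
      unfolding internal_def[of R] tR using t by (auto simp: R_def internal_def)
  qed
  define G'' :: "('v, 'e) graph" where
    "G'' = \<lparr>verts = verts G' - {v}, edges = edges G' - {e2}, ends = (ends G')(e1 := {a, b})\<rparr>"
  define S'' where "S'' = S(e1 := R)"
  have other: "v \<notin> ends G' f" if "f \<in> edges G'" "f \<noteq> e1" "f \<noteq> e2" for f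
    using at that by blast
  have vS: "v \<notin> internal (S f)" if "f \<in> edges G'" for f
    using S_path(5)[OF that] v(1) by blast
  have E'': "edges G'' = insert e1 (edges G' - {e1, e2})"
    using e ne by (auto simp: G''_def)
  have S''_other: "S'' f = S f" if "f \<in> edges G' - {e1, e2}" for f
    using that by (auto simp: S''_def)
  have S''_e1: "S'' e1 = R"
    by (simp add: S''_def)
  have "is_graph G''"
    unfolding is_graph_def
  proof (intro conjI ballI)
    fix f assume "f \<in> edges G''"
    then have f: "f \<in> edges G'" "f \<noteq> e2"
      by (auto simp: G''_def)
    show "ends G'' f \<subseteq> verts G''"
      using f a b abV ends_subset[OF f(1)] other[OF f(1)] by (auto simp: G''_def)
    show "card (ends G'' f) \<in> {1, 2}"
      using f graphs(1) by (auto simp: G''_def is_graph_def card_insert_if)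
  qed (use graph_finite[OF graphs(1)] in \<open>auto simp: G''_def\<close>)
  moreover have "path G (S'' f) \<and> nontrivial (S'' f) \<and> termini (S'' f) = ends G'' f \<and> internal (S'' f) \<inter> verts G'' = {}"
    if "f \<in> edges G''" for f
  proof (cases "f = e1")
    case True
    have "nontrivial R"
      using S_path(3)[OF e(1)] by (auto simp: R_def nontrivial_def)
    moreover have "internal R \<inter> verts G'' = {}"
      unfolding iR using S_path(5)[OF e(1)] S_path(5)[OF e(3)] by (auto simp: G''_def)
    ultimately show ?thesis
      using True R tR by (simp add: S''_def G''_def)
  next
    case False
    then have "f \<in> edges G'"
      using that by (simp add: G''_def)
    then show ?thesis
      using S_path[of f] False by (auto simp: S''_def G''_def)
  qed
  moreover have "tedges (S'' f) \<inter> tedges (S'' g) = {} \<and> internal (S'' f) \<inter> internal (S'' g) = {}"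
    if fg: "f \<in> edges G''" "g \<in> edges G''" "f \<noteq> g" for f g
  proof -
    have in_G': "f \<in> edges G'" "g \<in> edges G'" "f \<noteq> e2" "g \<noteq> e2"
      using fg by (auto simp: G''_def)
    have key: "tedges R \<inter> tedges (S h) = {} \<and> internal R \<inter> internal (S h) = {}"
      if h: "h \<in> edges G'" "h \<noteq> e1" "h \<noteq> e2" for h
      using S_disjoint[OF e(1) h(1)] S_disjoint[OF e(3) h(1)] h vS[OF h(1)] unfolding iR by (auto simp: R_def)
    show ?thesis
      using key[of f] key[of g] S_disjoint[of f g] in_G' fg(3) by (auto simp: S''_def)
  qed
  moreover have "edges G = (\<Union>f \<in> edges G''. tedges (S'' f))"
  proof -
    have "(\<Union>f \<in> edges G''. tedges (S'' f)) = tedges R \<union> (\<Union>f \<in> edges G' - {e1, e2}. tedges (S f))"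
      unfolding E'' using S''_other S''_e1 by simp
    also have "\<dots> = (\<Union>f \<in> edges G'. tedges (S f))"
      using e by (auto simp: R_def)
    finally show ?thesis
      using edges_G by simp
  qed
  moreover have "verts G = verts G'' \<union> (\<Union>f \<in> edges G''. internal (S'' f))"
  proof -
    have "(\<Union>f \<in> edges G''. internal (S'' f)) = internal R \<union> (\<Union>f \<in> edges G' - {e1, e2}. internal (S f))"
      unfolding E'' using S''_other S''_e1 by simp
    also have "\<dots> = insert v (\<Union>f \<in> edges G'. internal (S f))"
      using e by (auto simp: iR)
    finally show ?thesis
      using verts_G v(1) by (auto simp: G''_def)
  qed
  ultimately have "subdivision G'' S'' G"
    unfolding subdivision_def using graphs(2) by blast
  moreover have "card (edges G'') < card (edges G')"
    using card_Diff1_less[OF fin(1) e(3)] by (simp add: G''_def)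
  ultimately show thesis
    using that by blast
qed

end

lemma subdivision_refl:
  assumes G: "is_graph G"
  shows "subdivision G (edge_track (ends G)) G"
  unfolding subdivision_def using G edge_track_path[OF G]
  by (auto simp: edge_track_def nontrivial_def internal_def)

text \<open>Of all graphs that G is a subdivision of, one with the fewest edges admits no
  suppression.\<close>

lemma reduced_subdivision_exists:
  fixes G :: "('v, 'e) graph"
  assumes G: "is_graph G"
  obtains G' S where "subdivision G' S G" "reduced_graph G'"
proof -
  define Q where "Q p \<longleftrightarrow> subdivision (fst p) (snd p) G" for p :: "('v, 'e) graph \<times> ('e \<Rightarrow> ('v, 'e) track)"
  have "Q (G, edge_track (ends G))"
    using subdivision_refl[OF G] by (simp add: Q_def)
  then obtain p where p: "Q p" "\<And>q. Q q \<Longrightarrow> card (edges (fst p)) \<le> card (edges (fst q))"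
    using ex_has_least_nat[of Q _ "\<lambda>p. card (edges (fst p))"] by blast
  interpret subdivided "fst p" "snd p" G
    using p(1) by unfold_locales (simp add: Q_def)
  have "\<exists>e \<in> edges (fst p). ends (fst p) e = {v}" if v: "v \<in> verts (fst p)" "degree (fst p) v = 2" for v
  proof (rule ccontr)
    assume "\<not> ?thesis"
    then obtain G'' S'' where "subdivision G'' S'' G" "card (edges G'') < card (edges (fst p))"
      using suppress_divalent[OF v] by metis
    then show False
      using p(2)[of "(G'', S'')"] by (simp add: Q_def)
  qed
  then have "reduced_graph (fst p)"
    using graphs(1) by (simp add: reduced_graph_def)
  then show thesis
    using that subdivision by blast
qed

section \<open>Constructions B, C and D\<close>

text \<open>The signs chosen in advance survive only as signs of subdivided edges and may equally be
  read off afterwards. An edge outside \<open>F\<close> then comes out positive, so \<open>F\<close>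
  contains the negative edges as Construction B requires.\<close>

lemma constructionB_iff_constructionC:
  assumes \<sigma>: "signing G \<sigma>"
  shows "constructionB G \<sigma> \<longleftrightarrow> constructionC G \<sigma>"
proof
  assume "constructionB G \<sigma>"
  then obtain G' :: "('a, 'b) graph" and F \<D> S where "reduced_graph G'" "F \<subseteq> edges G'"
     "admissible_partition G' F \<D>" "subdivision G' S G" "signing G \<sigma>"
     "positive_outside G' F S \<sigma>" "admissible_signs G \<D> S \<sigma>"
    unfolding constructionB_def stepsB_def by (elim exE conjE)
  then show "constructionC G \<sigma>"
    unfolding constructionC_def
    by (intro exI[of _ G'] exI[of _ F] exI[of _ \<D>] exI[of _ S] exI[of _ "\<lambda>e. track_sign \<sigma> (S e)"] conjI)
      simp_all
next
  assume "constructionC G \<sigma>"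
  then obtain G' :: "('a, 'b) graph" and F \<D> S \<sigma>' where C: "reduced_graph G'" "F \<subseteq> edges G'"
     "admissible_partition G' F \<D>" "subdivision G' S G" "signing G \<sigma>"
     "positive_outside G' F S \<sigma>" "admissible_signs G \<D> S \<sigma>"
    and "\<forall>e' \<in> edges G'. \<sigma>' e' = track_sign \<sigma> (S e')"
    unfolding constructionC_def by (elim exE conjE)
  then have \<sigma>': "\<And>e'. e' \<in> edges G' \<Longrightarrow> \<sigma>' e' = track_sign \<sigma> (S e')"
    by simp
  interpret subdivided G' S G
    using C by unfold_locales
  have unit: "(\<Prod>e\<in>A. \<sigma> e) \<in> {1, -1}" if "A \<subseteq> edges G" for A
    using finite_subset[OF that fin(2)] that
    by (induction A rule: finite_induct) (use \<sigma> in \<open>auto simp: signing_def\<close>)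
  have "signing G' \<sigma>'"
    unfolding signing_def using \<sigma>' unit S_path(7) by (auto simp: track_sign_def)
  moreover have "\<sigma>' e = 1" if "e \<in> edges G' - F" for e
    using \<sigma>'[of e] C(6) that by (auto simp: positive_outside_def track_sign_def intro!: prod.neutral)
  then have "{e \<in> edges G'. \<sigma>' e = -1} \<subseteq> F"
    by force
  moreover have "tedges P \<subseteq> edges G'" if "P \<in> \<D>" for P
    using C(2,3) that unfolding admissible_partition_def by blast
  then have "signs_agree \<D> S \<sigma>' \<sigma>"
    unfolding signs_agree_def using \<sigma>' by (metis subsetD)
  ultimately have "stepsB G' \<sigma>' G \<sigma>"
    unfolding stepsB_def using C by (intro exI[of _ F] exI[of _ \<D>] exI[of _ S]) simp
  then show "constructionB G \<sigma>"
    unfolding constructionB_def using C(1) \<open>signing G' \<sigma>'\<close> by blast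
qed

text \<open>For every choice of \<open>G'\<close> and its signs, balance of G amounts to balance of
  \<open>G'\<close>, and this can be tested in nontrivial blocks because each circle lies in
  one.\<close>

lemma constructionD_iff:
  shows "constructionD G \<sigma> \<longleftrightarrow> constructionB G \<sigma> \<and> balanced G \<sigma>"
proof -
  have bal: "balanced G \<sigma> \<longleftrightarrow> (\<forall>B. nontrivial_block G' B \<longrightarrow> balanced B \<sigma>')"
    if \<sigma>': "signing G' \<sigma>'" and steps: "stepsB G' \<sigma>' G \<sigma>" for G' :: "('a, 'b) graph" and \<sigma>'
  proof -
    obtain F \<D> S where S: "F \<subseteq> edges G'" "{e \<in> edges G'. \<sigma>' e = -1} \<subseteq> F"
       "admissible_partition G' F \<D>" "subdivision G' S G"
       "positive_outside G' F S \<sigma>" "signs_agree \<D> S \<sigma>' \<sigma>"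
      using steps unfolding stepsB_def by (elim exE conjE)
    interpret subdivided G' S G
      using S by unfold_locales
    have "\<sigma>' e = track_sign \<sigma> (S e)" if e: "e \<in> edges G'" for e
    proof (cases "e \<in> F")
      case True
      then obtain P where "P \<in> \<D>" "e \<in> tedges P"
        using S(3) unfolding admissible_partition_def by blast
      then show ?thesis
        using S(6) by (simp add: signs_agree_def)
    next
      case False
      \<comment> \<open>\<open>F\<close> contains all negative edges of \<open>G'\<close>, and paths
        outside \<open>F\<close> are all positive, so the signs agree there too.\<close>
      then have "\<sigma>' e = 1"
        using \<sigma>' e S(2) by (auto simp: signing_def)
      moreover have "track_sign \<sigma> (S e) = 1"
        using S(5) e False by (auto simp: positive_outside_def track_sign_def intro!: prod.neutral)
      ultimately show ?thesis
        by simp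
    qed
    then have "balanced G \<sigma> \<longleftrightarrow> balanced G' \<sigma>'"
      by (rule balanced_iff)
    also have "\<dots> \<longleftrightarrow> (\<forall>B. nontrivial_block G' B \<longrightarrow> balanced B \<sigma>')"
    proof (intro iffI allI impI)
      fix B assume b: "balanced G' \<sigma>'" and B: "nontrivial_block G' B"
      show "balanced B \<sigma>'"
        unfolding balanced_def
      proof (intro allI impI)
        fix C assume "circle B C"
        then have "circle G' C"
          by (rule subgraph_circle[OF nontrivial_block_subgraph[OF B]])
        then show "track_sign \<sigma>' C = 1"
          using b by (simp add: balanced_def)
      qed
    next
      assume b: "\<forall>B. nontrivial_block G' B \<longrightarrow> balanced B \<sigma>'"
      show "balanced G' \<sigma>'"
        unfolding balanced_def
      proof (intro allI impI)
        fix C assume C: "circle G' C"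
        obtain B where B: "nontrivial_block G' B" "subgraph (track_graph G' C) B"
          using circle_in_nontrivial_block[OF graphs(1) C] .
        have "circle B C"
          by (rule subgraph_circle[OF B(2) circle_in_track_graph[OF C]])
        then show "track_sign \<sigma>' C = 1"
          using b B by (simp add: balanced_def)
      qed
    qed
    finally show ?thesis .
  qed
  show ?thesis
    unfolding constructionD_def constructionB_def using bal by blast
qed

text \<open>The circle takes up the whole degree at \<open>v\<close>.\<close>

lemma low_degree_circle:
  assumes G: "is_graph G" and d: "degree G v \<le> 2" and C: "circle G C" "v \<in> tverts C"
  shows "{e \<in> edges G. v \<in> ends G e} \<subseteq> tedges C"
proof
  fix e assume e: "e \<in> {e \<in> edges G. v \<in> ends G e}"
  have CT: "finite (tedges C)" "tedges C \<subseteq> edges G"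
    using track_finite_edges[OF circle_track[OF C(1)]] track_edges_subset[OF circle_track[OF C(1)]] .
  have "deg_in (ends G) (edges G) v \<le> deg_in (ends G) (tedges C) v"
    using circle_deg_in[OF C(1), of v] C(2) d by (simp add: degree_eq_deg_in graph_finite[OF G])
  then show "e \<in> tedges C"
    by (intro deg_in_eq_imp_contains[where E = "ends G" and v = v, OF CT(1) graph_finite(1)[OF G] CT(2)]) (use e in auto)
qed

section \<open>From Property 2 to Construction C\<close>

lemma track_subgraph:
  fixes G :: "('v, 'e) graph"
  assumes G: "is_graph G" and P: "track G P" "nontrivial P" and C: "track G C" "tedges P \<subseteq> tedges C"
  shows "subgraph (track_graph G P) (track_graph G C)"
proof -
  have "tverts P \<subseteq> tverts C"
  proof
    fix v assume "v \<in> tverts P"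
    then obtain e where "e \<in> tedges P" "v \<in> ends G e"
      using track_edge_at[OF P] by blast
    then show "v \<in> tverts C"
      using track_ends_subset[OF C(1)] C(2) by blast
  qed
  then show ?thesis
    using track_graph_subgraph[OF G P(1)] C(2) by (simp add: subgraph_def)
qed

lemma (in linkage) linked_internal:
  assumes \<D>: "linked \<D>" "\<And>v. v \<in> L \<Longrightarrow> \<exists>P \<in> \<D>. v \<in> internal P"
    and P: "P \<in> \<D>" "e \<in> tedges P" and v: "v \<in> L" "e \<in> N v"
  shows "v \<in> internal P"
proof -
  obtain Q where Q: "Q \<in> \<D>" "v \<in> internal Q"
    using \<D>(2)[OF v(1)] by blast
  then have "e \<in> tedges Q"
    using linkedD(7)[OF \<D>(1) Q] v(2) by (auto simp: edges_at_def)
  then show ?thesis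
    using linkedD(5)[OF \<D>(1) P(1) Q(1) P(2)] Q by simp
qed

text \<open>The isthmus condition at trivalent internal vertices comes from \<open>not_N\<close>,
  the block condition from the dichotomy that a track lies on one circle or has no edge on
  any.\<close>

lemma (in linkage) linked_admissible:
  assumes \<D>: "linked \<D>"
    and d: "\<And>v. v \<in> L \<Longrightarrow> degree H v \<le> 3"
    and t: "\<And>P v. P \<in> \<D> \<Longrightarrow> v \<in> termini P \<Longrightarrow> degree H v \<noteq> 2"
  shows "admissible_partition H F \<D>"
  unfolding admissible_partition_def
proof (intro conjI ballI impI)
  note D = linkedD[OF \<D>]
  show "nontrivial P" if "P \<in> \<D>" for P
    using D(3)[OF that] .
  show "path H P \<or> circle H P" if "P \<in> \<D>" for P
    using D(2)[OF that] by (simp add: track_def)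
  show "(\<Union>P \<in> \<D>. tedges P) = F"
    by (rule D(4))
  show "pairwise (\<lambda>P Q. disjnt (tedges P) (tedges Q)) \<D>"
    using \<D> by (simp add: linked_def)
  fix P assume P: "P \<in> \<D>"
  show "degree H v \<le> 3" if "v \<in> internal P" for v
    using d D(6)[OF P that] by blast
  show "isthmus H e" if v: "v \<in> internal P" and e: "e \<in> edges H" "v \<in> ends H e \<and> e \<notin> tedges P" for v e
  proof (rule not_in_circle_imp_isthmus[OF graph e(1)])
    fix C assume C: "circle H C"
    have "v \<in> L" "e \<notin> N v"
      using D(6,7)[OF P v] e by (auto simp: edges_at_def)
    then show "e \<notin> tedges C"
      using not_N e C by blast
  qed
  show "degree H v \<noteq> 2" if "v \<in> termini P" for v
    using t P that .
  show "(\<exists>B. nontrivial_block H B \<and> subgraph (track_graph H P) B) \<or> (\<forall>e \<in> tedges P. isthmus H e)"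
  proof (cases "\<exists>C e. circle H C \<and> e \<in> tedges C \<and> e \<in> tedges P")
    case True
    then obtain C e where C: "circle H C" "e \<in> tedges C" "e \<in> tedges P"
      by blast
    then have "tedges P \<subseteq> tedges C"
      using linked_circle_contains[OF \<D> P] by blast
    then have "subgraph (track_graph H P) (track_graph H C)"
      using track_subgraph[OF graph D(2,3)[OF P] circle_track[OF C(1)]] by blast
    moreover obtain B where "nontrivial_block H B" "subgraph (track_graph H C) B"
      using circle_in_nontrivial_block[OF graph C(1)] .
    ultimately show ?thesis
      using subgraph_trans by blast
  next
    case False
    then show ?thesis
      using not_in_circle_imp_isthmus[OF graph] track_edges_subset[OF D(2)[OF P]] by blast
  qed
qed

lemma loop_in_circle:
  assumes G: "is_graph G" and e: "e \<in> edges G" "ends G e = {v}"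
  obtains C where "circle G C" "e \<in> tedges C"
proof -
  have "even_set (ends G) {e}"
    using e by (auto simp: even_set_def deg_in_def inc_def)
  then show thesis
    using even_set_contains_circle[OF G, of "{e}" e] e that by blast
qed

lemma property2_imp_constructionC:
  fixes G :: "('v, 'e) graph"
  assumes G: "is_graph G" and \<sigma>: "signing G \<sigma>" and p2: "property2 G \<sigma>"
  shows "constructionC G \<sigma>"
proof -
  obtain G' :: "('v, 'e) graph" and S where sub: "subdivision G' S G" and red: "reduced_graph G'"
    using reduced_subdivision_exists[OF G] .
  interpret subdivided G' S G
    using sub by unfold_locales
  \<comment> \<open>\<open>positive_outside\<close> and \<open>admissible_signs\<close> force this
    choice.\<close>
  define F where "F = {f \<in> edges G'. \<exists>e \<in> tedges (S f). \<sigma> e \<noteq> 1}"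
  \<comment> \<open>The edges of \<open>G'\<close> whose subdivision has a positive edge at
    \<open>v\<close>. An edge of \<open>F\<close> may be among them, its negative edges lying
    farther along, so \<open>F\<close> alone does not tell which edges to link.\<close>
  define T where "T v = {f \<in> edges G'. v \<in> ends G' f \<and> (\<exists>e \<in> tedges (S f). v \<in> ends G e \<and> \<sigma> e = 1)}" for v
  define L3 where "L3 = {v \<in> verts G'. degree G' v = 3 \<and> neg_degree G \<sigma> v = 2}"
  \<comment> \<open>Vertices with a divalent loop survive suppression and yet must not be termini;
    such a loop has to become a circle.\<close>
  define L2 where "L2 = {v \<in> verts G'. degree G' v = 2 \<and> (\<exists>f \<in> F. ends G' f = {v})}"
  define N where "N v = (if v \<in> L3 then {f \<in> edges G'. v \<in> ends G' f} - T v else {f \<in> F. v \<in> ends G' f})" for v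
  have sign: "\<sigma> e = 1 \<or> \<sigma> e = -1" if "e \<in> edges G" for e
    using \<sigma> that by (auto simp: signing_def)
  have VG: "v \<in> verts G" if "v \<in> verts G'" for v
    using verts_G that by blast
  have S_edge_at: "\<exists>e \<in> tedges (S f). v \<in> ends G e" if "f \<in> edges G'" "v \<in> ends G' f" for f v
  proof (rule track_edge_at[OF S_path(2,3)[OF that(1)]])
    show "v \<in> tverts (S f)"
      using S_path(4)[OF that(1)] track_termini_subset[OF S_path(2)[OF that(1)]] that(2) by blast
  qed
  \<comment> \<open>Lifted to G, the circle becomes an even set and so yields a circle of G through
    the positive edge at \<open>v\<close>, which Property 2 excludes.\<close>
  have T_circle: "f \<notin> tedges C" if v: "v \<in> L3" and f: "f \<in> T v" and C: "circle G' C" for v f C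
  proof
    assume fC: "f \<in> tedges C"
    obtain e where e: "e \<in> tedges (S f)" "v \<in> ends G e" "\<sigma> e = 1"
      using f by (auto simp: T_def)
    have CG: "tedges C \<subseteq> edges G'"
      using track_edges_subset[OF circle_track[OF C]] .
    have "(\<Union>e\<in>tedges C. tedges (S e)) \<subseteq> edges G"
      using CG edges_G by blast
    then obtain D where "circle G D" "e \<in> tedges D"
      using even_set_contains_circle[OF G even_set_lift[OF CG circle_even_set[OF C]], of e] fC e(1) by blast
    moreover have "v \<in> verts G" "neg_degree G \<sigma> v = 2"
      using v VG by (auto simp: L3_def)
    ultimately show False
      using property2_positive_not_in_circle[OF p2 G _ _ e(2)] e(3) by auto
  qed
  \<comment> \<open>The edges of \<open>S f\<close> at \<open>v\<close> are all negative or all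
    non-negative. If \<open>f\<close> is in \<open>T v\<close>, it is no loop, since a loop lies on
    a circle, and so the positive edge is the only edge of \<open>S f\<close> at
    \<open>v\<close>.\<close>
  have negS: "deg_in (ends G) {e \<in> tedges (S f). \<sigma> e = -1} v = (if f \<in> N v then inc (ends G') f v else 0)"
    if v: "v \<in> L3" and f: "f \<in> edges G'" for v f
  proof (cases "v \<in> ends G' f")
    case False
    then have "v \<notin> tverts (S f)"
      using S_path(4,5)[OF f] v by (auto simp: internal_def L3_def)
    then have "\<not> (\<exists>e \<in> {e \<in> tedges (S f). \<sigma> e = -1}. v \<in> ends G e)"
      using track_ends_subset[OF S_path(2)[OF f]] by blast
    then have "deg_in (ends G) {e \<in> tedges (S f). \<sigma> e = -1} v = 0"
      using deg_in_pos_iff[of "{e \<in> tedges (S f). \<sigma> e = -1}" "ends G" v] S_path(6)[OF f] by simp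
    then show ?thesis
      using False by (simp add: inc_def)
  next
    case at: True
    have vV: "v \<in> verts G'"
      using v by (simp add: L3_def)
    show ?thesis
    proof (cases "f \<in> T v")
      case True
      have "ends G' f \<noteq> {v}"
        using loop_in_circle[OF graphs(1) f, of v] T_circle[OF v True] by blast
      then have one: "deg_in (ends G) (tedges (S f)) v = 1"
        using S_deg_in[OF f vV] at by (simp add: inc_def)
      obtain e where e: "e \<in> tedges (S f)" "v \<in> ends G e" "\<sigma> e = 1"
        using True by (auto simp: T_def)
      let ?A = "{e \<in> tedges (S f). \<sigma> e = -1}"
      have "deg_in (ends G) (insert e ?A) v \<le> 1"
        unfolding one[symmetric] using e S_path(6)[OF f] by (intro deg_in_mono) auto
      moreover have "deg_in (ends G) (insert e ?A) v = inc (ends G) e v + deg_in (ends G) ?A v"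
        using e S_path(6)[OF f] by (intro deg_in_insert) auto
      ultimately have "deg_in (ends G) ?A v = 0"
        using inc_pos_iff[of "ends G" e v] e(2) by simp
      then show ?thesis
        using True v by (simp add: N_def)
    next
      case False
      then have fN: "f \<in> N v"
        using at f v by (simp add: N_def)
      have "{e \<in> {e \<in> tedges (S f). \<sigma> e = -1}. v \<in> ends G e} = {e \<in> tedges (S f). v \<in> ends G e}"
        using False at f sign S_path(7)[OF f] by (auto simp: T_def)
      then have "deg_in (ends G) {e \<in> tedges (S f). \<sigma> e = -1} v = deg_in (ends G) (tedges (S f)) v"
        using deg_in_at[of "{e \<in> tedges (S f). \<sigma> e = -1}" "ends G" v] deg_in_at[of "tedges (S f)" "ends G" v]
          S_path(6)[OF f] by simp
      then show ?thesis
        using fN S_deg_in[OF f vV] by simp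
    qed
  qed
  \<comment> \<open>The loop exhausts the degree 2 of \<open>v\<close>.\<close>
  have L2_edges: "f = g" if v: "v \<in> L2" and f: "f \<in> F" "ends G' f = {v}" and g: "g \<in> edges G'" "v \<in> ends G' g" for v f g
  proof (rule ccontr)
    assume "f \<noteq> g"
    have fE: "f \<in> edges G'"
      using f by (simp add: F_def)
    have "deg_in (ends G') {f, g} v \<le> degree G' v"
      unfolding degree_eq_deg_in[OF fin(1)] using fE g fin by (intro deg_in_mono) auto
    moreover have "0 < inc (ends G') g v"
      using g by (simp add: inc_pos_iff)
    ultimately show False
      using v f(2) \<open>f \<noteq> g\<close> by (simp add: L2_def deg_in_def inc_def[of _ f])
  qed
  have L23: "v \<notin> L3" if "v \<in> L2" for v
    using that by (simp add: L2_def L3_def)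
  interpret linkage G' F "L3 \<union> L2" N
  proof
    show "is_graph G'"
      by (rule graphs)
    show "F \<subseteq> edges G'"
      by (auto simp: F_def)
  next
    fix v assume v: "v \<in> L3 \<union> L2"
    show "N v \<subseteq> {e \<in> F. v \<in> ends G' e}"
    proof
      fix f assume f: "f \<in> N v"
      show "f \<in> {e \<in> F. v \<in> ends G' e}"
      proof (cases "v \<in> L3")
        case True
        then have *: "f \<in> edges G'" "v \<in> ends G' f" "f \<notin> T v"
          using f by (auto simp: N_def)
        then show ?thesis
          using S_edge_at[OF *(1,2)] by (auto simp: F_def T_def)
      next
        case False
        then show ?thesis
          using f by (simp add: N_def)
      qed
    qed
    \<comment> \<open>At a vertex of \<open>L3\<close>, \<open>negS\<close> turns the negative
      degree in G into the sum of the incidences of \<open>N v\<close> in \<open>G'\<close>.\<close>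
    show "deg_in (ends G') (N v) v = 2"
    proof (cases "v \<in> L3")
      case True
      have "neg_edges G \<sigma> = (\<Union>f \<in> edges G'. {e \<in> tedges (S f). \<sigma> e = -1})"
        using edges_G by auto
      then have "neg_degree G \<sigma> v = deg_in (ends G) (\<Union>f \<in> edges G'. {e \<in> tedges (S f). \<sigma> e = -1}) v"
        using neg_degree_eq_deg_in[OF fin(2)] by simp
      also have "\<dots> = (\<Sum>f \<in> edges G'. deg_in (ends G) {e \<in> tedges (S f). \<sigma> e = -1} v)"
      proof (rule deg_in_UN[OF fin(1)])
        show "finite {e \<in> tedges (S f). \<sigma> e = -1}" if "f \<in> edges G'" for f
          using S_path(6)[OF that] by simp
        show "{e \<in> tedges (S f). \<sigma> e = -1} \<inter> {e \<in> tedges (S g). \<sigma> e = -1} = {}"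
          if "f \<in> edges G'" "g \<in> edges G'" "f \<noteq> g" for f g
          using S_disjoint(1)[OF that] by blast
      qed
      also have "\<dots> = (\<Sum>f \<in> edges G'. if f \<in> N v then inc (ends G') f v else 0)"
        using negS[OF True] by (intro sum.cong) auto
      also have "\<dots> = (\<Sum>f \<in> edges G' \<inter> N v. inc (ends G') f v)"
        using fin by (simp add: sum.inter_restrict)
      also have "edges G' \<inter> N v = N v"
        using True by (auto simp: N_def)
      finally show ?thesis
        using True by (simp add: deg_in_def L3_def)
    next
      case False
      then have v2: "v \<in> L2"
        using v by blast
      then obtain f where f: "f \<in> F" "ends G' f = {v}"
        by (auto simp: L2_def)
      then have "N v = {f}"
        using L2_edges[OF v2 f] False by (auto simp: N_def F_def)
      then show ?thesis
        using f by (simp add: deg_in_def inc_def)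
    qed
  next
    fix v e C assume *: "v \<in> L3 \<union> L2" "e \<in> edges G'" "v \<in> ends G' e" "e \<notin> N v" "circle G' C"
    show "e \<notin> tedges C"
    proof (cases "v \<in> L3")
      case True
      then show ?thesis
        using T_circle[OF True _ *(5), of e] * by (auto simp: N_def)
    next
      case False
      then have v2: "v \<in> L2"
        using * by blast
      then obtain f where f: "f \<in> F" "ends G' f = {v}"
        by (auto simp: L2_def)
      then have "e \<in> N v"
        using L2_edges[OF v2 f *(2,3)] False by (auto simp: N_def)
      then show ?thesis
        using * by blast
    qed
  qed
  obtain \<D> where \<D>: "linked \<D>" "\<And>v. v \<in> L3 \<union> L2 \<Longrightarrow> \<exists>P \<in> \<D>. v \<in> internal P"
    using linked_exists by blast
  note D = linkedD[OF \<D>(1)]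
  have not_linked_terminus: False if "P \<in> \<D>" "f \<in> tedges P" "v \<in> L3 \<union> L2" "f \<in> N v" "v \<in> termini P" for P f v
    using linked_internal[OF \<D> that(1,2,3,4)] that(5) by (simp add: internal_def)
  \<comment> \<open>A divalent vertex of the reduced graph carries a loop, its only edge. As an edge
    of a track this is in \<open>F\<close>, so the vertex belongs to \<open>L2\<close> and is
    internal.\<close>
  have terminus: "degree G' v \<noteq> 2" if P: "P \<in> \<D>" and v: "v \<in> termini P" for P v
  proof
    assume d: "degree G' v = 2"
    have vP: "v \<in> tverts P"
      using track_termini_subset[OF D(2)[OF P]] v by blast
    then have vV: "v \<in> verts G'"
      using track_verts_subset[OF D(2)[OF P]] by blast
    obtain f where f: "f \<in> tedges P" "v \<in> ends G' f"
      using track_edge_at[OF D(2,3)[OF P] vP] by blast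
    have fF: "f \<in> F"
      using D(4) P f by blast
    obtain g where g: "g \<in> edges G'" "ends G' g = {v}"
      using red vV d by (auto simp: reduced_graph_def)
    have "f = g"
    proof (rule ccontr)
      assume "f \<noteq> g"
      have "f \<in> edges G'"
        using fF by (simp add: F_def)
      then have "deg_in (ends G') {f, g} v \<le> degree G' v"
        unfolding degree_eq_deg_in[OF fin(1)] using g fin by (intro deg_in_mono) auto
      moreover have "0 < inc (ends G') f v"
        using f by (simp add: inc_pos_iff)
      ultimately show False
        using d g(2) \<open>f \<noteq> g\<close> by (simp add: deg_in_def inc_def[of _ g])
    qed
    then have v2: "v \<in> L2"
      using vV d g fF by (auto simp: L2_def)
    then have "f \<in> N v"
      using L23[OF v2] fF f by (simp add: N_def)
    then show False
      using not_linked_terminus[OF P f(1) _ _ v] v2 by blast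
  qed
  have "admissible_partition G' F \<D>"
    by (rule linked_admissible[OF \<D>(1)]) (use terminus in \<open>auto simp: L3_def L2_def\<close>)
  moreover have "positive_outside G' F S \<sigma>"
    by (auto simp: positive_outside_def F_def)
  moreover have "admissible_signs G \<D> S \<sigma>"
    unfolding admissible_signs_def Let_def
  proof (intro ballI conjI impI)
    fix P assume P: "P \<in> \<D>"
    have PF: "tedges P \<subseteq> F"
      using D(4) P by blast
    then have PE: "tedges P \<subseteq> edges G'"
      by (auto simp: F_def)
    show "\<not> (\<forall>e \<in> tedges (S f). \<sigma> e = 1)" if "f \<in> tedges P" for f
      using PF that by (auto simp: F_def)
    show "\<sigma> e = 1" if v: "v \<in> termini (subdivide_track S P)" and d1: "degree G v \<noteq> 1"
      and e: "e \<in> tedges (subdivide_track S P)" "v \<in> ends G e" for v e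
    proof (rule ccontr)
      assume neg: "\<sigma> e \<noteq> 1"
      have vt: "v \<in> termini P"
        using v by (simp add: subdivide_track_def)
      have vV: "v \<in> verts G'"
        using track_termini_subset[OF D(2)[OF P]] track_verts_subset[OF D(2)[OF P]] vt by blast
      obtain f where f: "f \<in> tedges P" "e \<in> tedges (S f)"
        using e by (auto simp: subdivide_track_def)
      have fE: "f \<in> edges G'"
        using f PE by blast
      have eG: "e \<in> edges G"
        using S_path(7)[OF fE] f by blast
      then have e_neg: "e \<in> neg_edges G \<sigma>"
        using sign neg by auto
      then have pos: "0 < neg_degree G \<sigma> v"
        using neg_degree_pos_iff[OF fin(2), of \<sigma> v] e(2) by blast
      \<comment> \<open>All degrees but 3 are ruled out, so \<open>v\<close> would be in
        \<open>L3\<close> with \<open>f\<close> in \<open>N v\<close>, and hence internal to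
        \<open>P\<close>.\<close>
      have "degree G v > 3 \<longrightarrow> neg_degree G \<sigma> v = 0" "degree G v = 3 \<longrightarrow> neg_degree G \<sigma> v \<in> {0, 2}"
        using p2 VG[OF vV] by (simp_all add: property2_def)
      moreover have "degree G v \<noteq> 2"
        using terminus[OF P vt] degree_eq[OF vV] by simp
      moreover have "degree G v \<noteq> 0"
        using pos neg_degree_le_degree[OF fin(2), of \<sigma> v] by simp
      ultimately have "degree G v = 3" "neg_degree G \<sigma> v = 2"
        using pos d1 by auto
      then have v3: "v \<in> L3"
        using vV degree_eq[OF vV] by (simp add: L3_def)
      have "f \<in> N v"
      proof (rule ccontr)
        assume "f \<notin> N v"
        then have "deg_in (ends G) {e \<in> tedges (S f). \<sigma> e = -1} v = 0"
          using negS[OF v3 fE] by simp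
        moreover have "finite {e \<in> tedges (S f). \<sigma> e = -1}"
          using S_path(6)[OF fE] by simp
        ultimately show False
          using deg_in_pos_iff[of "{e \<in> tedges (S f). \<sigma> e = -1}" "ends G" v] f(2) e(2) e_neg by auto
      qed
      then show False
        using not_linked_terminus[OF P f(1) _ _ vt] v3 by blast
    qed
    \<comment> \<open>A trivalent vertex is an old one and not in \<open>L2\<close>. The edges of
      \<open>P\<close> there are \<open>N v\<close>, hence outside \<open>T v\<close>, and their
      subdivisions have only negative edges at \<open>v\<close>.\<close>
    show "\<sigma> e = -1" if v: "v \<in> internal (subdivide_track S P)" and d3: "degree G v = 3"
      and e: "e \<in> tedges (subdivide_track S P)" "v \<in> ends G e" for v e
    proof -
      obtain f where f: "f \<in> tedges P" "e \<in> tedges (S f)"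
        using e by (auto simp: subdivide_track_def)
      have fE: "f \<in> edges G'"
        using f PE by blast
      have "v \<in> tverts (S f)"
        using track_ends_subset[OF S_path(2)[OF fE] f(2)] e(2) by blast
      moreover have "v \<notin> internal (S f)"
        using degree_internal[OF fE] d3 by auto
      ultimately have vf: "v \<in> ends G' f"
        using S_path(4)[OF fE] by (simp add: internal_def)
      then have "v \<in> tverts P"
        using track_ends_subset[OF D(2)[OF P] f(1)] by blast
      then have vi: "v \<in> internal P"
        using v by (simp add: internal_def subdivide_track_def)
      have vV: "v \<in> verts G'"
        using vf ends_subset[OF fE] by blast
      have "v \<in> L3 \<union> L2" "edges_at P v = N v"
        using D(6,7)[OF P vi] by auto
      moreover have "v \<notin> L2"
        using d3 degree_eq[OF vV] by (auto simp: L2_def)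
      moreover have "f \<in> edges_at P v"
        using f vf by (simp add: edges_at_def)
      ultimately have "f \<notin> T v"
        by (auto simp: N_def)
      then have "\<sigma> e \<noteq> 1"
        using f(2) e(2) fE vf by (auto simp: T_def)
      then show ?thesis
        using sign[of e] S_path(7)[OF fE] f(2) by blast
    qed
  qed
  ultimately have "reduced_graph G' \<and> F \<subseteq> edges G' \<and>
     admissible_partition G' F \<D> \<and> subdivision G' S G \<and> signing G \<sigma> \<and>
     positive_outside G' F S \<sigma> \<and> admissible_signs G \<D> S \<sigma> \<and>
     (\<forall>e' \<in> edges G'. track_sign \<sigma> (S e') = track_sign \<sigma> (S e'))"
    using red sub \<sigma> F_edges by blast
  then show ?thesis
    unfolding constructionC_def by (intro exI[of _ G'] exI[of _ F] exI[of _ \<D>] exI[of _ S] exI[of _ "\<lambda>e. track_sign \<sigma> (S e)"])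
qed

text \<open>At a vertex of degree above 2 the positive signs at termini force each negative edge
  into a track with \<open>v\<close> internal. Then \<open>v\<close> has degree 3, which leaves room
  for one such track only; its edges at \<open>v\<close> are negative, and any other edge there
  comes from an isthmus, so circles through \<open>v\<close> follow the track.\<close>

lemma constructionC_imp_property2:
  fixes G :: "('v, 'e) graph"
  assumes "constructionC G \<sigma>"
  shows "property2 G \<sigma>"
  unfolding property2_def
proof (intro ballI)
  fix v assume v: "v \<in> verts G"
  obtain G' :: "('v, 'e) graph" and F \<D> S where FE: "F \<subseteq> edges G'"
     and adm: "admissible_partition G' F \<D>" and sub: "subdivision G' S G" and \<sigma>: "signing G \<sigma>"
     and out: "positive_outside G' F S \<sigma>" and signs: "admissible_signs G \<D> S \<sigma>"
    using assms unfolding constructionC_def by (elim exE conjE)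
  interpret subdivided G' S G
    using sub by unfold_locales
  show "(degree G v > 3 \<longrightarrow> neg_degree G \<sigma> v = 0) \<and> (degree G v = 3 \<longrightarrow> neg_degree G \<sigma> v \<in> {0, 2}) \<and>
    (neg_degree G \<sigma> v = 2 \<longrightarrow>
      (\<forall>C. circle G C \<and> v \<in> tverts C \<longrightarrow> {e \<in> edges G. v \<in> ends G e \<and> \<sigma> e = -1} \<subseteq> tedges C))"
  \<comment> \<open>Up to degree 2, a circle through \<open>v\<close> contains all edges at
    \<open>v\<close>, whatever their signs.\<close>
  proof (cases "degree G v \<le> 2 \<or> neg_degree G \<sigma> v = 0")
    case True
    then show ?thesis
      using low_degree_circle[OF graphs(2), of v] by fastforce
  next
    case False
    then have d: "degree G v > 2" and pos: "0 < neg_degree G \<sigma> v"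
      by auto
    have vV: "v \<in> verts G'"
      using v verts_G degree_internal[of _ v] d by fastforce
    have DT: "track G' P" "nontrivial P" "tedges P \<subseteq> F" if "P \<in> \<D>" for P
      using adm that by (auto simp: admissible_partition_def track_def)
    have uni: "P = Q" if "P \<in> \<D>" "Q \<in> \<D>" "f \<in> tedges P" "f \<in> tedges Q" for P Q f
      using adm that unfolding admissible_partition_def pairwise_def disjnt_def by blast
    have ends_S: "v \<in> ends G' f" if "f \<in> edges G'" "e \<in> tedges (S f)" "v \<in> ends G e" for f e
      using track_ends_subset[OF S_path(2)[OF that(1)] that(2)] S_path(4,5)[OF that(1)] that vV
      by (auto simp: internal_def)
    have neg_track: "\<exists>P \<in> \<D>. v \<in> internal P \<and> e \<in> (\<Union>f \<in> tedges P. tedges (S f))"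
      if e: "e \<in> neg_edges G \<sigma>" "v \<in> ends G e" for e
    proof -
      obtain f where f: "f \<in> edges G'" "e \<in> tedges (S f)"
        using e edges_G by blast
      have "f \<in> F"
        using out f e unfolding positive_outside_def by force
      then obtain P where P: "P \<in> \<D>" "f \<in> tedges P"
        using adm unfolding admissible_partition_def by blast
      have vP: "v \<in> tverts P"
        using track_ends_subset[OF DT(1)[OF P(1)] P(2)] ends_S[OF f e(2)] by blast
      have "\<forall>v \<in> termini (subdivide_track S P). degree G v \<noteq> 1 \<longrightarrow>
          (\<forall>e \<in> tedges (subdivide_track S P). v \<in> ends G e \<longrightarrow> \<sigma> e = 1)"
        using signs P(1) unfolding admissible_signs_def Let_def by blast
      then have "v \<notin> termini P"
        using d e f P by (fastforce simp: subdivide_track_def)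
      then show ?thesis
        using P f vP by (auto simp: internal_def)
    qed
    obtain e0 where e0: "e0 \<in> neg_edges G \<sigma>" "v \<in> ends G e0"
      using pos neg_degree_pos_iff[OF fin(2), of \<sigma> v] by blast
    obtain P where P: "P \<in> \<D>" "v \<in> internal P"
      using neg_track[OF e0] by blast
    have "degree G' v \<le> 3"
      using adm P unfolding admissible_partition_def by blast
    then have d3: "degree G v = 3" "degree G' v = 3"
      using d degree_eq[OF vV] by auto
    have PE: "tedges P \<subseteq> edges G'"
      using DT(3)[OF P(1)] FE by blast
    define U where "U = (\<Union>f \<in> tedges P. tedges (S f))"
    have UG: "U \<subseteq> edges G" "finite U"
      using PE edges_G fin finite_subset[of U "edges G"] by (auto simp: U_def)
    have degP: "deg_in (ends G') (tedges Q) v = 2" if "Q \<in> \<D>" "v \<in> internal Q" for Q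
      using track_deg_in_internal[OF DT(1)[OF that(1)] that(2)] .
    have degU: "deg_in (ends G) U v = 2"
      using deg_in_lift[OF PE vV] degP[OF P] by (simp add: U_def)
    have unique: "Q = P" if Q: "Q \<in> \<D>" "v \<in> internal Q" for Q
    proof (rule ccontr)
      assume "Q \<noteq> P"
      then have "tedges Q \<inter> tedges P = {}"
        using uni[OF Q(1) P(1)] by blast
      then have "deg_in (ends G') (tedges Q \<union> tedges P) v = 4"
        using deg_in_union[of "tedges Q" "tedges P" "ends G'" v] degP[OF Q] degP[OF P]
          track_finite_edges[OF DT(1)[OF Q(1)]] track_finite_edges[OF DT(1)[OF P(1)]] by simp
      moreover have "deg_in (ends G') (tedges Q \<union> tedges P) v \<le> degree G' v"
        unfolding degree_eq_deg_in[OF fin(1)] using DT(3)[OF Q(1)] PE FE by (intro deg_in_mono fin) blast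
      ultimately show False
        using d3 by simp
    qed
    have at: "{e \<in> edges G. v \<in> ends G e \<and> \<sigma> e = -1} = {e \<in> U. v \<in> ends G e}"
    proof (intro equalityI subsetI)
      fix e assume "e \<in> {e \<in> edges G. v \<in> ends G e \<and> \<sigma> e = -1}"
      then show "e \<in> {e \<in> U. v \<in> ends G e}"
        using neg_track[of e] unique by (auto simp: U_def)
    next
      fix e assume e: "e \<in> {e \<in> U. v \<in> ends G e}"
      have "\<forall>v \<in> internal (subdivide_track S P). degree G v = 3 \<longrightarrow>
          (\<forall>e \<in> tedges (subdivide_track S P). v \<in> ends G e \<longrightarrow> \<sigma> e = -1)"
        using signs P(1) unfolding admissible_signs_def Let_def by blast
      moreover have "v \<in> internal (subdivide_track S P)"
        using P(2) by (auto simp: internal_def subdivide_track_def)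
      ultimately show "e \<in> {e \<in> edges G. v \<in> ends G e \<and> \<sigma> e = -1}"
        using d3 e UG by (auto simp: subdivide_track_def U_def)
    qed
    have "{e \<in> neg_edges G \<sigma>. v \<in> ends G e} = {e \<in> U. v \<in> ends G e}"
      using at by blast
    then have "neg_degree G \<sigma> v = 2"
      using deg_in_at[of "neg_edges G \<sigma>" "ends G" v] deg_in_at[OF UG(2), of "ends G" v] fin degU
      by (simp add: neg_degree_eq_deg_in)
    moreover have "{e \<in> U. v \<in> ends G e} \<subseteq> tedges C" if C: "circle G C" "v \<in> tverts C" for C
    proof -
      have CT: "finite (tedges C)" "tedges C \<subseteq> edges G"
        using track_finite_edges[OF circle_track[OF C(1)]] track_edges_subset[OF circle_track[OF C(1)]] .
      \<comment> \<open>An edge at \<open>v\<close> outside the track belongs to a subdivided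
        isthmus of \<open>G'\<close>, and no circle of G contains it.\<close>
      have third: "e \<in> U" if e: "e \<in> tedges C" "v \<in> ends G e" for e
      proof (rule ccontr)
        assume "e \<notin> U"
        obtain f where f: "f \<in> edges G'" "e \<in> tedges (S f)"
          using e CT edges_G by blast
        have "f \<notin> tedges P"
          using f \<open>e \<notin> U\<close> by (auto simp: U_def)
        then have "isthmus G' f"
          using adm P d3 f(1) ends_S[OF f e(2)] unfolding admissible_partition_def by blast
        then show False
          using isthmus_lift[OF _ f(2) C(1)] e by blast
      qed
      have sub: "{e \<in> tedges C. v \<in> ends G e} \<subseteq> {e \<in> U. v \<in> ends G e}"
        using third by blast
      have "deg_in (ends G) {e \<in> U. v \<in> ends G e} v \<le> deg_in (ends G) {e \<in> tedges C. v \<in> ends G e} v"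
        using deg_in_at[OF UG(2), of "ends G" v] deg_in_at[OF CT(1), of "ends G" v] degU circle_deg_in[OF C(1), of v] C(2) by simp
      then have "e \<in> {e \<in> tedges C. v \<in> ends G e}" if "e \<in> {e \<in> U. v \<in> ends G e}" for e
        by (intro deg_in_eq_imp_contains[where E = "ends G" and v = v, OF _ _ sub _ that]) (use CT UG that in auto)
      then show ?thesis
        by blast
    qed
    ultimately show ?thesis
      using d3 at by simp
  qed
qed

section \<open>Line graphs\<close>

text \<open>The line graph has neither loops nor parallel edges, so a circle in it is determined by
  its vertices in cyclic order; length at least 3 rules out going back along the same edge.\<close>

definition line_cycle :: "('v, 'e) graph \<Rightarrow> 'e list \<Rightarrow> bool" where
  "line_cycle G ds \<longleftrightarrow> 3 \<le> length ds \<and> distinct ds \<and> set ds \<subseteq> edges G \<and>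
     successively (\<lambda>e f. ends G e \<inter> ends G f \<noteq> {}) ds \<and> ends G (last ds) \<inter> ends G (hd ds) \<noteq> {}"

lemma line_cycle_imp_circle:
  assumes ds: "line_cycle G ds"
  obtains C where "circle (line_graph G) C" "tverts C = set ds"
proof -
  \<comment> \<open>The last entry is repeated in front to close the walk, so \<open>ds ! i\<close>
    sits at position \<open>Suc i\<close>.\<close>
  define vs where "vs = last ds # ds"
  define k where "k = length ds"
  define xs where "xs = map (\<lambda>i. {vs ! i, vs ! Suc i}) [0..<k]"
  have k: "3 \<le> k" and dist: "distinct ds" and sub: "set ds \<subseteq> edges G"
    using ds by (auto simp: line_cycle_def k_def)
  have ne: "ds \<noteq> []"
    using k by (auto simp: k_def)
  have v0: "vs ! 0 = ds ! (k - 1)"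
    using ne by (simp add: vs_def last_conv_nth k_def)
  have vS: "vs ! Suc i = ds ! i" for i
    by (simp add: vs_def)
  have eq: "ds ! i = ds ! j \<longleftrightarrow> i = j" if "i < k" "j < k" for i j
    using nth_eq_iff_index_eq[OF dist] that by (simp add: k_def)
  have meet: "ends G (vs ! i) \<inter> ends G (vs ! Suc i) \<noteq> {}" if "i < k" for i
  proof (cases i)
    case 0
    then show ?thesis
      using ds ne v0 by (simp add: line_cycle_def vS last_conv_nth hd_conv_nth k_def)
  next
    case (Suc j)
    then show ?thesis
      using ds that by (auto simp: line_cycle_def vS successively_conv_nth k_def)
  qed
  have neq: "vs ! i \<noteq> vs ! Suc i" if "i < k" for i
    using that k eq v0 vS by (cases i) auto
  have in_edges: "vs ! i \<in> edges G" if "i \<le> k" for i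
    using that sub ne by (cases i) (auto simp: vs_def k_def)
  have "walk (line_graph G) vs xs"
    unfolding walk_def
  proof (intro conjI allI impI)
    show "set vs \<subseteq> verts (line_graph G)"
      using sub ne by (auto simp: vs_def line_graph_def)
    show "set xs \<subseteq> edges (line_graph G)"
    proof
      fix x assume "x \<in> set xs"
      then obtain i where i: "i < k" "x = {vs ! i, vs ! Suc i}"
        by (auto simp: xs_def)
      then show "x \<in> edges (line_graph G)"
        using meet[OF i(1)] neq[OF i(1)] in_edges[of i] in_edges[of "Suc i"] unfolding line_graph_def by auto
    qed
  qed (auto simp: vs_def xs_def k_def line_graph_def)
  moreover have "distinct xs"
  proof -
    \<comment> \<open>A pair occurring twice would have to be traversed in opposite directions,
      which needs a cyclic sequence of length 2.\<close>
    have "inj_on (\<lambda>i. {vs ! i, vs ! Suc i}) {0..<k}"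
    proof (rule inj_onI)
      fix i j assume ij: "i \<in> {0..<k}" "j \<in> {0..<k}" "{vs ! i, vs ! Suc i} = {vs ! j, vs ! Suc j}"
      show "i = j"
      proof (rule ccontr)
        assume "i \<noteq> j"
        then have "vs ! Suc i \<noteq> vs ! Suc j"
          using ij eq[of i j] by (simp add: vS)
        then have *: "vs ! Suc i = vs ! j" "vs ! i = vs ! Suc j"
          using ij(3) by (auto simp: doubleton_eq_iff)
        show False
          using * ij k v0 vS eq by (cases i; cases j) auto
      qed
    qed
    then show ?thesis
      by (simp add: xs_def distinct_map)
  qed
  ultimately have "circle (line_graph G) \<lparr>tverts = set vs, tedges = set xs, termini = {}\<rparr>"
    unfolding circle_iff using k dist ne
    by (intro exI[of _ vs] exI[of _ xs]) (auto simp: vs_def xs_def)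
  moreover have "set vs = set ds"
    using ne by (auto simp: vs_def)
  ultimately show thesis
    using that by simp
qed

text \<open>Indexing by all natural numbers with period \<open>k\<close> removes the wrap-around:
  \<open>a (Suc i)\<close> is always the next vertex.\<close>

lemma line_circle_indexed:
  assumes C: "circle (line_graph G) C"
  obtains a :: "nat \<Rightarrow> 'e" and k where "3 \<le> k" "\<And>i j. a i = a j \<longleftrightarrow> i mod k = j mod k"
    "\<And>i. ends G (a i) \<inter> ends G (a (Suc i)) \<noteq> {}" "tverts C = a ` {..<k}" "tverts C \<subseteq> edges G"
proof -
  obtain vs xs where w: "walk (line_graph G) vs xs" and ne: "xs \<noteq> []" and cl: "hd vs = last vs"
    and dist: "distinct (tl vs)" "distinct xs" and Cv: "tverts C = set vs"
    using C unfolding circle_iff by auto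
  define k where "k = length xs"
  have len: "length vs = Suc k"
    using walk_length[OF w] by (simp add: k_def)
  have k0: "0 < k"
    using ne by (simp add: k_def)
  have cyc: "vs ! 0 = vs ! k"
    using cl len by (simp add: hd_conv_nth last_conv_nth flip: length_greater_0_conv)
  have eqv: "vs ! Suc i = vs ! Suc j \<longleftrightarrow> i = j" if "i < k" "j < k" for i j
    using nth_eq_iff_index_eq[OF dist(1), of i j] that len by (simp add: nth_tl)
  have x: "xs ! i = {vs ! i, vs ! Suc i}" "vs ! i \<noteq> vs ! Suc i" "ends G (vs ! i) \<inter> ends G (vs ! Suc i) \<noteq> {}"
    if i: "i < k" for i
  proof -
    show xi: "xs ! i = {vs ! i, vs ! Suc i}"
      using walk_ends_nth[OF w, of i] i by (simp add: k_def line_graph_def)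
    have "xs ! i \<in> edges (line_graph G)"
      using walk_edges_subset[OF w] i by (auto simp: k_def)
    then obtain e f where "{vs ! i, vs ! Suc i} = {e, f}" "e \<noteq> f" "ends G e \<inter> ends G f \<noteq> {}"
      unfolding xi by (auto simp: line_graph_def)
    then show "vs ! i \<noteq> vs ! Suc i" "ends G (vs ! i) \<inter> ends G (vs ! Suc i) \<noteq> {}"
      by (auto simp: doubleton_eq_iff)
  qed
  have "k \<noteq> 1"
    using x(2)[of 0] cyc by auto
  \<comment> \<open>With two steps, both would use the same pair as their edge, against
    distinctness.\<close>
  moreover have "k \<noteq> 2"
  proof
    assume 2: "k = 2"
    have "xs ! 0 = {vs ! 0, vs ! 1}" "xs ! 1 = {vs ! 1, vs ! 2}"
      using x(1)[of 0] x(1)[of 1] 2 by (simp_all add: numeral_2_eq_2)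
    then have "xs ! 0 = xs ! 1"
      using cyc 2 by auto
    moreover have "0 < length xs" "1 < length xs"
      using 2 by (simp_all add: k_def)
    ultimately show False
      using nth_eq_iff_index_eq[OF dist(2), of 0 1] by simp
  qed
  ultimately have k3: "3 \<le> k"
    using k0 by simp
  \<comment> \<open>Positions 1 to \<open>k\<close> are pairwise distinct, while position 0 repeats
    position \<open>k\<close>; hence the shift by one.\<close>
  define a where "a i = vs ! Suc (i mod k)" for i
  have lt: "i mod k < k" for i
    using k0 by simp
  have "a i = a j \<longleftrightarrow> i mod k = j mod k" for i j
    unfolding a_def using eqv[OF lt lt] .
  moreover have "ends G (a i) \<inter> ends G (a (Suc i)) \<noteq> {}" for i
  proof (cases "Suc (i mod k) = k")
    case True
    then have "a i = vs ! 0" "a (Suc i) = vs ! Suc 0"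
      using cyc by (simp_all add: a_def mod_Suc)
    then show ?thesis
      using x(3)[OF k0] by simp
  next
    case False
    then have "Suc i mod k = Suc (i mod k)" "Suc (i mod k) < k"
      using lt[of i] by (auto simp: mod_Suc)
    then show ?thesis
      using x(3)[of "Suc (i mod k)"] by (simp add: a_def)
  qed
  moreover have "set vs = a ` {..<k}"
  proof
    show "a ` {..<k} \<subseteq> set vs"
      using len by (auto simp: a_def)
    show "set vs \<subseteq> a ` {..<k}"
    proof
      fix e assume "e \<in> set vs"
      then obtain i where i: "i < Suc k" "e = vs ! i"
        using len by (metis in_set_conv_nth)
      show "e \<in> a ` {..<k}"
      proof (cases i)
        case 0
        then have "e = a (k - 1)"
          using i cyc k0 by (simp add: a_def)
        then show ?thesis
          using k0 by auto
      next
        case (Suc j)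
        then have "e = a j" "j < k"
          using i by (auto simp: a_def)
        then show ?thesis
          by blast
      qed
    qed
  qed
  moreover have "set vs \<subseteq> edges G"
    using walk_verts_subset[OF w] by (simp add: line_graph_def)
  ultimately show thesis
    using that[of k a] k3 Cv by simp
qed

lemma walk_successively:
  assumes "walk G vs es"
  shows "successively (\<lambda>e f. ends G e \<inter> ends G f \<noteq> {}) es"
  unfolding successively_conv_nth
proof (intro allI impI)
  fix i assume i: "Suc i < length es"
  then have "vs ! Suc i \<in> ends G (es ! i) \<inter> ends G (es ! Suc i)"
    using walk_ends_nth[OF assms, of i] walk_ends_nth[OF assms, of "Suc i"] by simp
  then show "ends G (es ! i) \<inter> ends G (es ! Suc i) \<noteq> {}"
    by blast
qed

lemma walk_hd_edge:
  assumes "walk G vs es" "es \<noteq> []"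
  shows "hd vs \<in> ends G (hd es)"
  using walk_ends_nth[OF assms(1), of 0] assms(2) walk_nonempty[OF assms(1)]
  by (simp add: hd_conv_nth)

lemma walk_last_edge:
  assumes "walk G vs es" "es \<noteq> []"
  shows "last vs \<in> ends G (last es)"
  using walk_hd_edge[OF walk_rev[OF assms(1)]] assms(2) walk_nonempty[OF assms(1)]
  by (simp add: hd_rev)

section \<open>Consistency of the line graph of a simple graph\<close>

context
  fixes G :: "('v, 'e) graph"
  assumes simple: "simple_graph G"
begin

lemma simple_is_graph: "is_graph G"
  using simple by (simp add: simple_graph_def)

lemma simple_finite: "finite (edges G)"
  using simple_is_graph graph_finite by blast

lemma simple_inc: "e \<in> edges G \<Longrightarrow> inc (ends G) e v = of_bool (v \<in> ends G e)"
  using simple by (auto simp: simple_graph_def inc_def)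

lemma simple_deg_in: "A \<subseteq> edges G \<Longrightarrow> deg_in (ends G) A v = card {e \<in> A. v \<in> ends G e}"
proof -
  assume A: "A \<subseteq> edges G"
  then have "deg_in (ends G) A v = (\<Sum>e\<in>A. of_bool (v \<in> ends G e))"
    unfolding deg_in_def using simple_inc by (intro sum.cong) auto
  also have "\<dots> = card {e \<in> A. v \<in> ends G e}"
    using finite_subset[OF A simple_finite] by (simp add: Int_def)
  finally show ?thesis .
qed

text \<open>A shorter circle would be a loop or a pair of parallel edges.\<close>

lemma circle_walk:
  assumes "circle G C"
  obtains vs es where "walk G vs es" "hd vs = last vs" "distinct es" "3 \<le> length es"
    "tverts C = set vs" "tedges C = set es"
proof -
  obtain vs es where w: "walk G vs es" "es \<noteq> []" "hd vs = last vs" "distinct (tl vs)" "distinct es"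
    "tverts C = set vs" "tedges C = set es"
    using assms unfolding circle_iff by auto
  have len: "length vs = Suc (length es)"
    using walk_length[OF w(1)] .
  have cyc: "vs ! 0 = vs ! length es"
    using w(3) len by (simp add: hd_conv_nth last_conv_nth flip: length_greater_0_conv)
  have card2: "card (ends G (es ! i)) = 2" if "i < length es" for i
  proof -
    have "es ! i \<in> edges G"
      using walk_edges_subset[OF w(1)] nth_mem[OF that] by blast
    then show ?thesis
      using simple by (simp add: simple_graph_def)
  qed
  have "length es \<noteq> 1"
    using card2[of 0] walk_ends_nth[OF w(1), of 0] w(2) cyc by auto
  moreover have "length es \<noteq> 2"
  proof
    assume 2: "length es = 2"
    have "ends G (es ! 0) = ends G (es ! 1)"
      using walk_ends_nth[OF w(1), of 0] walk_ends_nth[OF w(1), of 1] cyc 2 by (auto simp: numeral_2_eq_2)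
    moreover have "es ! 0 \<in> edges G" "es ! 1 \<in> edges G"
      using walk_edges_subset[OF w(1)] 2 by auto
    ultimately have "es ! 0 = es ! 1"
      using simple by (auto simp: simple_graph_def inj_on_def)
    moreover have "0 < length es" "1 < length es"
      using 2 by simp_all
    ultimately show False
      using nth_eq_iff_index_eq[OF w(5), of 0 1] by simp
  qed
  ultimately have "3 \<le> length es"
    using w(2) length_greater_0_conv[of es] by linarith
  then show thesis
    using that w by blast
qed

context
  fixes \<sigma> :: "'e \<Rightarrow> int"
  assumes \<sigma>: "signing G \<sigma>"
begin

lemma sign_cases: "e \<in> edges G \<Longrightarrow> \<sigma> e = 1 \<or> \<sigma> e = -1"
  using \<sigma> by (auto simp: signing_def)

lemma consistent_line_cycle:
  assumes "consistent (line_graph G) \<sigma>" "line_cycle G ds"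
  shows "(\<Prod>e\<in>set ds. \<sigma> e) = 1"
  using line_cycle_imp_circle[OF assms(2)] assms(1) unfolding consistent_def by metis

text \<open>The edges of a circle in their cyclic order form a circle of the line graph, long enough
  because the graph is simple.\<close>

lemma consistent_imp_balanced:
  assumes "consistent (line_graph G) \<sigma>"
  shows "balanced G \<sigma>"
  unfolding balanced_def
proof (intro allI impI)
  fix C assume "circle G C"
  then obtain vs es where w: "walk G vs es" "hd vs = last vs" "distinct es" "3 \<le> length es" "tedges C = set es"
    by (rule circle_walk)
  have ne: "es \<noteq> []"
    using w(4) by auto
  have "line_cycle G es"
    unfolding line_cycle_def
    using w walk_successively[OF w(1)] walk_edges_subset[OF w(1)] walk_hd_edge[OF w(1) ne] walk_last_edge[OF w(1) ne]
    by auto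
  then show "track_sign \<sigma> C = 1"
    using consistent_line_cycle[OF assms] w(5) by (simp add: track_sign_def)
qed

text \<open>An edge hanging off a circle can be inserted into the corresponding circle of the line graph.\<close>

lemma consistent_pendant_positive:
  assumes cons: "consistent (line_graph G) \<sigma>" and C: "circle G C" and v: "v \<in> tverts C"
    and b: "b \<in> edges G" "v \<in> ends G b" "b \<notin> tedges C"
  shows "\<sigma> b = 1"
proof -
  obtain vs es where w: "walk G vs es" "hd vs = last vs" "distinct es" "3 \<le> length es" "tverts C = set vs" "tedges C = set es"
    using C by (rule circle_walk)
  have len: "length vs = Suc (length es)"
    using walk_length[OF w(1)] .
  obtain j where j: "j < length vs" "v = vs ! j"
    using v w(5) by (metis in_set_conv_nth)
  have ne: "es \<noteq> []" "vs \<noteq> []"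
    using w(4) len by auto
  \<comment> \<open>If \<open>v\<close> is the closing vertex, its first occurrence is taken
    instead, so that an edge of the walk starts there.\<close>
  obtain i where i: "i < length es" "v = vs ! i"
  proof (cases "j < length es")
    case False
    then have "v = last vs"
      using j len ne by (simp add: last_conv_nth less_Suc_eq)
    then show thesis
      using that[of 0] w(2) ne by (simp add: hd_conv_nth)
  qed (use j that in blast)
  have w1: "walk G (take (Suc i) vs) (take i es)" and w2: "walk G (drop i vs) (drop i es)"
    using walk_take[OF w(1)] walk_drop[OF w(1)] i by simp_all
  have t: "hd (take (Suc i) vs) = hd vs" "last (take (Suc i) vs) = v" "hd (drop i vs) = v" "last (drop i vs) = hd vs"
    using i len ne w(2) by (auto simp: take_Suc_conv_app_nth hd_append hd_conv_nth hd_drop_conv_nth)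
  \<comment> \<open>\<open>b\<close> is inserted between the two edges that meet at
    \<open>v\<close>; for \<open>i = 0\<close> it comes first and closes up with the last
    edge.\<close>
  let ?ds = "take i es @ b # drop i es"
  have ne2: "drop i es \<noteq> []"
    using i by simp
  have e2: "v \<in> ends G (hd (drop i es))" "hd vs \<in> ends G (last (drop i es))"
    using walk_hd_edge[OF w2 ne2] walk_last_edge[OF w2 ne2] t by auto
  have e1: "hd vs \<in> ends G (hd (take i es))" "v \<in> ends G (last (take i es))" if "take i es \<noteq> []"
    using walk_hd_edge[OF w1 that] walk_last_edge[OF w1 that] t by auto
  have b_set: "b \<notin> set es"
    using b w(6) by simp
  have set_ds: "set ?ds = insert b (set es)"
    by (metis Un_insert_right append_take_drop_id list.simps(15) set_append)
  have "distinct (take i es @ drop i es)"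
    using w(3) by simp
  then have dist: "distinct ?ds"
    using b_set unfolding distinct_append by (auto dest: in_set_takeD in_set_dropD)
  have succ: "successively (\<lambda>e f. ends G e \<inter> ends G f \<noteq> {}) ?ds"
    unfolding successively_append_iff successively_Cons
    using walk_successively[OF w1] walk_successively[OF w2] e1 e2 b(2) by auto
  have "ends G (last ?ds) \<inter> ends G (hd ?ds) \<noteq> {}"
  proof (cases "take i es = []")
    case True
    then have "i = 0"
      using ne by simp
    then have "v = hd vs"
      using i ne by (simp add: hd_conv_nth)
    then show ?thesis
      using True e2 b ne2 by auto
  next
    case False
    then show ?thesis
      using e1 e2 ne2 by auto
  qed
  then have "line_cycle G ?ds"
    unfolding line_cycle_def using succ dist set_ds w(4) b(1) walk_edges_subset[OF w(1)] by auto
  then have "(\<Prod>e\<in>insert b (set es). \<sigma> e) = 1"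
    using consistent_line_cycle[OF cons] set_ds by metis
  moreover have "(\<Prod>e\<in>set es. \<sigma> e) = 1"
    using consistent_imp_balanced[OF cons] C w(6) by (auto simp: balanced_def track_sign_def)
  ultimately show ?thesis
    using b_set by simp
qed

text \<open>Edges with a common end are pairwise adjacent in the line graph.\<close>

lemma consistent_triangle:
  assumes cons: "consistent (line_graph G) \<sigma>"
    and abc: "{a, b, c} \<subseteq> {e \<in> edges G. v \<in> ends G e}" "distinct [a, b, c]"
  shows "\<sigma> a * \<sigma> b * \<sigma> c = 1"
proof -
  have "line_cycle G [a, b, c]"
    using abc by (auto simp: line_cycle_def)
  then show ?thesis
    using consistent_line_cycle[OF cons, of "[a, b, c]"] abc by (simp add: mult.assoc)
qed

lemma consistent_imp_property2:
  assumes cons: "consistent (line_graph G) \<sigma>"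
  shows "property2 G \<sigma>"
  unfolding property2_def
proof (intro ballI conjI impI allI)
  fix v assume v: "v \<in> verts G"
  let ?E = "{e \<in> edges G. v \<in> ends G e}"
  have deg: "degree G v = card ?E"
    using simple_deg_in[of "edges G" v] degree_eq_deg_in[OF simple_finite] by simp
  have neg: "neg_degree G \<sigma> v = card {e \<in> ?E. \<sigma> e = -1}"
    using simple_deg_in[of "neg_edges G \<sigma>" v] neg_degree_eq_deg_in[OF simple_finite, of \<sigma> v]
    by (simp add: conj_commute conj_left_commute)
  have fin: "finite ?E"
    using simple_finite by simp
  show "neg_degree G \<sigma> v = 0" if "degree G v > 3"
  proof (rule ccontr)
    assume "neg_degree G \<sigma> v \<noteq> 0"
    then obtain a where a: "a \<in> ?E" "\<sigma> a = -1"
      unfolding neg using fin by (auto simp: card_gt_0_iff)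
    \<comment> \<open>Beside a negative \<open>a\<close>, any two of three further edges at
      \<open>v\<close> would need opposite signs, which three edges cannot satisfy.\<close>
    have "3 \<le> card (?E - {a})"
      using that a fin by (simp add: deg card_Diff_singleton)
    then obtain B where B: "B \<subseteq> ?E - {a}" "card B = 3"
      by (rule obtain_subset_with_card_n)
    then obtain b c d where "B = {b, c, d}" "distinct [b, c, d]"
      by (auto simp: card_3_iff)
    then have "{b, c, d} \<subseteq> ?E - {a}" "distinct [b, c, d]"
      using B by auto
    then have prods: "\<sigma> a * \<sigma> b * \<sigma> c = 1" "\<sigma> a * \<sigma> b * \<sigma> d = 1" "\<sigma> a * \<sigma> c * \<sigma> d = 1"
      and e: "b \<in> edges G" "c \<in> edges G" "d \<in> edges G"
      using a consistent_triangle[OF cons, of a b c v] consistent_triangle[OF cons, of a b d v]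
        consistent_triangle[OF cons, of a c d v] by auto
    show False
      using sign_cases[OF e(1)] sign_cases[OF e(2)] sign_cases[OF e(3)] a(2) prods by (elim disjE) simp_all
  qed
  show "neg_degree G \<sigma> v \<in> {0, 2}" if d3: "degree G v = 3"
  proof -
    obtain a b c where abc: "?E = {a, b, c}" "a \<noteq> b" "a \<noteq> c" "b \<noteq> c"
      using d3 unfolding deg card_3_iff by blast
    then have e: "a \<in> edges G" "b \<in> edges G" "c \<in> edges G"
      by auto
    have "\<sigma> a * \<sigma> b * \<sigma> c = 1"
      using consistent_triangle[OF cons, of a b c v] abc by auto
    moreover have "card {e \<in> ?E. \<sigma> e = -1} = (\<Sum>e\<in>{a, b, c}. of_bool (\<sigma> e = -1))"
      unfolding abc(1) by (subst sum_of_bool_eq) (auto intro: arg_cong[where f = card])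
    ultimately show ?thesis
      using abc(2-4) sign_cases[OF e(1)] sign_cases[OF e(2)] sign_cases[OF e(3)] unfolding neg by auto
  qed
  show "{e \<in> edges G. v \<in> ends G e \<and> \<sigma> e = -1} \<subseteq> tedges C" if "circle G C \<and> v \<in> tverts C" for C
    using consistent_pendant_positive[OF cons, of C v] that by force
qed

text \<open>Let \<open>w i\<close> be a vertex common to \<open>a i\<close> and
  \<open>a (Suc i)\<close>. The edge \<open>a (Suc i)\<close> is passed from \<open>w i\<close> to
  \<open>w (Suc i)\<close> if these differ, and only touched if they agree. The passed edges form
  the even set \<open>A\<close>.\<close>

lemma property2_balanced_imp_consistent:
  assumes p2: "property2 G \<sigma>" and bal: "balanced G \<sigma>"
  shows "consistent (line_graph G) \<sigma>"
  unfolding consistent_def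
proof (intro allI impI)
  fix C assume "circle (line_graph G) C"
  then obtain a :: "nat \<Rightarrow> 'e" and k where k: "3 \<le> k" and a: "\<And>i j. a i = a j \<longleftrightarrow> i mod k = j mod k"
    and meet: "\<And>i. ends G (a i) \<inter> ends G (a (Suc i)) \<noteq> {}" and C: "tverts C = a ` {..<k}" "tverts C \<subseteq> edges G"
    by (rule line_circle_indexed) blast
  define w where "w i = (SOME x. x \<in> ends G (a i) \<inter> ends G (a (Suc i)))" for i
  have "w i \<in> ends G (a i) \<inter> ends G (a (Suc i))" for i
    unfolding w_def some_in_eq by (rule meet)
  then have w: "w i \<in> ends G (a i)" "w i \<in> ends G (a (Suc i))" for i
    by auto
  have a_shift: "a (i + k) = a i" for i
    by (simp add: a)
  \<comment> \<open>The choice of \<open>w i\<close> depends only on the two edges, so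
    \<open>w\<close> inherits the period.\<close>
  then have w_shift: "w (i + k) = w i" for i
    using a_shift[of i] a_shift[of "Suc i"] by (simp add: w_def)
  have a_mod: "a i = a (i mod k)" for i
    by (simp add: a)
  have aE: "a i \<in> edges G" for i
  proof -
    have "a i \<in> a ` {..<k}"
      using a_mod[of i] k by auto
    then show ?thesis
      using C by blast
  qed
  have image: "a ` Suc ` {..<k} = a ` {..<k}"
  proof -
    have "a k = a 0"
      using a_shift[of 0] by simp
    moreover have "insert 0 (Suc ` {..<k}) = insert k {..<k}"
      by (metis lessThan_Suc lessThan_Suc_eq_insert_0)
    then have "insert (a 0) (a ` Suc ` {..<k}) = insert (a k) (a ` {..<k})"
      by (metis image_insert)
    moreover have "a k \<in> a ` Suc ` {..<k}"
      using k by (intro imageI image_eqI[of _ _ "k - 1"]) auto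
    moreover have "a 0 \<in> a ` {..<k}"
      using k by auto
    ultimately show ?thesis
      by (metis insert_absorb)
  qed
  have inj: "inj_on (\<lambda>i. a (Suc i)) {..<k}"
  proof (rule inj_onI)
    fix i j assume "i \<in> {..<k}" "j \<in> {..<k}" "a (Suc i) = a (Suc j)"
    then show "i = j"
      using k by (auto simp: a mod_Suc split: if_splits)
  qed
  define I where "I = {i \<in> {..<k}. w i \<noteq> w (Suc i)}"
  define A where "A = (\<lambda>i. a (Suc i)) ` I"
  have ends_I: "ends G (a (Suc i)) = {w i, w (Suc i)}" if "w i \<noteq> w (Suc i)" for i
  proof -
    have "card (ends G (a (Suc i))) = 2"
      using simple aE by (simp add: simple_graph_def)
    moreover have "{w i, w (Suc i)} \<subseteq> ends G (a (Suc i))"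
      using w by auto
    ultimately show ?thesis
      using that by (intro sym[OF card_subset_eq]) (auto simp: card_gt_0_iff intro: card_ge_0_finite)
  qed
  have AE: "A \<subseteq> edges G"
    using aE by (auto simp: A_def)
  \<comment> \<open>Over a full period each \<open>w i\<close> is counted once as a start and once
    as an end. The touched edges contribute 0 or 2 to this count, so leaving them out keeps it
    even.\<close>
  have evenA: "even_set (ends G) A"
    unfolding even_set_def
  proof (intro conjI allI)
    show "finite A"
      by (simp add: A_def I_def)
    fix v
    let ?f = "\<lambda>i. of_bool (w i = v) + of_bool (w (Suc i) = v) :: nat"
    have "deg_in (ends G) A v = (\<Sum>i\<in>I. inc (ends G) (a (Suc i)) v)"
      unfolding deg_in_def A_def
      by (subst sum.reindex) (auto intro: inj_on_subset[OF inj] simp: I_def)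
    also have "\<dots> = (\<Sum>i\<in>I. ?f i)"
      using ends_I by (intro sum.cong) (auto simp: I_def inc_def)
    finally have d: "deg_in (ends G) A v = (\<Sum>i\<in>I. ?f i)" .
    have "(\<Sum>i<k. ?f i) = (\<Sum>i\<in>I. ?f i) + (\<Sum>i\<in>{..<k} - I. ?f i)"
      by (subst sum.subset_diff[of I]) (auto simp: I_def)
    moreover have "even (\<Sum>i\<in>{..<k} - I. ?f i)"
      by (intro dvd_sum) (auto simp: I_def)
    moreover have "even (\<Sum>i<k. ?f i)"
    proof -
      have "(\<Sum>i<k. of_bool (w (Suc i) = v)) + of_bool (w 0 = v) = (\<Sum>i<k. of_bool (w i = v)) + (of_bool (w k = v) :: nat)"
        using sum.lessThan_Suc[of "\<lambda>i. of_bool (w i = v) :: nat" k] sum.lessThan_Suc_shift[of "\<lambda>i. of_bool (w i = v) :: nat" k]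
        by simp
      then have "(\<Sum>i<k. of_bool (w (Suc i) = v)) = (\<Sum>i<k. of_bool (w i = v) :: nat)"
        using w_shift[of 0] by simp
      then show ?thesis
        by (simp add: sum.distrib)
    qed
    ultimately show "even (deg_in (ends G) A v)"
      unfolding d by (simp only: even_add)
  qed
  have prodA: "(\<Prod>e\<in>A. \<sigma> e) = 1"
    using bal balanced_iff_even_sets[OF simple_is_graph] AE evenA by blast
  have split: "(\<Prod>e\<in>tverts C. \<sigma> e) = (\<Prod>i\<in>{..<k} - I. \<sigma> (a (Suc i)))"
  proof -
    have "(\<Prod>e\<in>tverts C. \<sigma> e) = (\<Prod>i<k. \<sigma> (a (Suc i)))"
      using prod.reindex[OF inj, of \<sigma>] image C by (simp add: image_image)
    also have "\<dots> = (\<Prod>i\<in>{..<k} - I. \<sigma> (a (Suc i))) * (\<Prod>i\<in>I. \<sigma> (a (Suc i)))"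
      by (rule prod.subset_diff) (auto simp: I_def)
    also have "(\<Prod>i\<in>I. \<sigma> (a (Suc i))) = 1"
      using prodA inj_on_subset[OF inj, of I] unfolding A_def by (subst (asm) prod.reindex) (auto simp: I_def)
    finally show ?thesis
      by simp
  qed
  show "(\<Prod>e\<in>tverts C. \<sigma> e) = 1"
  \<comment> \<open>By \<open>split\<close> only a negative touched edge can do harm.\<close>
  proof (cases "\<exists>i<k. w i = w (Suc i) \<and> \<sigma> (a (Suc i)) = -1")
    case False
    then have "\<sigma> (a (Suc i)) = 1" if "i \<in> {..<k} - I" for i
      using that sign_cases[OF aE] by (auto simp: I_def)
    then show ?thesis
      unfolding split by (intro prod.neutral) blast
  next
    case True
    then obtain i where i: "w i = w (Suc i)" "\<sigma> (a (Suc i)) = -1"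
      by blast
    define v where "v = w i"
    \<comment> \<open>A touched edge and both its neighbours in the circle contain \<open>v\<close>.
      These are three edges, one of them negative, so Property 2 leaves no further edge at
      \<open>v\<close>.\<close>
    have at_v: "v \<in> ends G (a i)" "v \<in> ends G (a (Suc i))" "v \<in> ends G (a (Suc (Suc i)))"
      using w[of i] w[of "Suc i"] i by (auto simp: v_def)
    have dist: "a i \<noteq> a (Suc i)" "a (Suc i) \<noteq> a (Suc (Suc i))" "a i \<noteq> a (Suc (Suc i))"
      using k by (auto simp: a mod_Suc split: if_splits)
    let ?T = "{a i, a (Suc i), a (Suc (Suc i))}"
    let ?E = "{e \<in> edges G. v \<in> ends G e}"
    have sub: "?T \<subseteq> ?E"
      using at_v aE by auto
    have vG: "v \<in> verts G"
      using at_v aE simple_is_graph by (auto simp: is_graph_def)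
    have deg: "degree G v = card ?E"
      using simple_deg_in[of "edges G" v] degree_eq_deg_in[OF simple_finite] by simp
    have cardT: "card ?T = 3"
      using dist by simp
    have "0 < neg_degree G \<sigma> v"
      using neg_degree_pos_iff[OF simple_finite, of \<sigma> v] i aE at_v by auto
    moreover have "3 \<le> degree G v"
      unfolding deg cardT[symmetric] using sub simple_finite by (intro card_mono) auto
    moreover have "degree G v > 3 \<longrightarrow> neg_degree G \<sigma> v = 0" "degree G v = 3 \<longrightarrow> neg_degree G \<sigma> v \<in> {0, 2}"
      using p2 vG by (simp_all add: property2_def)
    ultimately have d3: "degree G v = 3" and n2: "neg_degree G \<sigma> v = 2"
      by auto
    have E: "?E = ?T"
      using sub simple_finite cardT d3 deg by (intro sym[OF card_subset_eq]) auto
    have "neg_degree G \<sigma> v = card {e \<in> ?E. \<sigma> e = -1}"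
      using simple_deg_in[of "neg_edges G \<sigma>" v] neg_degree_eq_deg_in[OF simple_finite, of \<sigma> v]
      by (simp add: conj_commute conj_left_commute)
    then have two: "card {e \<in> ?T. \<sigma> e = -1} = 2"
      using n2 unfolding E by simp
    \<comment> \<open>A positive edge at \<open>v\<close> lies on no circle and hence in no even
      set.\<close>
    have not_A: "e \<notin> A" if "e \<in> ?T" "\<sigma> e \<noteq> -1" for e
    proof
      assume "e \<in> A"
      then obtain D where "circle G D" "e \<in> tedges D"
        using even_set_contains_circle[OF simple_is_graph evenA AE] by blast
      then show False
        using property2_positive_not_in_circle[OF p2 simple_is_graph vG n2] that sub by blast
    qed
    have in_A: "a (Suc j) \<in> A" if "w j \<noteq> w (Suc j)" for j
    proof -
      have "w (j mod k) = w j" "w (Suc (j mod k)) = w (Suc j)" "a (Suc (j mod k)) = a (Suc j)"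
      proof -
        show "a (Suc (j mod k)) = a (Suc j)"
          by (simp add: a mod_Suc_eq)
        moreover have "a (Suc (Suc (j mod k))) = a (Suc (Suc j))"
          unfolding a by (metis mod_Suc_eq)
        ultimately show "w (j mod k) = w j" "w (Suc (j mod k)) = w (Suc j)"
          using a_mod[of j] by (simp_all add: w_def)
      qed
      moreover from this have "j mod k \<in> I"
        using that k by (simp add: I_def)
      ultimately show ?thesis
        unfolding A_def by (metis image_eqI)
    qed
    \<comment> \<open>Just two of the three edges at \<open>v\<close> are negative, so one neighbour
      is positive. Not being in \<open>A\<close>, it is only touched, and the edge beyond it
      contains \<open>v\<close> as well; for \<open>k > 3\<close> this would be a fourth edge
      there.\<close>
    have k3: "k = 3"
    proof (rule ccontr)
      assume "k \<noteq> 3"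
      then have k4: "4 \<le> k"
        using k by simp
      have "\<sigma> (a i) \<noteq> -1 \<or> \<sigma> (a (Suc (Suc i))) \<noteq> -1"
      proof (rule ccontr)
        assume "\<not> ?thesis"
        then have "{e \<in> ?T. \<sigma> e = -1} = ?T"
          using i by auto
        then show False
          using two cardT by simp
      qed
      then show False
      proof
        assume "\<sigma> (a (Suc (Suc i))) \<noteq> -1"
        then have "w (Suc i) = w (Suc (Suc i))"
          using not_A[of "a (Suc (Suc i))"] in_A[of "Suc i"] by blast
        then have "v \<in> ends G (a (Suc (Suc (Suc i))))"
          using w(2)[of "Suc (Suc i)"] i by (simp add: v_def)
        then have "a (Suc (Suc (Suc i))) \<in> ?T"
          using E aE by blast
        then show False
          using k4 by (auto simp: a mod_Suc split: if_splits)
      next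
        assume *: "\<sigma> (a i) \<noteq> -1"
        \<comment> \<open>\<open>j\<close> stands for \<open>i - 1\<close> modulo \<open>k\<close>;
          adding \<open>k\<close> avoids truncated subtraction at 0.\<close>
        define j where "j = i + k - 1"
        have j: "Suc j = i + k"
          using k by (simp add: j_def)
        have "a (Suc j) \<notin> A"
          using not_A[of "a i"] * a_shift[of i] j by simp
        then have "w j = w (Suc j)"
          using in_A by blast
        then have "v \<in> ends G (a j)"
          using w(1)[of j] w_shift[of i] j by (simp add: v_def)
        then have "a j \<in> ?T"
          using E aE by blast
        moreover have "a i = a (Suc j)" "a (Suc i) = a (Suc (Suc j))" "a (Suc (Suc i)) = a (Suc (Suc (Suc j)))"
          using a_shift[of i] a_shift[of "Suc i"] a_shift[of "Suc (Suc i)"] j by simp_all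
        ultimately have "a j \<in> {a (Suc j), a (Suc (Suc j)), a (Suc (Suc (Suc j)))}"
          by simp
        then show False
          using k4 by (auto simp: a mod_Suc split: if_splits)
      qed
    qed
    \<comment> \<open>With \<open>k = 3\<close> the circle is the triangle of the edges at
      \<open>v\<close>, whose two negative signs cancel.\<close>
    have "?T \<subseteq> tverts C"
      using a_mod[of i] a_mod[of "Suc i"] a_mod[of "Suc (Suc i)"] k unfolding C by auto
    moreover have "card (tverts C) \<le> 3"
      unfolding C using card_image_le[of "{..<k}" a] k3 by simp
    moreover have "finite (tverts C)"
      unfolding C by simp
    ultimately have "tverts C = ?T"
      using cardT by (intro sym[OF card_seteq]) auto
    moreover have "(\<Prod>e\<in>?T. \<sigma> e) = (\<Prod>e\<in>{e \<in> ?T. \<sigma> e = -1}. \<sigma> e)"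
      using sign_cases[OF aE] by (intro prod.mono_neutral_right) auto
    moreover have "\<dots> = (\<Prod>e\<in>{e \<in> ?T. \<sigma> e = -1}. -1)"
      by (rule prod.cong) auto
    ultimately show ?thesis
      using two by simp
  qed
qed

lemma consistent_iff: "consistent (line_graph G) \<sigma> \<longleftrightarrow> property2 G \<sigma> \<and> balanced G \<sigma>"
  using consistent_imp_balanced consistent_imp_property2 property2_balanced_imp_consistent by blast

end

end

theorem theorem4p1:
  fixes \<Gamma> :: "('v, 'e) graph" and \<sigma> :: "'e \<Rightarrow> int"
  assumes "signed_graph \<Gamma> \<sigma>"
  shows "((property2 \<Gamma> \<sigma> \<longleftrightarrow> constructionA \<Gamma> \<sigma>) \<and>
          (property2 \<Gamma> \<sigma> \<longleftrightarrow> constructionB \<Gamma> \<sigma>) \<and>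
          (property2 \<Gamma> \<sigma> \<longleftrightarrow> constructionC \<Gamma> \<sigma>)) \<and>
         (simple_graph \<Gamma> \<longrightarrow>
          (consistent (line_graph \<Gamma>) \<sigma> \<longleftrightarrow> constructionA \<Gamma> \<sigma> \<and> balanced \<Gamma> \<sigma>) \<and>
          (consistent (line_graph \<Gamma>) \<sigma> \<longleftrightarrow> constructionB \<Gamma> \<sigma> \<and> balanced \<Gamma> \<sigma>) \<and>
          (consistent (line_graph \<Gamma>) \<sigma> \<longleftrightarrow> constructionC \<Gamma> \<sigma> \<and> balanced \<Gamma> \<sigma>) \<and>
          (consistent (line_graph \<Gamma>) \<sigma> \<longleftrightarrow> constructionD \<Gamma> \<sigma>))"
proof -
  have G: "is_graph \<Gamma>" and \<sigma>: "signing \<Gamma> \<sigma>"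
    using assms by (auto simp: signed_graph_def)
  have A: "property2 \<Gamma> \<sigma> \<longleftrightarrow> constructionA \<Gamma> \<sigma>"
    using property2_imp_constructionA[OF G \<sigma>] constructionA_imp_property2[OF \<sigma>] by blast
  have C: "property2 \<Gamma> \<sigma> \<longleftrightarrow> constructionC \<Gamma> \<sigma>"
    using property2_imp_constructionC[OF G \<sigma>] constructionC_imp_property2 by blast
  have B: "property2 \<Gamma> \<sigma> \<longleftrightarrow> constructionB \<Gamma> \<sigma>"
    using C constructionB_iff_constructionC[OF \<sigma>] by simp
  show ?thesis
    using A B C consistent_iff[OF _ \<sigma>] constructionD_iff[of \<Gamma> \<sigma>] by blast
qed

end
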